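(* Let $S$ be a semitopological semigroup. Then $WAP(S)$ has a left invariant mean if and only if $S$ has the following fixed point property $(F)$: for every locally convex space $X$ whose topology is determined by a family $Q$ of continuous seminorms and every nonempty weakly compact convex subset $K$ of $X$, every $Q$-nonexpansive dynamical system $(S,(K,\mathrm{weak}))$ such that the enveloping semigroup $E(S,(K,\mathrm{weak}))$ consists of (weakly) continuous functions $K\to K$ has a fixed point.
   Context: A semitopological semigroup is a (nonempty) semigroup $S$ with a Hausdorff topology such that for each $t\in S$ the maps $s\mapsto ts$ and $s\mapsto st$ are continuous. $\ell^\infty(S)$ is the Banach space of bounded complex-valued functions on $S$ with the supremum norm; for $s\in S$, $L_sf(t)=f(st)$ and $R_sf(t)=f(ts)$. $C(S)$ is the closed subalgebra of bounded continuous functions. $WAP(S)$ is the space of weakly almost periodic functions: those $f\in C(S)$ for which $\{L_sf:s\in S\}$ is relatively compact in the weak topology of $C(S)$. If $Y$ is a closed linear subspace of $\ell^\infty(S)$ containing constants with $L_s(Y)\subset Y$, $R_s(Y)\subset Y$ for all $s$ (as is $WAP(S)$), a left invariant mean (LIM) on $Y$ is $\mu\in Y^*$ with $\|\mu\|=\mu(1)=1$ and $\mu(L_sf)=\mu(f)$ for all $s\in S$, $f\in Y$. Locally convex spaces are Hausdorff. A dynamical system $(S,K)$ consists of a semitopological semigroup $S$, a topological space $K$ and an action $S\times K\to K$, $(s,x)\mapsto sx$, with $s_1(s_2x)=(s_1s_2)x$, which is separately continuous (all maps $s\mapsto sx$ and all translations $\lambda_s:x\mapsto sx$ are continuous). $(S,(K,\mathrm{weak}))$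 means that $K$ carries the weak topology. The enveloping semigroup $E(S,K)$ of a compact dynamical system is the closure of $\{\lambda_s:s\in S\}$ in $K^K$ with the product topology. For $K$ in a locally convex space with topology determined by the family $Q$ of seminorms, the system is $Q$-nonexpansive if $p(sx-sy)\le p(x-y)$ for all $p\in Q$, $s\in S$, $x,y\in K$. A fixed point is $x\in K$ with $sx=x$ for all $s\in S$. *)

theory Defs
  imports "HOL-Analysis.Analysis" "HOL-Library.Function_Algebras"
begin

section \<open>Locally convex spaces\<close>

text \<open>
  A locally convex space over the scalar field \<open>'k\<close> (to be instantiated with the reals or the
  complex numbers) is a linear subspace \<open>X\<close> of an ambient \<open>'k\<close>-vector space with underlying type
  \<open>'x\<close>, together with a family \<open>Q\<close> of seminorms on \<open>X\<close> whose topology is Hausdorff.  Every notion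
  below only looks at the values of seminorms and functionals on \<open>X\<close>.
\<close>

definition seminorm_on ::
    "('k::real_normed_field \<Rightarrow> 'x::ab_group_add \<Rightarrow> 'x) \<Rightarrow> 'x set \<Rightarrow> ('x \<Rightarrow> real) \<Rightarrow> bool" where
  "seminorm_on scl X p \<longleftrightarrow>
     (\<forall>x\<in>X. 0 \<le> p x) \<and>
     (\<forall>x\<in>X. \<forall>y\<in>X. p (x + y) \<le> p x + p y) \<and>
     (\<forall>c. \<forall>x\<in>X. p (scl c x) = norm c * p x)"

text \<open>The set \<open>X\<close> itself is in the subbase so that the space is \<open>X\<close> even when \<open>Q\<close> is empty.\<close>

definition seminorm_topology :: "'x::ab_group_add set \<Rightarrow> ('x \<Rightarrow> real) set \<Rightarrow> 'x topology" where
  "seminorm_topology X Q =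
     topology_generated_by
       (insert X {{y \<in> X. p (y - x) < r} | p x r. p \<in> Q \<and> x \<in> X \<and> 0 < r})"

locale locally_convex_space = vector_space scl
  for scl :: "'k::real_normed_field \<Rightarrow> 'x::ab_group_add \<Rightarrow> 'x" +
  fixes X :: "'x set" and Q :: "('x \<Rightarrow> real) set"
  assumes subspace_carrier: "subspace X"
    and seminorms: "\<And>p. p \<in> Q \<Longrightarrow> seminorm_on scl X p"
    and Hausdorff: "Hausdorff_space (seminorm_topology X Q)"

definition linear_functional_on ::
    "('k::real_normed_field \<Rightarrow> 'x::ab_group_add \<Rightarrow> 'x) \<Rightarrow> 'x set \<Rightarrow> ('x \<Rightarrow> 'k) \<Rightarrow> bool" where
  "linear_functional_on scl X \<phi> \<longleftrightarrow>
     (\<forall>x\<in>X. \<forall>y\<in>X. \<phi> (x + y) = \<phi> x + \<phi> y) \<and>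
     (\<forall>c. \<forall>x\<in>X. \<phi> (scl c x) = c * \<phi> x)"

definition continuous_dual ::
    "('k::real_normed_field \<Rightarrow> 'x::ab_group_add \<Rightarrow> 'x) \<Rightarrow> 'x set \<Rightarrow> ('x \<Rightarrow> real) set \<Rightarrow> ('x \<Rightarrow> 'k) set"
  where
  "continuous_dual scl X Q =
     {\<phi>. linear_functional_on scl X \<phi> \<and> continuous_map (seminorm_topology X Q) euclidean \<phi>}"

definition weak_topology ::
    "('k::real_normed_field \<Rightarrow> 'x::ab_group_add \<Rightarrow> 'x) \<Rightarrow> 'x set \<Rightarrow> ('x \<Rightarrow> real) set \<Rightarrow> 'x topology"
  where
  "weak_topology scl X Q =
     topology_generated_by
       (insert X {{x \<in> X. \<phi> x \<in> V} | \<phi> V. \<phi> \<in> continuous_dual scl X Q \<and> open V})"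

definition convex_on_scale ::
    "('k::real_normed_field \<Rightarrow> 'x::ab_group_add \<Rightarrow> 'x) \<Rightarrow> 'x set \<Rightarrow> bool" where
  "convex_on_scale scl K \<longleftrightarrow>
     (\<forall>x\<in>K. \<forall>y\<in>K. \<forall>t::real. 0 \<le> t \<and> t \<le> 1 \<longrightarrow>
        scl (of_real (1 - t)) x + scl (of_real t) y \<in> K)"


section \<open>Weakly almost periodic functions and invariant means\<close>

class semitopological_semigroup = t2_space + semigroup_mult +
  assumes tendsto_mult_left_at: "\<And>t a. ((\<lambda>s. t * s) \<longlongrightarrow> t * a) (at a)"
    and tendsto_mult_right_at: "\<And>t a. ((\<lambda>s. s * t) \<longlongrightarrow> a * t) (at a)"

definition left_translate :: "'s::semigroup_mult \<Rightarrow> ('s \<Rightarrow> complex) \<Rightarrow> ('s \<Rightarrow> complex)" where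
  "left_translate s f = (\<lambda>t. f (s * t))"

definition scale_fun :: "complex \<Rightarrow> ('s \<Rightarrow> complex) \<Rightarrow> ('s \<Rightarrow> complex)" where
  "scale_fun c f = (\<lambda>t. c * f t)"

text \<open>Only meaningful for bounded functions.\<close>

definition sup_norm :: "('s \<Rightarrow> complex) \<Rightarrow> real" where
  "sup_norm f = (SUP t. norm (f t))"

definition bounded_continuous :: "('s::topological_space \<Rightarrow> complex) set" where
  "bounded_continuous = {f. continuous_on UNIV f \<and> bounded (range f)}"

definition WAP :: "('s::semitopological_semigroup \<Rightarrow> complex) set" where
  "WAP = {f \<in> bounded_continuous.
     compactin (weak_topology scale_fun bounded_continuous {sup_norm})
       (weak_topology scale_fun bounded_continuous {sup_norm}
          closure_of range (\<lambda>s. left_translate s f))}"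

definition functional_norm ::
    "('s \<Rightarrow> complex) set \<Rightarrow> (('s \<Rightarrow> complex) \<Rightarrow> complex) \<Rightarrow> real" where
  "functional_norm Y \<mu> = (SUP f \<in> {f \<in> Y. sup_norm f \<le> 1}. norm (\<mu> f))"

definition left_invariant_mean ::
    "('s::semigroup_mult \<Rightarrow> complex) set \<Rightarrow> (('s \<Rightarrow> complex) \<Rightarrow> complex) \<Rightarrow> bool" where
  "left_invariant_mean Y \<mu> \<longleftrightarrow>
     \<mu> \<in> continuous_dual scale_fun Y {sup_norm} \<and>
     functional_norm Y \<mu> = 1 \<and> \<mu> (\<lambda>_. 1) = 1 \<and>
     (\<forall>s. \<forall>f\<in>Y. \<mu> (left_translate s f) = \<mu> f)"


section \<open>Dynamical systems\<close>

text \<open>The phase space is \<open>topspace T\<close>; the values of \<open>act s\<close> outside of it are irrelevant.\<close>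

locale dynamical_system =
  fixes act :: "'s::semitopological_semigroup \<Rightarrow> 'a \<Rightarrow> 'a" and T :: "'a topology"
  assumes act_act: "\<And>s t x. x \<in> topspace T \<Longrightarrow> act s (act t x) = act (s * t) x"
    and continuous_orbit: "\<And>x. x \<in> topspace T \<Longrightarrow> continuous_map euclidean T (\<lambda>s. act s x)"
    and continuous_translation: "\<And>s. continuous_map T T (act s)"

text \<open>Self-maps of the phase space are represented by extensional functions.\<close>

definition enveloping_semigroup :: "('s \<Rightarrow> 'a \<Rightarrow> 'a) \<Rightarrow> 'a topology \<Rightarrow> ('a \<Rightarrow> 'a) set" where
  "enveloping_semigroup act T =
     product_topology (\<lambda>_. T) (topspace T)
       closure_of range (\<lambda>s. restrict (act s) (topspace T))"

definition nonexpansive ::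
    "('x::ab_group_add \<Rightarrow> real) set \<Rightarrow> ('s \<Rightarrow> 'x \<Rightarrow> 'x) \<Rightarrow> 'x set \<Rightarrow> bool" where
  "nonexpansive Q act K \<longleftrightarrow>
     (\<forall>p\<in>Q. \<forall>s. \<forall>x\<in>K. \<forall>y\<in>K. p (act s x - act s y) \<le> p (x - y))"

text \<open>
  The fixed point property (F) of the semigroup \<open>'s\<close> for all locally convex spaces over the scalar
  field \<open>'k\<close> with carrier in \<open>'x\<close>.  Since a formula cannot quantify over types, a property of all
  locally convex spaces has to be stated for all \<open>'x\<close> where it is concluded; where it is assumed,
  the type \<open>('s \<Rightarrow> complex) \<Rightarrow> complex\<close>, which contains the dual of \<open>WAP\<close> as a subspace, is enough.
\<close>

definition fixed_point_property ::
    "'s::semitopological_semigroup itself \<Rightarrow> 'k::real_normed_field itself \<Rightarrow>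
     'x::ab_group_add itself \<Rightarrow> bool" where
  "fixed_point_property _ _ _ \<longleftrightarrow>
     (\<forall>(scl :: 'k \<Rightarrow> 'x \<Rightarrow> 'x) X Q K (act :: 's \<Rightarrow> 'x \<Rightarrow> 'x).
        locally_convex_space scl X Q \<longrightarrow>
        K \<noteq> {} \<longrightarrow>
        compactin (weak_topology scl X Q) K \<longrightarrow>
        convex_on_scale scl K \<longrightarrow>
        dynamical_system act (subtopology (weak_topology scl X Q) K) \<longrightarrow>
        nonexpansive Q act K \<longrightarrow>
        (\<forall>f \<in> enveloping_semigroup act (subtopology (weak_topology scl X Q) K).
           continuous_map (subtopology (weak_topology scl X Q) K)
             (subtopology (weak_topology scl X Q) K) f) \<longrightarrow>
        (\<exists>x\<in>K. \<forall>s. act s x = x))"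

end

theory Submission
  imports Defs
begin

text \<open>
  From a mean to fixed points: let \<open>E\<close> be the enveloping semigroup, a compact semitopological semigroup.
  For continuous \<open>h\<close> on \<open>E\<close> the function \<open>s \<mapsto> h (\<lambda>\<^sub>s)\<close> is weakly almost periodic by
  Grothendieck's theorem, so a left invariant mean prevents disjoint closed right ideals in \<open>E\<close>.
  Hence, for a minimal idempotent \<open>e\<close>, \<open>G = e E e\<close> is a compact group with \<open>\<lambda>\<^sub>s G = G\<close> for all \<open>s\<close>.  The
  elements of \<open>E\<close> are nonexpansive, and by a Baire category argument the orbits of \<open>G\<close> are totally
  bounded for every seminorm.  If \<open>K\<^sub>0\<close> is a minimal invariant closed convex set and \<open>x \<in> e K\<^sub>0\<close>, then
  \<open>F = G x\<close> satisfies \<open>s F = F\<close>; were \<open>F\<close> not a point, a non-diametral point of its convex hull would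
  contradict the minimality of \<open>K\<^sub>0\<close>, as in DeMarr's theorem.

  From fixed points to a mean: \<open>S\<close> acts on the means on \<open>WAP\<close> by the adjoints of the left translations.
  For the seminorms of uniform convergence on weakly compact translation invariant sets this action is
  nonexpansive, and by Grothendieck's theorem again the weak topology on the means is that of pointwise
  convergence.
\<close>

section \<open>Hahn-Banach separation\<close>

text \<open>The obstacle is that \<open>K\<close> is only weakly compact, while a non-diametral
  point in the style of DeMarr requires a set that is totally bounded for the seminorm at hand. The
  orbit of a group provides one: small oscillation at one place is carried everywhere by
  nonexpansive group elements. Grothendieck's theorem is used in the single form
  \<open>dominated_functional_continuous\<close>: \<open>k\<close> \<mapsto> \<open>H k\<close> is
  weakly continuous into the functions on \<open>TA\<close>. The functional enters only through an
  inequality for finite linear combinations, so neither a Banach space of continuous functions nor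
  measures representing its dual appear. For a fixed point, \<open>H\<close> is
  \<open>h (\<xi> \<circ> \<eta>)\<close> on pairs from \<open>E\<close>; for a mean,
  \<open>H\<close> is the pairing of means with a weakly compact set of functions. On the means, a
  single evaluation \<bar>\<mu> f\<bar> is in general not nonexpansive, because the action moves
  \<open>f\<close>; the supremum over a translation invariant set is. Weak compactness of that set
  keeps the seminorm weak enough for the means to stay weakly compact. \<open>S\<close> need not
  have a unit, so neither \<open>f\<close> in its own orbit closure nor the identity in
  \<open>E\<close> can be taken for granted.\<close>

definition sublinear_on :: "(real \<Rightarrow> 'x::ab_group_add \<Rightarrow> 'x) \<Rightarrow> 'x set \<Rightarrow> ('x \<Rightarrow> real) \<Rightarrow> bool" where
  "sublinear_on scl X q \<longleftrightarrow>
     (\<forall>x\<in>X. \<forall>y\<in>X. q (x + y) \<le> q x + q y) \<and> (\<forall>t\<ge>0. \<forall>x\<in>X. q (scl t x) = t * q x)"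

locale real_subspace = vector_space scl
  for scl :: "real \<Rightarrow> 'x::ab_group_add \<Rightarrow> 'x" +
  fixes X :: "'x set"
  assumes subspace_X: "subspace X"
begin

lemma zero_mem: "0 \<in> X" and add_mem: "x \<in> X \<Longrightarrow> y \<in> X \<Longrightarrow> x + y \<in> X"
  and scale_mem: "x \<in> X \<Longrightarrow> scl c x \<in> X" and neg_mem: "x \<in> X \<Longrightarrow> - x \<in> X"
  and diff_mem: "x \<in> X \<Longrightarrow> y \<in> X \<Longrightarrow> x - y \<in> X"
  using subspace_X by (auto intro: subspace_0 subspace_add subspace_scale subspace_neg subspace_diff)

text \<open>One inequality for positive scalars is enough: applied to \<open>1/t\<close> and
  \<open>scl t x\<close> it gives the reverse one, and together with subadditivity it forces
  \<open>q 0 = 0\<close>.\<close>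

lemma sublinear_onI:
  assumes add: "\<And>x y. x \<in> X \<Longrightarrow> y \<in> X \<Longrightarrow> q (x + y) \<le> q x + q y"
    and scale: "\<And>t x. t > 0 \<Longrightarrow> x \<in> X \<Longrightarrow> q (scl t x) \<le> t * q x"
  shows "sublinear_on scl X q"
proof -
  have "q 0 \<ge> 0" using add[of 0 0] zero_mem by simp
  moreover have "q 0 \<le> 0" using scale[of "1/2" 0] zero_mem by simp
  ultimately have q0: "q 0 = 0" by simp
  have "q (scl t x) = t * q x" if "t \<ge> 0" "x \<in> X" for t x
  proof (cases "t = 0")
    case False
    with that have t: "t > 0" by simp
    have "q x = q (scl (1/t) (scl t x))" using t by simp
    also have "\<dots> \<le> (1/t) * q (scl t x)" by (rule scale) (use t that scale_mem in auto)
    finally have "t * q x \<le> q (scl t x)" using t by (simp add: field_simps)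
    then show ?thesis using scale[OF t that(2)] by simp
  qed (simp add: q0)
  then show ?thesis using add by (auto simp: sublinear_on_def)
qed

lemma sublinear_on_zero: "sublinear_on scl X q \<Longrightarrow> q 0 = 0"
  using zero_mem by (auto simp: sublinear_on_def dest!: spec[of _ "0::real"] bspec[of X _ 0])

lemma sublinear_on_neg:
  assumes "sublinear_on scl X q" "x \<in> X"
  shows "- q (- x) \<le> q x"
proof -
  have "q (x + - x) \<le> q x + q (- x)"
    using assms neg_mem unfolding sublinear_on_def by blast
  then show ?thesis using sublinear_on_zero[OF assms(1)] by simp
qed

text \<open>The functional \<open>q' v\<close> is the infimum of
  \<open>q (v + t a) - t \<epsilon>\<close> over \<open>t \<ge> 0\<close> and
  \<open>a \<in> A\<close>. The choice \<open>t = 1\<close>, \<open>v = - a\<close> shows that a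
  linear functional below \<open>q'\<close> is at least \<open>\<epsilon>\<close> on
  \<open>A\<close>. The bound \<open>\<epsilon> \<le> q a\<close> keeps the infimum finite, and
  convexity of \<open>A\<close> gives subadditivity.\<close>

lemma sublinear_shift:
  assumes q: "sublinear_on scl X q" and A: "A \<subseteq> X" "A \<noteq> {}" "convex_on_scale scl A"
    and ge: "\<And>a. a \<in> A \<Longrightarrow> \<epsilon> \<le> q a"
  obtains q' where "sublinear_on scl X q'" "\<And>x. x \<in> X \<Longrightarrow> q' x \<le> q x" "\<And>a. a \<in> A \<Longrightarrow> q' (- a) \<le> - \<epsilon>"
proof -
  define P where "P = {0::real..} \<times> A"
  define F where "F = (\<lambda>v (t, a). q (v + scl t a) - t * \<epsilon>)"
  define q' where "q' = (\<lambda>v. INF c\<in>P. F v c)"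
  have Pne: "P \<noteq> {}" using A(2) by (auto simp: P_def)
  have qadd: "q (x + y) \<le> q x + q y" if "x \<in> X" "y \<in> X" for x y
    using q that by (auto simp: sublinear_on_def)
  have qscale: "q (scl t x) = t * q x" if "t \<ge> 0" "x \<in> X" for t x
    using q that by (auto simp: sublinear_on_def)
  have lower: "F v (t, a) \<ge> - q (- v)" if "v \<in> X" "t \<ge> 0" "a \<in> A" for v t a
  proof -
    have a: "a \<in> X" using that A by auto
    have "t * \<epsilon> \<le> t * q a" using ge that by (simp add: mult_left_mono)
    also have "\<dots> = q ((v + scl t a) + - v)" using qscale[OF that(2) a] by simp
    also have "\<dots> \<le> q (v + scl t a) + q (- v)"
      by (rule qadd) (use that a in \<open>auto intro!: add_mem scale_mem neg_mem\<close>)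
    finally show ?thesis by (simp add: F_def)
  qed
  have bdd: "bdd_below (F v ` P)" if "v \<in> X" for v
    using lower[OF that] by (force simp: P_def bdd_below_def)
  have le: "q' v \<le> F v (t, a)" if "v \<in> X" "t \<ge> 0" "a \<in> A" for v t a
    unfolding q'_def by (rule cINF_lower[OF bdd]) (use that in \<open>auto simp: P_def\<close>)
  have "sublinear_on scl X q'"
  proof (rule sublinear_onI)
    fix x y assume x: "x \<in> X" and y: "y \<in> X"
    have key: "q' (x + y) \<le> F x (t, a) + F y (u, b)"
      if t: "t \<ge> 0" and u: "u \<ge> 0" and a: "a \<in> A" and b: "b \<in> A" for t a u b
    proof -
      \<comment> \<open>A nonnegative combination of two points of \<open>A\<close> is
        \<open>t + u\<close> times one point of \<open>A\<close>; if both coefficients vanish, any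
        point will do.\<close>
      obtain c where c: "c \<in> A" "scl (t + u) c = scl t a + scl u b"
      proof (cases "t + u = 0")
        case True
        then have "t = 0" "u = 0" using t u by auto
        then show ?thesis using a that by auto
      next
        case False
        then have pos: "t + u > 0" using t u by auto
        define r where "r = u / (t + u)"
        have r: "0 \<le> r" "r \<le> 1" "(t + u) * (1 - r) = t" "(t + u) * r = u"
          using pos t u by (auto simp: r_def field_simps)
        have "scl (1 - r) a + scl r b \<in> A"
          using A(3) a b r(1,2) by (auto simp: convex_on_scale_def)
        moreover have "scl (t + u) (scl (1 - r) a + scl r b) = scl t a + scl u b"
          by (simp only: scale_right_distrib scale_scale r)
        ultimately show ?thesis using that by blast
      qed
      have "q' (x + y) \<le> F (x + y) (t + u, c)" using le[of "x+y" "t+u" c] x y t u c add_mem by auto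
      also have "\<dots> = q ((x + scl t a) + (y + scl u b)) - (t + u) * \<epsilon>"
        by (simp only: F_def c(2) prod.case) (simp add: ac_simps)
      also have "\<dots> \<le> q (x + scl t a) + q (y + scl u b) - (t + u) * \<epsilon>"
        using qadd[of "x + scl t a" "y + scl u b"] x y a b A(1) by (auto intro!: add_mem scale_mem)
      finally show ?thesis by (simp add: F_def algebra_simps)
    qed
    have "q' (x + y) - F y (u, b) \<le> q' x" if "u \<ge> 0" "b \<in> A" for u b
      unfolding q'_def[of ] 
    proof (rule cINF_greatest[OF Pne])
      fix c assume "c \<in> P"
      then obtain t a where "c = (t, a)" "t \<ge> 0" "a \<in> A" by (auto simp: P_def)
      then show "(INF c\<in>P. F (x + y) c) - F y (u, b) \<le> F x c"
        using key[of t u a b] that by (simp add: q'_def)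
    qed
    then have "q' (x + y) - q' x \<le> F y c" if "c \<in> P" for c using that by (fastforce simp: P_def)
    then have "q' (x + y) - q' x \<le> q' y" unfolding q'_def[of ]
      by (intro cINF_greatest[OF Pne]) auto
    then show "q' (x + y) \<le> q' x + q' y" by simp
  next
    fix s :: real and x assume s: "s > 0" and x: "x \<in> X"
    have "q' (scl s x) / s \<le> F x c" if "c \<in> P" for c
    proof -
      obtain t a where c: "c = (t, a)" "t \<ge> 0" "a \<in> A" using \<open>c \<in> P\<close> by (auto simp: P_def)
      have "q' (scl s x) \<le> F (scl s x) (s * t, a)"
        by (rule le) (use s c x scale_mem in auto)
      also have "\<dots> = q (scl s (x + scl t a)) - s * t * \<epsilon>"
        by (simp add: F_def scale_right_distrib)
      also have "\<dots> = s * F x c"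
        using qscale[of s "x + scl t a"] s c x A(1) add_mem scale_mem
        by (auto simp: F_def algebra_simps)
      finally show ?thesis using s by (simp add: field_simps)
    qed
    then have "q' (scl s x) / s \<le> q' x" unfolding q'_def by (intro cINF_greatest[OF Pne]) auto
    then show "q' (scl s x) \<le> s * q' x" using s by (simp add: field_simps)
  qed
  moreover have "q' x \<le> q x" if "x \<in> X" for x
  proof -
    obtain a where "a \<in> A" using A by auto
    then show ?thesis using le[OF that, of 0 a] by (simp add: F_def)
  qed
  moreover have "q' (- a) \<le> - \<epsilon>" if "a \<in> A" for a
    using le[of "- a" 1 a] that A(1) neg_mem sublinear_on_zero[OF q] by (auto simp: F_def)
  ultimately show ?thesis using that by blast
qed

text \<open>A pointwise minimal sublinear functional is odd by \<open>sublinear_shift\<close>, hence linear.\<close>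

lemma sublinear_linear_minorant:
  assumes q: "sublinear_on scl X q"
  obtains \<phi> where "linear_functional_on scl X \<phi>" "\<And>x. x \<in> X \<Longrightarrow> \<phi> x \<le> q x"
proof -
  \<comment> \<open>Zorn's lemma compares total functions although only values on \<open>X\<close>
    matter; the fixed value 0 outside makes the comparison one about \<open>X\<close> alone.\<close>
  define S where "S = {\<phi>. sublinear_on scl X \<phi> \<and> (\<forall>x\<in>X. \<phi> x \<le> q x) \<and> (\<forall>x. x \<notin> X \<longrightarrow> \<phi> x = 0)}"
  have "\<exists>m\<in>S. \<forall>a\<in>S. m \<ge> a \<longrightarrow> a = m"
  proof (rule predicate_Zorn)
    show "partial_order_on S (relation_of (\<ge>) S)"
      by (rule partial_order_on_relation_ofI) auto
  next
    fix C assume C: "C \<in> Chains (relation_of (\<ge>) S)"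
    then have CS: "C \<subseteq> S" by (auto simp: Chains_def relation_of_def)
    have chain: "a \<le> b \<or> b \<le> a" if "a \<in> C" "b \<in> C" for a b
      using C that by (auto simp: Chains_def relation_of_def)
    show "\<exists>u\<in>S. \<forall>a\<in>C. a \<ge> u"
    proof (cases "C = {}")
      case True
      have "(\<lambda>x. if x \<in> X then q x else 0) \<in> S"
        using q by (auto simp: S_def sublinear_on_def intro: add_mem scale_mem)
      then show ?thesis using True by blast
    next
      case False
      define u where "u = (\<lambda>x. INF \<phi>\<in>C. \<phi> x)"
      have sub: "\<phi> (x + y) \<le> \<phi> x + \<phi> y" "s > 0 \<Longrightarrow> \<phi> (scl s x) = s * \<phi> x"
        if "\<phi> \<in> C" "x \<in> X" "y \<in> X" for \<phi> x y s
        using that CS by (auto simp: S_def sublinear_on_def)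
      have bdd: "bdd_below ((\<lambda>\<phi>. \<phi> x) ` C)" for x
      proof (cases "x \<in> X")
        case True
        have "- q (- x) \<le> \<phi> x" if "\<phi> \<in> C" for \<phi>
          using sublinear_on_neg[of \<phi> x] True that CS neg_mem[OF True] by (force simp: S_def)
        then show ?thesis by (auto simp: bdd_below_def)
      next
        case False
        then have "(\<lambda>\<phi>. \<phi> x) ` C \<subseteq> {0}" using CS by (auto simp: S_def)
        then show ?thesis by (rule bdd_below_mono[rotated]) simp
      qed
      have le: "u x \<le> \<phi> x" if "\<phi> \<in> C" for x \<phi>
        unfolding u_def by (rule cINF_lower[OF bdd that])
      have "sublinear_on scl X u"
      proof (rule sublinear_onI)
        fix x y assume x: "x \<in> X" and y: "y \<in> X"
        \<comment> \<open>Of two members of the chain the smaller one serves for both summands, so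
          the pointwise infimum stays subadditive.\<close>
        have key: "u (x + y) \<le> \<phi> x + \<psi> y" if "\<phi> \<in> C" "\<psi> \<in> C" for \<phi> \<psi>
          using chain[OF that]
        proof
          assume "\<phi> \<le> \<psi>"
          then show ?thesis using le[OF that(1), of "x+y"] sub(1)[OF that(1) x y] le_funD[of \<phi> \<psi> y]
            by simp
        next
          assume "\<psi> \<le> \<phi>"
          then show ?thesis using le[OF that(2), of "x+y"] sub(1)[OF that(2) x y] le_funD[of \<psi> \<phi> x]
            by simp
        qed
        have "u (x + y) - \<psi> y \<le> u x" if "\<psi> \<in> C" for \<psi>
          unfolding u_def[THEN fun_cong, of x]
          by (intro cINF_greatest[OF False]) (use key that in \<open>auto simp: diff_le_eq\<close>)
        then have "u (x + y) - u x \<le> u y"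
          unfolding u_def[THEN fun_cong, of y]
          by (intro cINF_greatest[OF False]) (auto simp: diff_le_eq add.commute)
        then show "u (x + y) \<le> u x + u y" by simp
      next
        fix s :: real and x assume s: "s > 0" and x: "x \<in> X"
        have "u (scl s x) / s \<le> \<phi> x" if "\<phi> \<in> C" for \<phi>
          using le[OF that, of "scl s x"] sub(2)[OF that x x s] s by (simp add: field_simps)
        then have "u (scl s x) / s \<le> u x"
          unfolding u_def[THEN fun_cong, of x] by (intro cINF_greatest[OF False])
        then show "u (scl s x) \<le> s * u x" using s by (simp add: field_simps)
      qed
      moreover have "u x \<le> q x" if "x \<in> X" for x
      proof -
        obtain \<phi> where \<phi>: "\<phi> \<in> C" using False by auto
        then show ?thesis using le[OF \<phi>, of x] CS that by (force simp: S_def)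
      qed
      moreover have "u x = 0" if "x \<notin> X" for x
      proof -
        have "(\<lambda>\<phi>. \<phi> x) ` C \<subseteq> {0}" using that CS by (auto simp: S_def)
        then have "(\<lambda>\<phi>. \<phi> x) ` C = {0}" using False by auto
        then show ?thesis by (simp add: u_def)
      qed
      ultimately have "u \<in> S" by (auto simp: S_def)
      then show ?thesis using le by (auto simp: le_fun_def)
    qed
  qed
  then obtain m where m: "m \<in> S" and min: "\<And>a. a \<in> S \<Longrightarrow> m \<ge> a \<Longrightarrow> a = m" by blast
  have ms: "sublinear_on scl X m" using m by (simp add: S_def)
  have odd: "m (- a) = - m a" if a: "a \<in> X" for a
  proof -
    have "scl (1 - t) a + scl t a = a" for t
      by (simp flip: scale_left_distrib)
    then have conv: "convex_on_scale scl {a}"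
      by (auto simp: convex_on_scale_def)
    \<comment> \<open>Shifting by the singleton \<open>{a}\<close> with
      \<open>\<epsilon> = m a\<close> produces something below \<open>m\<close>; minimality makes it
      equal to \<open>m\<close>, so \<open>m\<close> itself satisfies
      \<open>m (- a) \<le> - m a\<close>.\<close>
    obtain q' where q': "sublinear_on scl X q'" "\<And>x. x \<in> X \<Longrightarrow> q' x \<le> m x" "q' (- a) \<le> - m a"
      using sublinear_shift[OF ms _ _ conv, of "m a"] a by auto
    define q'' where "q'' = (\<lambda>x. if x \<in> X then q' x else 0)"
    have "sublinear_on scl X q''"
      using q'(1) by (auto simp: q''_def sublinear_on_def intro: add_mem scale_mem)
    then have "q'' \<in> S" using m q'(2) by (force simp: S_def q''_def)
    moreover have "m \<ge> q''" using m q'(2) by (auto simp: le_fun_def S_def q''_def)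
    ultimately have "q'' = m" by (rule min)
    then have "m (- a) = q' (- a)" using neg_mem[OF a] by (auto simp: q''_def)
    then show ?thesis using q'(3) sublinear_on_neg[OF ms a] by simp
  qed
  have add: "m (x + y) = m x + m y" if "x \<in> X" "y \<in> X" for x y
  proof (rule antisym)
    show "m (x + y) \<le> m x + m y" using ms that by (auto simp: sublinear_on_def)
    have "m ((x + y) + - y) \<le> m (x + y) + m (- y)"
      using ms that add_mem neg_mem unfolding sublinear_on_def by blast
    then show "m x + m y \<le> m (x + y)" using odd[OF that(2)] by simp
  qed
  have "m (scl c x) = c * m x" if "x \<in> X" for c x
  proof (cases "c \<ge> 0")
    case True
    then show ?thesis using ms that by (auto simp: sublinear_on_def)
  next
    case False
    have "m (scl (- c) x) = (- c) * m x"
      using ms that False by (simp add: sublinear_on_def del: scale_minus_left)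
    then show ?thesis using odd[OF scale_mem[OF that, of c]] by simp
  qed
  with add have "linear_functional_on scl X m" by (auto simp: linear_functional_on_def)
  then show ?thesis using that m by (auto simp: S_def)
qed

lemma Hahn_Banach_separation:
  assumes q: "sublinear_on scl X q" and A: "A \<subseteq> X" "A \<noteq> {}" "convex_on_scale scl A"
    and ge: "\<And>a. a \<in> A \<Longrightarrow> \<epsilon> \<le> q a"
  obtains \<phi> where "linear_functional_on scl X \<phi>" "\<And>x. x \<in> X \<Longrightarrow> \<phi> x \<le> q x"
    "\<And>a. a \<in> A \<Longrightarrow> \<epsilon> \<le> \<phi> a"
proof -
  obtain q' where q': "sublinear_on scl X q'" "\<And>x. x \<in> X \<Longrightarrow> q' x \<le> q x"
      "\<And>a. a \<in> A \<Longrightarrow> q' (- a) \<le> - \<epsilon>"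
    using sublinear_shift[OF q A ge] by blast
  obtain \<phi> where \<phi>: "linear_functional_on scl X \<phi>" "\<And>x. x \<in> X \<Longrightarrow> \<phi> x \<le> q' x"
    using sublinear_linear_minorant[OF q'(1)] by blast
  have "\<epsilon> \<le> \<phi> a" if "a \<in> A" for a
  proof -
    have "\<phi> (scl (-1) a) = - 1 * \<phi> a"
      using \<phi>(1) A(1) that unfolding linear_functional_on_def by blast
    then have "\<phi> (- a) = - \<phi> a" by simp
    moreover have "\<phi> (- a) \<le> - \<epsilon>"
      using \<phi>(2)[of "- a"] q'(3)[OF that] A(1) that neg_mem by force
    ultimately show ?thesis by simp
  qed
  then show ?thesis using that \<phi> q'(2) by (meson order_trans)
qed

end

section \<open>Separately continuous functions on compact spaces\<close>

text \<open>The open sets where \<open>g n\<close> is below \<open>e\<close> grow with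
  \<open>n\<close>, so a finite subcover comes down to its last member.\<close>

lemma Dini_decreasing:
  fixes g :: "nat \<Rightarrow> 'b \<Rightarrow> real"
  assumes comp: "compact_space T" and cont: "\<And>n. continuous_map T euclideanreal (g n)"
    and dec: "\<And>n x. x \<in> topspace T \<Longrightarrow> g (Suc n) x \<le> g n x"
    and ex: "\<And>x. x \<in> topspace T \<Longrightarrow> \<exists>n. g n x < e"
  obtains n where "\<And>x. x \<in> topspace T \<Longrightarrow> g n x < e"
proof -
  define U where "U = (\<lambda>n. {x \<in> topspace T. g n x < e})"
  have opn: "openin T (U n)" for n
  proof -
    have "openin T {x \<in> topspace T. g n x \<in> {..<e}}"
      by (rule openin_continuous_map_preimage[OF cont]) auto
    then show ?thesis by (simp add: U_def)
  qed
  have "\<exists>F. finite F \<and> F \<subseteq> range U \<and> topspace T \<subseteq> \<Union>F"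
    using opn ex by (intro comp[unfolded compact_space_alt, rule_format]) (auto simp: U_def)
  then obtain N where N: "finite N" "topspace T \<subseteq> (\<Union>n\<in>N. U n)"
    by (metis finite_subset_image)
  define m where "m = Max (insert 0 N)"
  have anti: "g k x \<le> g n x" if "n \<le> k" "x \<in> topspace T" for n k x
    using that(1) by (induction k rule: dec_induct) (use dec[OF that(2)] in \<open>auto intro: order_trans\<close>)
  have "g m x < e" if x: "x \<in> topspace T" for x
  proof -
    obtain n where n: "n \<in> N" "g n x < e" using N(2) x by (auto simp: U_def)
    have "n \<le> m" using N(1) n(1) by (auto simp: m_def)
    then show ?thesis using anti[OF _ x, of n m] n(2) by simp
  qed
  then show ?thesis using that by blast
qed

section \<open>Uniformly small convex combinations of a bounded pointwise null sequence\<close>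

lemma convex_on_scale_weighted_sums:
  fixes h :: "nat \<Rightarrow> 'b \<Rightarrow> real"
  shows "convex_on_scale (\<lambda>r f x. r * f x)
    {(\<lambda>x. \<Sum>n<N. w n * h n x) | N w. (\<forall>n. 0 \<le> w n) \<and> (\<Sum>n<N. w n) = 1}"
  unfolding convex_on_scale_def
proof clarify
  fix t :: real and N M :: nat and w v :: "nat \<Rightarrow> real"
  assume t: "0 \<le> t" "t \<le> 1" and w: "\<forall>n. 0 \<le> w n" "sum w {..<N} = 1"
    and v: "\<forall>n. 0 \<le> v n" "sum v {..<M} = 1"
  define L where "L = max N M"
  have ext: "(\<Sum>n<K. c n * d n) = (\<Sum>n<L. (if n < K then c n else 0) * d n)" if "K \<le> L"
    for K and c d :: "nat \<Rightarrow> real"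
    by (rule sum.mono_neutral_cong_left) (use that in auto)
  define z where "z = (\<lambda>n. (1 - t) * (if n < N then w n else 0) + t * (if n < M then v n else 0))"
  have N: "(\<Sum>n<N. w n * d n) = (\<Sum>n<L. (if n < N then w n else 0) * d n)"
    and M: "(\<Sum>n<M. v n * d n) = (\<Sum>n<L. (if n < M then v n else 0) * d n)" for d :: "nat \<Rightarrow> real"
    by (rule ext, simp add: L_def)+
  have comb: "(\<Sum>n<L. z n * d n) = (1 - t) * (\<Sum>n<N. w n * d n) + t * (\<Sum>n<M. v n * d n)"
    for d :: "nat \<Rightarrow> real"
    unfolding N M z_def sum_distrib_left sum.distrib[symmetric]
    by (rule sum.cong[OF refl]) (simp only: distrib_right mult.assoc)
  have "sum z {..<L} = 1" using comb[of "\<lambda>_. 1"] w v by simp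
  moreover have "\<forall>n. 0 \<le> z n" using t w v by (auto simp: z_def)
  moreover have "(\<lambda>x. of_real (1 - t) * (\<Sum>n<N. w n * h n x)) + (\<lambda>x. of_real t * (\<Sum>n<M. v n * h n x))
      = (\<lambda>x. \<Sum>n<L. z n * h n x)"
    unfolding comb by (simp add: fun_eq_iff)
  ultimately show "\<exists>N' w'. (\<lambda>x. of_real (1 - t) * (\<Sum>n<N. w n * h n x)) +
         (\<lambda>x. of_real t * (\<Sum>n<M. v n * h n x)) = (\<lambda>x. \<Sum>n<N'. w' n * h n x) \<and>
      (\<forall>n. 0 \<le> w' n) \<and> sum w' {..<N'} = 1"
    by (intro exI[of _ L] exI[of _ z] conjI)
qed

text \<open>Values outside \<open>B\<close> are arbitrary, so functions on the whole type can stand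
  for functions on the space in the Hahn-Banach argument.\<close>

lemma real_subspace_bounded_functions:
  "real_subspace (\<lambda>r f x. r * f x) {f :: 'b \<Rightarrow> real. \<exists>c. \<forall>x\<in>B. \<bar>f x\<bar> \<le> c}"
proof -
  interpret vector_space "\<lambda>r (f :: 'b \<Rightarrow> real) x. r * f x"
    by unfold_locales (auto simp: fun_eq_iff algebra_simps)
  show ?thesis
  proof unfold_locales
    show "subspace {f :: 'b \<Rightarrow> real. \<exists>c. \<forall>x\<in>B. \<bar>f x\<bar> \<le> c}"
      unfolding subspace_def
    proof (intro conjI ballI allI)
      fix f g :: "'b \<Rightarrow> real" and r :: real
      assume f: "f \<in> {f. \<exists>c. \<forall>x\<in>B. \<bar>f x\<bar> \<le> c}"
      then obtain c where c: "\<forall>x\<in>B. \<bar>f x\<bar> \<le> c" by auto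
      have "\<forall>x\<in>B. \<bar>r * f x\<bar> \<le> \<bar>r\<bar> * c" using c by (auto simp: abs_mult intro: mult_left_mono)
      then show "(\<lambda>x. r * f x) \<in> {f. \<exists>c. \<forall>x\<in>B. \<bar>f x\<bar> \<le> c}" by auto
      assume "g \<in> {f. \<exists>c. \<forall>x\<in>B. \<bar>f x\<bar> \<le> c}"
      then obtain d where "\<forall>x\<in>B. \<bar>g x\<bar> \<le> d" by auto
      then have "\<forall>x\<in>B. \<bar>(f + g) x\<bar> \<le> c + d" using c by fastforce
      then show "f + g \<in> {f. \<exists>c. \<forall>x\<in>B. \<bar>f x\<bar> \<le> c}" by blast
    qed (auto intro!: exI[of _ 0])
  qed
qed

text \<open>The heart of Riesz's elementary proof of bounded convergence for positive functionals:
  a sequence of almost optimal finite maxima has decreasing minima with large values of \<open>\<phi>\<close>.\<close>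

lemma positive_functional_bounded_convergence:
  fixes h :: "nat \<Rightarrow> 'b \<Rightarrow> real"
  assumes comp: "compact_space T" and cont: "\<And>n. continuous_map T euclideanreal (h n)"
    and pos: "\<And>n x. x \<in> topspace T \<Longrightarrow> 0 \<le> h n x" and bd: "\<And>n x. x \<in> topspace T \<Longrightarrow> h n x \<le> M"
    and lim: "\<And>x. x \<in> topspace T \<Longrightarrow> (\<lambda>n. h n x) \<longlonglongrightarrow> 0"
    and lin: "linear_functional_on (\<lambda>r f x. r * f x) {f. \<exists>c. \<forall>x\<in>topspace T. \<bar>f x\<bar> \<le> c} \<phi>"
    and sup: "\<And>f c. (\<exists>d. \<forall>x\<in>topspace T. \<bar>f x\<bar> \<le> d) \<Longrightarrow> (\<And>x. x \<in> topspace T \<Longrightarrow> f x \<le> c) \<Longrightarrow> \<phi> f \<le> c"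
    and e: "0 < e"
  shows "\<exists>n. \<phi> (h n) < e"
proof (rule ccontr)
  assume "\<nexists>n. \<phi> (h n) < e"
  then have ge: "e \<le> \<phi> (h n)" for n by (simp add: not_less)
  define V where "V = {f :: 'b \<Rightarrow> real. \<exists>c. \<forall>x\<in>topspace T. \<bar>f x\<bar> \<le> c}"
  interpret V: real_subspace "\<lambda>r (f :: 'b \<Rightarrow> real) x. r * f x" V
    unfolding V_def by (rule real_subspace_bounded_functions)
  have add: "\<phi> (f + g) = \<phi> f + \<phi> g" if "f \<in> V" "g \<in> V" for f g
    using lin that by (auto simp: linear_functional_on_def V_def)
  \<comment> \<open>Positivity is the case \<open>c = 0\<close> of \<open>sup\<close>, applied to
    the difference.\<close>
  have mono: "\<phi> f \<le> \<phi> g" if "f \<in> V" "g \<in> V" "\<And>x. x \<in> topspace T \<Longrightarrow> f x \<le> g x" for f g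
  proof -
    have d: "f - g \<in> V" using that V.diff_mem by blast
    have "\<phi> (f - g) \<le> 0" by (rule sup) (use d that(3) in \<open>auto simp: V_def\<close>)
    moreover have "\<phi> f = \<phi> (f - g) + \<phi> g" using add[OF d that(2)] by simp
    ultimately show ?thesis by simp
  qed
  define k where "k = (\<lambda>n m x. MAX j\<in>{n..n+m}. h j x)"
  define S where "S = {f. continuous_map T euclideanreal f \<and> (\<forall>x\<in>topspace T. 0 \<le> f x \<and> f x \<le> M)}"
  have SV: "f \<in> V" if "f \<in> S" for f
    using that by (fastforce simp: S_def V_def)
  have hS: "h n \<in> S" for n using cont pos bd by (auto simp: S_def)
  have maxS: "(\<lambda>x. max (f x) (g x)) \<in> S" and minS: "(\<lambda>x. min (f x) (g x)) \<in> S"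
    if "f \<in> S" "g \<in> S" for f g
    using that by (auto simp: S_def intro!: continuous_map_real_max continuous_map_real_min)
  have k0: "k n 0 = h n" for n by (auto simp: k_def)
  have kSuc: "k n (Suc m) = (\<lambda>x. max (k n m x) (h (Suc (n + m)) x))" for n m
  proof
    fix x
    have "(\<lambda>j. h j x) ` {n..n + Suc m} = insert (h (Suc (n+m)) x) ((\<lambda>j. h j x) ` {n..n+m})"
      by (auto simp: atLeastAtMostSuc_conv)
    then show "k n (Suc m) x = max (k n m x) (h (Suc (n + m)) x)"
      by (simp add: k_def max.commute)
  qed
  have kS: "k n m \<in> S" for n m
    by (induction m) (auto simp: k0 kSuc hS intro!: maxS)
  have kmono: "k n m x \<le> k n' m' x" if "n' \<le> n" "n + m \<le> n' + m'" for n m n' m' x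
    unfolding k_def by (rule Max_mono) (use that in auto)
  have kle: "k n m x < c \<longleftrightarrow> (\<forall>j\<in>{n..n+m}. h j x < c)" for n m x c
    by (simp add: k_def)
  have phik: "\<phi> (k n m) \<le> M" for n m
    by (rule sup) (use kS[of n m] SV[OF kS[of n m]] in \<open>auto simp: S_def V_def\<close>)
  \<comment> \<open>The values \<open>\<phi> (k n m)\<close> are bounded by \<open>M\<close>, so
    some \<open>m\<close> comes within the tolerance of their supremum. The tolerances
    \<open>e / 2 ^ (n + 2)\<close> add up to at most \<open>e / 2\<close>, half of the lower bound
    \<open>e \<le> \<phi> (h n)\<close>.\<close>
  have "\<exists>m. \<forall>m'. \<phi> (k n m') \<le> \<phi> (k n m) + e / 2 ^ (n + 2)" for n
  proof -
    define s where "s = (SUP m. \<phi> (k n m))"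
    have bdd: "bdd_above (range (\<lambda>m. \<phi> (k n m)))" using phik by (auto intro: bdd_aboveI[of _ M])
    have "s - e / 2 ^ (n + 2) < s" using e by simp
    then obtain m where "s - e / 2 ^ (n + 2) < \<phi> (k n m)"
      unfolding s_def using less_cSUP_iff[OF _ bdd] by blast
    moreover have "\<phi> (k n m') \<le> s" for m' unfolding s_def by (rule cSUP_upper[OF _ bdd]) simp
    ultimately have "\<phi> (k n m') \<le> \<phi> (k n m) + e / 2 ^ (n + 2)" for m'
      by (smt (verit))
    then show ?thesis by blast
  qed
  then obtain m where m: "\<And>n m'. \<phi> (k n m') \<le> \<phi> (k n (m n)) + e / 2 ^ (n + 2)" by metis
  define g where "g = rec_nat (k 0 (m 0)) (\<lambda>n f x. min (f x) (k (Suc n) (m (Suc n)) x))"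
  have g0: "g 0 = k 0 (m 0)" and gS: "g (Suc n) = (\<lambda>x. min (g n x) (k (Suc n) (m (Suc n)) x))" for n
    by (auto simp: g_def)
  have gle: "g n x \<le> k n (m n) x" for n x by (cases n) (auto simp: g0 gS)
  have gmem: "g n \<in> S" for n by (induction n) (auto simp: g0 gS kS intro!: minS)
  have low: "\<phi> (g n) \<ge> \<phi> (k n (m n)) - (\<Sum>i<n. e / 2 ^ (i + 2))" for n
  proof (induction n)
    case (Suc n)
    define a where "a = g n"
    define b where "b = k (Suc n) (m (Suc n))"
    \<comment> \<open>With this length \<open>k n L\<close> dominates both \<open>a\<close> and
      \<open>b\<close>, because the window of \<open>b\<close> starts one index later. So
      \<open>\<phi>\<close> of their maximum exceeds \<open>\<phi> (k n (m n))\<close> by at most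
      the tolerance.\<close>
    define L where "L = max (m n) (Suc (m (Suc n)))"
    have ab: "a \<in> S" "b \<in> S" by (auto simp: a_def b_def gmem kS)
    have "a x \<le> k n L x" for x
      by (rule order_trans[OF gle[of n x, folded a_def]], rule kmono) (auto simp: L_def)
    moreover have "b x \<le> k n L x" for x
      unfolding b_def by (rule kmono) (auto simp: L_def)
    ultimately have "\<phi> (\<lambda>x. max (a x) (b x)) \<le> \<phi> (k n L)"
      by (intro mono SV maxS ab kS) auto
    also have "\<dots> \<le> \<phi> (k n (m n)) + e / 2 ^ (n + 2)" by (rule m)
    finally have mx: "\<phi> (\<lambda>x. max (a x) (b x)) \<le> \<phi> (k n (m n)) + e / 2 ^ (n + 2)" .
    \<comment> \<open>By this identity an upper bound for \<open>\<phi>\<close> of the maximum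
      becomes a lower bound for \<open>\<phi>\<close> of the minimum.\<close>
    have "(\<lambda>x. min (a x) (b x)) + (\<lambda>x. max (a x) (b x)) = a + b"
      by (auto simp: fun_eq_iff min_def max_def)
    then have "\<phi> (\<lambda>x. min (a x) (b x)) + \<phi> (\<lambda>x. max (a x) (b x)) = \<phi> a + \<phi> b"
      using add[of a b] add[of "\<lambda>x. min (a x) (b x)" "\<lambda>x. max (a x) (b x)"] ab SV minS maxS by metis
    moreover have "\<phi> (g (Suc n)) = \<phi> (\<lambda>x. min (a x) (b x))" by (simp add: gS a_def b_def)
    ultimately show ?case using Suc mx by (simp add: a_def b_def)
  qed (simp add: g0)
  have geo: "(\<Sum>i<n. e / 2 ^ (i + 2)) \<le> e / 2" for n
  proof -
    have "(\<Sum>i<n. e / 2 ^ (i + 2)) = e / 2 - e / 2 ^ (n + 1)"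
      by (induction n) (auto simp: field_simps)
    then show ?thesis using e by simp
  qed
  have glow: "\<phi> (g n) \<ge> e / 2" for n
  proof -
    have "e \<le> \<phi> (k n (m n))"
      by (rule order_trans[OF ge[of n] mono[OF SV[OF hS] SV[OF kS]]])
         (metis k0 kmono le_add1 order_refl add.right_neutral)
    then show ?thesis using low[of n] geo[of n] by linarith
  qed
  \<comment> \<open>\<open>g n\<close> lies below a maximum of finitely many \<open>h j\<close> with
    \<open>j \<ge> n\<close>, hence is eventually small at every point; being decreasing it is then
    small uniformly.\<close>
  obtain n where n: "\<And>x. x \<in> topspace T \<Longrightarrow> g n x < e / 4"
  proof (rule Dini_decreasing[OF comp, of g "e / 4"])
    show "continuous_map T euclideanreal (g n)" for n using gmem[of n] by (auto simp: S_def)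
    show "g (Suc n) x \<le> g n x" for n x by (simp add: gS)
    fix x assume "x \<in> topspace T"
    then have "\<forall>\<^sub>F n in sequentially. h n x < e / 4"
      using order_tendstoD(2)[OF lim, of x "e/4"] e by simp
    then obtain N where "\<And>n. n \<ge> N \<Longrightarrow> h n x < e / 4" by (auto simp: eventually_sequentially)
    then have "k N (m N) x < e / 4" unfolding kle by auto
    then show "\<exists>n. g n x < e / 4" using gle[of N x] by (meson le_less_trans)
  qed auto
  have "\<phi> (g n) \<le> e / 4"
    by (rule sup) (use n SV[OF gmem[of n]] in \<open>auto simp: V_def less_imp_le\<close>)
  then show False using glow[of n] e by simp
qed

text \<open>Otherwise all convex combinations have supremum at least \<open>e\<close>. Separation
  with the supremum as sublinear functional gives a linear \<open>\<phi>\<close> below the supremum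
  with \<open>\<phi> (h n) \<ge> e\<close> for all \<open>n\<close>, which bounded convergence
  forbids. This replaces Lebesgue's theorem for representing measures.\<close>

lemma convex_combination_small:
  fixes h :: "nat \<Rightarrow> 'b \<Rightarrow> real"
  assumes comp: "compact_space T" and cont: "\<And>n. continuous_map T euclideanreal (h n)"
    and pos: "\<And>n x. x \<in> topspace T \<Longrightarrow> 0 \<le> h n x" and bd: "\<And>n x. x \<in> topspace T \<Longrightarrow> h n x \<le> M"
    and lim: "\<And>x. x \<in> topspace T \<Longrightarrow> (\<lambda>n. h n x) \<longlonglongrightarrow> 0"
    and e: "0 < e"
  obtains N w where "\<And>n. 0 \<le> w n" "(\<Sum>n<N. w n) = 1"
    "\<And>x. x \<in> topspace T \<Longrightarrow> (\<Sum>n<N. w n * h n x) \<le> e"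
proof (rule ccontr)
  assume neg: "\<not> thesis"
  note small = that
  define B where "B = topspace T"
  define V where "V = {f :: 'b \<Rightarrow> real. \<exists>c. \<forall>x\<in>B. \<bar>f x\<bar> \<le> c}"
  interpret V: real_subspace "\<lambda>r (f :: 'b \<Rightarrow> real) x. r * f x" V
    unfolding V_def by (rule real_subspace_bounded_functions)
  define A where "A = {(\<lambda>x. \<Sum>n<N. w n * h n x) | N w. (\<forall>n. 0 \<le> w n) \<and> (\<Sum>n<N. w n) = 1}"
  define q where "q = (\<lambda>f :: 'b \<Rightarrow> real. SUP x\<in>B. f x)"
  have large: "\<exists>x\<in>B. e < (\<Sum>n<N. w n * h n x)" if w: "\<And>n. 0 \<le> w n" "(\<Sum>n<N. w n) = 1" for N w
  proof (rule ccontr)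
    assume "\<not> (\<exists>x\<in>B. e < (\<Sum>n<N. w n * h n x))"
    then have "(\<Sum>n<N. w n * h n x) \<le> e" if "x \<in> topspace T" for x
      using that by (simp add: B_def not_less)
    with neg small w show False by blast
  qed
  have hA: "h n \<in> A" for n
  proof -
    have "h n = (\<lambda>x. \<Sum>i<Suc n. (if i = n then 1 else 0) * h i x)"
      by simp
    moreover have "(\<Sum>i<Suc n. (if i = n then 1 else 0 :: real)) = 1" by simp
    ultimately show ?thesis unfolding A_def
      by (intro CollectI exI[of _ "Suc n"] exI[of _ "\<lambda>i. if i = n then 1 else 0 :: real"]) auto
  qed
  have hV: "h n \<in> V" for n
    unfolding V_def using pos bd by (auto simp: B_def intro!: exI[of _ M])
  have AV: "A \<subseteq> V"
  proof
    fix f assume "f \<in> A"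
    then obtain N w where f: "f = (\<lambda>x. \<Sum>n<N. w n * h n x)" by (auto simp: A_def)
    have "f = (\<Sum>n<N. (\<lambda>x. w n * h n x))" unfolding f by (induction N) (auto simp: fun_eq_iff)
    also have "\<dots> \<in> V" by (intro V.subspace_sum V.subspace_X V.scale_mem hV)
    finally show "f \<in> V" .
  qed
  have ne: "B \<noteq> {}" using large[of "\<lambda>_. 1" 1] by auto
  have bdd: "bdd_above (f ` B)" if "f \<in> V" for f
    using that unfolding V_def bdd_above_def by (auto simp: abs_le_iff)
  have qge: "f x \<le> q f" if "f \<in> V" "x \<in> B" for f x
    unfolding q_def by (rule cSUP_upper[OF that(2) bdd[OF that(1)]])
  have qle: "q f \<le> c" if "\<And>x. x \<in> B \<Longrightarrow> f x \<le> c" for f c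
    unfolding q_def by (rule cSUP_least[OF ne that])
  have sub: "sublinear_on (\<lambda>r f x. r * f x) V q"
  proof (rule V.sublinear_onI)
    show "q (f + g) \<le> q f + q g" if "f \<in> V" "g \<in> V" for f g
      by (rule qle) (use qge that in \<open>auto intro: add_mono\<close>)
    show "q (\<lambda>x. t * f x) \<le> t * q f" if "t > 0" "f \<in> V" for f t
      by (rule qle) (use qge that in \<open>auto\<close>)
  qed
  have qA: "e \<le> q a" if a: "a \<in> A" for a
  proof -
    obtain N w where "a = (\<lambda>x. \<Sum>n<N. w n * h n x)" "\<forall>n. 0 \<le> w n" "(\<Sum>n<N. w n) = 1"
      using a by (auto simp: A_def)
    then obtain x where "x \<in> B" "e < a x" using large[of w N] by auto
    then show ?thesis using qge[of a x] a AV by auto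
  qed
  have Ane: "A \<noteq> {}" using hA by auto
  obtain \<phi> where \<phi>: "linear_functional_on (\<lambda>r f x. r * f x) V \<phi>" "\<And>f. f \<in> V \<Longrightarrow> \<phi> f \<le> q f"
      "\<And>a. a \<in> A \<Longrightarrow> e \<le> \<phi> a"
    using V.Hahn_Banach_separation[OF sub AV Ane convex_on_scale_weighted_sums[of h, folded A_def] qA]
    by blast
  have "\<exists>n. \<phi> (h n) < e"
  proof (rule positive_functional_bounded_convergence[OF comp cont pos bd lim _ _ e])
    show "linear_functional_on (\<lambda>r f x. r * f x) {f. \<exists>c. \<forall>x\<in>topspace T. \<bar>f x\<bar> \<le> c} \<phi>"
      using \<phi>(1) by (simp add: V_def B_def)
    show "\<phi> f \<le> c" if "\<exists>d. \<forall>x\<in>topspace T. \<bar>f x\<bar> \<le> d" "\<And>x. x \<in> topspace T \<Longrightarrow> f x \<le> c" for f c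
      using \<phi>(2)[of f] qle[of f c] that by (force simp: V_def B_def)
  qed auto
  then show False using \<phi>(3)[OF hA] by (meson not_less)
qed

section \<open>Grothendieck's theorem\<close>

lemma compact_space_cluster_point:
  fixes k :: "nat \<Rightarrow> 'a"
  assumes comp: "compact_space T" and inf: "infinite N" and k: "\<And>n. n \<in> N \<Longrightarrow> k n \<in> topspace T"
  obtains x where "x \<in> topspace T" "\<And>U. openin T U \<Longrightarrow> x \<in> U \<Longrightarrow> infinite {n \<in> N. k n \<in> U}"
proof (rule ccontr)
  assume neg: "\<not> thesis"
  note cluster = that
  define \<U> where "\<U> = {U. openin T U \<and> finite {n \<in> N. k n \<in> U}}"
  have "\<exists>U\<in>\<U>. x \<in> U" if "x \<in> topspace T" for x
    using cluster[OF that] neg by (auto simp: \<U>_def)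
  then have "\<exists>\<F>. finite \<F> \<and> \<F> \<subseteq> \<U> \<and> topspace T \<subseteq> \<Union>\<F>"
    by (intro comp[unfolded compact_space_alt, rule_format]) (auto simp: \<U>_def)
  then obtain \<F> where \<F>: "finite \<F>" "\<F> \<subseteq> \<U>" "topspace T \<subseteq> \<Union>\<F>" by blast
  have "finite (\<Union>U\<in>\<F>. {n \<in> N. k n \<in> U})"
    using \<F>(1,2) by (auto simp: \<U>_def)
  moreover have "N \<subseteq> (\<Union>U\<in>\<F>. {n \<in> N. k n \<in> U})" using \<F>(3) k by blast
  ultimately show False using inf finite_subset by blast
qed

text \<open>The image of a compact space in a finite power of the complex plane is totally bounded:
  finitely many points represent all of \<open>T\<close> as far as the functions indexed by
  \<open>I\<close> can tell.\<close>

lemma compact_space_finite_net: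
  fixes H :: "'k \<Rightarrow> 'a \<Rightarrow> complex"
  assumes comp: "compact_space T" and I: "finite I"
    and cont: "\<And>k. k \<in> I \<Longrightarrow> continuous_map T euclidean (H k)" and e: "0 < e"
  obtains A where "finite A" "A \<subseteq> topspace T"
    "\<And>a. a \<in> topspace T \<Longrightarrow> \<exists>b\<in>A. \<forall>k\<in>I. cmod (H k a - H k b) < e"
proof -
  define U where "U = (\<lambda>b. {a \<in> topspace T. \<forall>k\<in>I. cmod (H k a - H k b) < e})"
  have opn: "openin T (U b)" for b
  proof -
    have "U b = topspace T \<inter> (\<Inter>k\<in>I. {a \<in> topspace T. H k a \<in> ball (H k b) e})"
      by (auto simp: U_def dist_norm norm_minus_commute)
    moreover have "openin T (topspace T \<inter> (\<Inter>k\<in>I. {a \<in> topspace T. H k a \<in> ball (H k b) e}))"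
      using I cont by (intro openin_Int_Inter) (auto simp del: mem_ball intro!: openin_continuous_map_preimage)
    ultimately show ?thesis by simp
  qed
  have "\<exists>F. finite F \<and> F \<subseteq> U ` topspace T \<and> topspace T \<subseteq> \<Union>F"
    using opn e by (intro comp[unfolded compact_space_alt, rule_format]) (auto simp: U_def)
  then obtain A where A: "finite A" "A \<subseteq> topspace T" "topspace T \<subseteq> (\<Union>b\<in>A. U b)"
    by (metis finite_subset_image)
  have "\<exists>b\<in>A. \<forall>k\<in>I. cmod (H k a - H k b) < e" if "a \<in> topspace T" for a
    using A(3) that by (auto simp: U_def)
  with A that show ?thesis by blast
qed

text \<open>Grothendieck's theorem on separately continuous functions.  If \<open>\<psi>\<close> were discontinuous, one
  could pick a sequence \<open>k\<close> on which \<open>H\<close> converges on a set that norms all the differences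
  \<open>H (k n) - H (k 0)\<close>, contradicting that some convex combination of these is uniformly small.\<close>

theorem dominated_functional_continuous:
  fixes H :: "'k \<Rightarrow> 'a \<Rightarrow> complex" and \<psi> :: "'k \<Rightarrow> complex"
  assumes TK: "compact_space TK" and TA: "compact_space TA"
    and cK: "\<And>a. a \<in> topspace TA \<Longrightarrow> continuous_map TK euclidean (\<lambda>k. H k a)"
    and cA: "\<And>k. k \<in> topspace TK \<Longrightarrow> continuous_map TA euclidean (H k)"
    and bd: "\<And>k a. k \<in> topspace TK \<Longrightarrow> a \<in> topspace TA \<Longrightarrow> cmod (H k a) \<le> M"
    and dom: "\<And>N \<kappa> c e. (\<And>n. \<kappa> n \<in> topspace TK) \<Longrightarrow>
       (\<And>a. a \<in> topspace TA \<Longrightarrow> cmod (\<Sum>n<N::nat. c n * H (\<kappa> n) a) \<le> e) \<Longrightarrow>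
       0 \<le> e \<Longrightarrow> cmod (\<Sum>n<N. c n * \<psi> (\<kappa> n)) \<le> C * e"
  shows "continuous_map TK euclidean \<psi>"
proof (rule ccontr)
  assume notc: "\<not> continuous_map TK euclidean \<psi>"
  obtain k0 \<epsilon> where k0: "k0 \<in> topspace TK" and \<epsilon>: "\<epsilon> > 0"
    and far: "\<And>U. openin TK U \<Longrightarrow> k0 \<in> U \<Longrightarrow> \<exists>k\<in>U. \<epsilon> \<le> cmod (\<psi> k - \<psi> k0)"
  proof -
    obtain V where V: "open V" "\<not> openin TK {x \<in> topspace TK. \<psi> x \<in> V}"
      using notc by (auto simp: continuous_map_def)
    then obtain k0 where k0: "k0 \<in> topspace TK" "\<psi> k0 \<in> V"
      and no: "\<And>U. openin TK U \<Longrightarrow> k0 \<in> U \<Longrightarrow> \<not> U \<subseteq> {x \<in> topspace TK. \<psi> x \<in> V}"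
      by (subst (asm) openin_subopen) blast
    obtain \<epsilon> where \<epsilon>: "\<epsilon> > 0" "ball (\<psi> k0) \<epsilon> \<subseteq> V" using V(1) k0(2) by (meson openE)
    have "\<exists>k\<in>U. \<epsilon> \<le> cmod (\<psi> k - \<psi> k0)" if "openin TK U" "k0 \<in> U" for U
    proof (rule ccontr)
      assume "\<not> (\<exists>k\<in>U. \<epsilon> \<le> cmod (\<psi> k - \<psi> k0))"
      then have "\<psi> k \<in> ball (\<psi> k0) \<epsilon>" if "k \<in> U" for k
        using that by (force simp: dist_norm norm_minus_commute)
      then show False using no[OF that] \<epsilon>(2) openin_subset[OF that(1)] by blast
    qed
    then show ?thesis using that k0(1) \<epsilon>(1) by blast
  qed
  \<comment> \<open>A state consists of the current point \<open>k\<close>, the finite set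
    \<open>I\<close> of points met so far, and a finite \<open>A\<close> representing all of
    \<open>TA\<close> for the functions \<open>H k\<close>, \<open>k \<in> I\<close>, up to
    \<open>1 / (n + 1)\<close>. In the transition \<open>R\<close> the next point is close to
    \<open>k0\<close> on \<open>A\<close> although \<open>\<psi>\<close> keeps the two at distance
    \<open>\<epsilon>\<close>.\<close>
  define P where "P = (\<lambda>n (k, I, A). k \<in> topspace TK \<and> finite I \<and> I \<subseteq> topspace TK \<and> k \<in> I \<and> k0 \<in> I \<and>
    finite A \<and> A \<subseteq> topspace TA \<and>
    (\<forall>a\<in>topspace TA. \<exists>b\<in>A. \<forall>k\<in>I. cmod (H k a - H k b) < 1 / real (Suc n)))"
  define R where "R = (\<lambda>n (k :: 'k, I :: 'k set, A) (k', I', A'). I \<subseteq> I' \<and> A \<subseteq> A' \<and> \<epsilon> \<le> cmod (\<psi> k' - \<psi> k0) \<and>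
    (\<forall>a\<in>A. cmod (H k' a - H k0 a) < 1 / real (Suc n)))"
  have net: "\<exists>A. finite A \<and> A \<subseteq> topspace TA \<and> (\<forall>a\<in>topspace TA. \<exists>b\<in>A. \<forall>k\<in>I. cmod (H k a - H k b) < 1 / real (Suc n))"
    if "finite I" "I \<subseteq> topspace TK" for I n
    by (rule compact_space_finite_net[OF TA that(1), of H "1 / real (Suc n)"]) (use cA that(2) in auto)
  have "\<exists>f. \<forall>n. P n (f n) \<and> R n (f n) (f (Suc n))"
  proof (rule dependent_nat_choice)
    obtain A where "finite A" "A \<subseteq> topspace TA"
      "\<forall>a\<in>topspace TA. \<exists>b\<in>A. \<forall>k\<in>{k0}. cmod (H k a - H k b) < 1 / real (Suc 0)"
      using net[of "{k0}" 0] k0 by auto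
    then have "P 0 (k0, {k0}, A)" using k0 by (simp add: P_def)
    then show "\<exists>x. P 0 x" by blast
  next
    fix x n assume Px: "P n x"
    obtain k I A where x: "x = (k, I, A)" by (cases x)
    have I: "finite I" "I \<subseteq> topspace TK" "k0 \<in> I" and A: "finite A" "A \<subseteq> topspace TA"
      using Px by (auto simp: P_def x)
    define U where "U = topspace TK \<inter> (\<Inter>a\<in>A. {k \<in> topspace TK. H k a \<in> ball (H k0 a) (1 / real (Suc n))})"
    have "openin TK U" unfolding U_def
      using A cK by (intro openin_Int_Inter) (auto simp del: mem_ball intro!: openin_continuous_map_preimage)
    moreover have "k0 \<in> U" using k0 by (auto simp: U_def)
    ultimately obtain k' where k': "k' \<in> U" "\<epsilon> \<le> cmod (\<psi> k' - \<psi> k0)" using far by blast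
    have k'2: "k' \<in> topspace TK" "\<forall>a\<in>A. cmod (H k' a - H k0 a) < 1 / real (Suc n)"
      using k'(1) by (auto simp: U_def dist_norm norm_minus_commute)
    obtain A' where A': "finite A'" "A' \<subseteq> topspace TA"
      "\<forall>a\<in>topspace TA. \<exists>b\<in>A'. \<forall>k\<in>insert k' I. cmod (H k a - H k b) < 1 / real (Suc (Suc n))"
      using net[of "insert k' I" "Suc n"] I k'2 by auto
    have "P (Suc n) (k', insert k' I, A \<union> A')"
      using A' I A k'2(1) unfolding P_def by (auto simp del: of_nat_Suc ball_simps) (meson UnCI)
    moreover have "R n x (k', insert k' I, A \<union> A')"
      using k' k'2 by (auto simp: R_def x)
    ultimately show "\<exists>y. P (Suc n) y \<and> R n x y" by blast
  qed
  then obtain f where f: "\<And>n. P n (f n)" "\<And>n. R n (f n) (f (Suc n))" by blast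
  define k where "k = (\<lambda>n. fst (f n))"
  define I where "I = (\<lambda>n. fst (snd (f n)))"
  define A where "A = (\<lambda>n. snd (snd (f n)))"
  have fn: "f n = (k n, I n, A n)" for n by (simp add: k_def I_def A_def)
  have kT: "k n \<in> topspace TK" and kI: "k n \<in> I n" "k0 \<in> I n" and AT: "A n \<subseteq> topspace TA"
    and nt: "a \<in> topspace TA \<Longrightarrow> \<exists>b\<in>A n. \<forall>k\<in>I n. cmod (H k a - H k b) < 1 / real (Suc n)" for n a
    using f(1)[of n] by (auto simp: P_def fn)
  have Iinc: "I n \<subseteq> I (Suc n)" and Ainc: "A n \<subseteq> A (Suc n)"
    and psik: "\<epsilon> \<le> cmod (\<psi> (k (Suc n)) - \<psi> k0)"
    and kA: "a \<in> A n \<Longrightarrow> cmod (H (k (Suc n)) a - H k0 a) < 1 / real (Suc n)" for n a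
    using f(2)[of n] by (auto simp: R_def fn)
  have Imono: "I m \<subseteq> I n" and Amono: "A m \<subseteq> A n" if "m \<le> n" for m n
    using lift_Suc_mono_le[of I, OF Iinc that] lift_Suc_mono_le[of A, OF Ainc that] by auto
  \<comment> \<open>On the sets \<open>A n\<close> the functions \<open>H (k n)\<close> approach
    \<open>H k0\<close> by construction. Convergence is needed on a compact set, hence the
    closure.\<close>
  define B where "B = TA closure_of (\<Union>n. A n)"
  define TB where "TB = subtopology TA B"
  have BT: "B \<subseteq> topspace TA" by (simp add: B_def closure_of_subset_topspace)
  have AB: "A n \<subseteq> B" for n
    unfolding B_def by (rule order_trans[OF _ closure_of_subset]) (use AT in auto)
  have topTB: "topspace TB = B" using BT by (auto simp: TB_def)
  have compB: "compact_space TB"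
    unfolding TB_def
    by (rule compact_space_subtopology, rule closedin_compact_space[OF TA]) (simp add: B_def)
  define h where "h = (\<lambda>n a. cmod (H (k (Suc n)) a - H k0 a))"
  have lim: "(\<lambda>n. h n a) \<longlonglongrightarrow> 0" if a: "a \<in> topspace TB" for a
  proof (rule ccontr)
    assume "\<not> (\<lambda>n. h n a) \<longlonglongrightarrow> 0"
    then obtain d where d: "d > 0" "\<not> (\<forall>\<^sub>F n in sequentially. h n a < d)"
      unfolding tendsto_iff by (auto simp: h_def)
    \<comment> \<open>A cluster point \<open>x\<close> of the points with index in \<open>N\<close>
      agrees with \<open>k0\<close> on every \<open>A m\<close>, hence on \<open>B\<close> by
      continuity in the second argument. But then \<open>H (k (Suc n)) a\<close> comes close to
      \<open>H k0 a\<close> for some \<open>n \<in> N\<close>.\<close>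
    define N where "N = {n. d \<le> h n a}"
    have "infinite N"
      using d(2) by (simp add: N_def eventually_cofinite cofinite_eq_sequentially[symmetric] not_less)
    then obtain x where x: "x \<in> topspace TK"
      and cl: "\<And>U. openin TK U \<Longrightarrow> x \<in> U \<Longrightarrow> infinite {n \<in> N. k (Suc n) \<in> U}"
      using compact_space_cluster_point[OF TK, of N "\<lambda>n. k (Suc n)"] kT by blast
    have appr: "\<exists>n\<ge>m. n \<in> N \<and> cmod (H (k (Suc n)) b - H x b) < r" if "b \<in> topspace TA" "r > 0" for b r m
    proof -
      define U where "U = {k \<in> topspace TK. H k b \<in> ball (H x b) r}"
      have "openin TK U" unfolding U_def by (rule openin_continuous_map_preimage[OF cK]) (use that in auto)
      then have "infinite {n \<in> N. k (Suc n) \<in> U}" by (rule cl) (use x that in \<open>auto simp: U_def\<close>)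
      then obtain n where "n \<ge> m" "n \<in> N" "k (Suc n) \<in> U"
        by (auto simp: infinite_nat_iff_unbounded_le)
      then show ?thesis by (auto simp: U_def dist_norm norm_minus_commute)
    qed
    have eqA: "H x b = H k0 b" if b: "b \<in> A m" for b m
    proof (rule ccontr)
      assume "H x b \<noteq> H k0 b"
      then have pos: "cmod (H x b - H k0 b) / 2 > 0" (is "?r > 0") by simp
      obtain j where j: "1 / real (Suc j) < ?r" using pos nat_approx_posE by blast
      obtain n where n: "n \<ge> max m j" "cmod (H (k (Suc n)) b - H x b) < ?r"
        using appr[of b ?r "max m j"] b AT pos by blast
      have "b \<in> A n" using b Amono[of m n] n(1) by auto
      then have "cmod (H (k (Suc n)) b - H k0 b) < 1 / real (Suc n)" by (rule kA)
      also have "\<dots> \<le> 1 / real (Suc j)" using n(1) by (simp add: frac_le)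
      finally have "cmod (H (k (Suc n)) b - H k0 b) < ?r" using j by simp
      moreover have "cmod (H x b - H k0 b) \<le> cmod (H (k (Suc n)) b - H x b) + cmod (H (k (Suc n)) b - H k0 b)"
        using norm_triangle_ineq4[of "H (k (Suc n)) b - H k0 b" "H (k (Suc n)) b - H x b"] by simp
      ultimately show False using n(2) by simp
    qed
    have "closedin TA {b \<in> topspace TA. H x b - H k0 b \<in> {0}}"
      by (rule closedin_continuous_map_preimage[of _ euclidean]) (use cA x k0 in \<open>auto intro!: continuous_map_diff\<close>)
    then have "B \<subseteq> {b \<in> topspace TA. H x b - H k0 b \<in> {0}}"
      unfolding B_def by (rule closure_of_minimal[rotated]) (use eqA AT in auto)
    then have eqa: "H x a = H k0 a" using a by (auto simp: topTB)
    obtain n where n: "n \<in> N" "cmod (H (k (Suc n)) a - H x a) < d"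
      using appr[of a d 0] a d(1) BT by (auto simp: topTB)
    then show False by (simp add: N_def h_def eqa)
  qed
  \<comment> \<open>Chosen so that \<open>C * \<eta>\<close> stays at most
    \<open>\<epsilon> / 2\<close>, whatever the sign of \<open>C\<close>.\<close>
  define \<eta> where "\<eta> = \<epsilon> / (2 * (\<bar>C\<bar> + 1))"
  have \<eta>: "\<eta> > 0" using \<epsilon> by (simp add: \<eta>_def)
  obtain N w where w: "\<And>n. 0 \<le> w n" "(\<Sum>n<N. w n) = 1"
    and small: "\<And>a. a \<in> topspace TB \<Longrightarrow> (\<Sum>n<N. w n * h n a) \<le> \<eta>"
  proof (rule convex_combination_small[OF compB _ _ _ lim \<eta>])
    show "continuous_map TB euclideanreal (h n)" for n
      unfolding TB_def h_def
      by (intro continuous_map_from_subtopology continuous_map_norm continuous_map_diff cA kT k0)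
    show "h n a \<le> M + M" if "a \<in> topspace TB" for n a
      unfolding h_def
      by (rule order_trans[OF norm_triangle_ineq4 add_mono]) (use that kT k0 BT bd topTB in auto)
  qed (auto simp: h_def)
  \<comment> \<open>The phases turn the differences of \<open>\<psi>\<close> into their moduli, so
    the convex combination cannot cancel.\<close>
  define \<sigma> where "\<sigma> = (\<lambda>n. cnj (sgn (\<psi> (k (Suc n)) - \<psi> k0)))"
  have \<sigma>norm: "cmod (\<sigma> n) \<le> 1" for n by (simp add: \<sigma>_def norm_sgn)
  have \<sigma>: "\<sigma> n * (\<psi> (k (Suc n)) - \<psi> k0) = of_real (cmod (\<psi> (k (Suc n)) - \<psi> k0))" for n
  proof -
    have "cnj (sgn z) * z = of_real (cmod z)" for z :: complex
      by (cases "z = 0") (auto simp: sgn_eq complex_norm_square[symmetric] power2_eq_square field_simps mult.commute)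
    then show ?thesis by (simp add: \<sigma>_def)
  qed
  \<comment> \<open>Index 0 carries \<open>k0\<close> with the negative sum of the other
    coefficients, which gives a combination of differences the shape required by
    \<open>dom\<close>.\<close>
  define \<kappa> where "\<kappa> = (\<lambda>n. case n of 0 \<Rightarrow> k0 | Suc n \<Rightarrow> k (Suc n))"
  define c where "c = (\<lambda>n. case n of 0 \<Rightarrow> - (\<Sum>n<N. of_real (w n) * \<sigma> n) | Suc n \<Rightarrow> of_real (w n) * \<sigma> n)"
  have comb: "(\<Sum>n<Suc N. c n * F (\<kappa> n)) = (\<Sum>n<N. of_real (w n) * (\<sigma> n * (F (k (Suc n)) - F k0)))" for F
    unfolding sum.lessThan_Suc_shift
    by (simp add: c_def \<kappa>_def sum_subtractf algebra_simps) (simp add: sum_distrib_left)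
  define v where "v = (\<lambda>a. \<Sum>n<Suc N. c n * H (\<kappa> n) a)"
  have vA: "cmod (v a) \<le> \<eta>" if a: "a \<in> A m" for a m
  proof -
    have "cmod (v a) \<le> (\<Sum>n<N. cmod (of_real (w n) * (\<sigma> n * (H (k (Suc n)) a - H k0 a))))"
      unfolding v_def comb[of "\<lambda>k. H k a"] by (rule norm_sum)
    also have "\<dots> \<le> (\<Sum>n<N. w n * h n a)"
      by (rule sum_mono) (use w(1) \<sigma>norm in \<open>auto simp: norm_mult h_def intro!: mult_left_mono mult_left_le_one_le\<close>)
    also have "\<dots> \<le> \<eta>" using small a AB by (auto simp: topTB)
    finally show ?thesis .
  qed
  have v: "cmod (v a) \<le> \<eta>" if a: "a \<in> topspace TA" for a
  proof (rule field_le_epsilon)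
    fix r :: real assume "r > 0"
    define D where "D = (\<Sum>n<Suc N. cmod (c n))"
    have D: "D \<ge> 0" by (simp add: D_def sum_nonneg)
    obtain j where j: "1 / real (Suc j) < r / (D + 1)"
      using nat_approx_posE[of "r / (D + 1)"] \<open>r > 0\<close> D by auto
    \<comment> \<open>From \<open>N\<close> on all points of the combination lie in
      \<open>I m\<close>; from \<open>j\<close> on the net \<open>A m\<close> is fine enough for the
      total weight \<open>D\<close>. So the bound on \<open>A m\<close> extends to \<open>TA\<close>
      up to \<open>r\<close>.\<close>
    define m where "m = max N j"
    obtain b where b: "b \<in> A m" "\<forall>x\<in>I m. cmod (H x a - H x b) < 1 / real (Suc m)" using nt[OF a] by blast
    have \<kappa>I: "\<kappa> n \<in> I m" if "n < Suc N" for n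
    proof -
      have "n \<le> m" using that by (auto simp: m_def)
      then show ?thesis using kI(2)[of m] kI(1)[of n] Imono[of n m]
        by (auto simp: \<kappa>_def split: nat.splits)
    qed
    have "cmod (v a - v b) = cmod (\<Sum>n<Suc N. c n * (H (\<kappa> n) a - H (\<kappa> n) b))"
      by (simp only: v_def sum_subtractf right_diff_distrib)
    also have "\<dots> \<le> (\<Sum>n<Suc N. cmod (c n * (H (\<kappa> n) a - H (\<kappa> n) b)))" by (rule norm_sum)
    also have "\<dots> \<le> (\<Sum>n<Suc N. cmod (c n) * (1 / real (Suc m)))"
    proof (rule sum_mono)
      fix n assume "n \<in> {..<Suc N}"
      then have "cmod (H (\<kappa> n) a - H (\<kappa> n) b) \<le> 1 / real (Suc m)"
        using b(2) \<kappa>I[of n] by (simp add: less_imp_le)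
      then show "cmod (c n * (H (\<kappa> n) a - H (\<kappa> n) b)) \<le> cmod (c n) * (1 / real (Suc m))"
        unfolding norm_mult by (rule mult_left_mono) simp
    qed
    also have "\<dots> = D * (1 / real (Suc m))" unfolding D_def by (rule sum_distrib_right[symmetric])
    also have "\<dots> \<le> D * (1 / real (Suc j))" by (rule mult_left_mono) (use D in \<open>auto simp: m_def frac_le\<close>)
    also have "\<dots> \<le> D * (r / (D + 1))" by (rule mult_left_mono) (use j D in auto)
    also have "\<dots> \<le> r" using D \<open>r > 0\<close> by (simp add: field_simps)
    finally have "cmod (v a - v b) \<le> r" .
    moreover have "cmod (v a) \<le> cmod (v b) + cmod (v a - v b)" by (rule norm_triangle_sub)
    ultimately show "cmod (v a) \<le> \<eta> + r" using vA[OF b(1)] by simp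
  qed
  have "cmod (\<Sum>n<Suc N. c n * \<psi> (\<kappa> n)) \<le> C * \<eta>"
  proof (rule dom)
    show "\<kappa> n \<in> topspace TK" for n using k0 kT by (simp add: \<kappa>_def split: nat.splits)
    show "cmod (\<Sum>n<Suc N. c n * H (\<kappa> n) a) \<le> \<eta>" if "a \<in> topspace TA" for a
      using v[OF that] by (simp only: v_def)
  qed (use \<eta> in simp)
  moreover have "\<epsilon> \<le> cmod (\<Sum>n<Suc N. c n * \<psi> (\<kappa> n))"
  proof -
    have "\<epsilon> = (\<Sum>n<N. w n * \<epsilon>)" by (simp add: w(2) sum_distrib_right[symmetric])
    also have "\<dots> \<le> (\<Sum>n<N. w n * cmod (\<psi> (k (Suc n)) - \<psi> k0))"
      by (intro sum_mono mult_left_mono psik w)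
    also have "\<dots> = Re (\<Sum>n<Suc N. c n * \<psi> (\<kappa> n))"
      unfolding comb \<sigma> by simp
    also have "\<dots> \<le> cmod (\<Sum>n<Suc N. c n * \<psi> (\<kappa> n))" by (rule complex_Re_le_cmod)
    finally show ?thesis .
  qed
  moreover have "C * \<eta> < \<epsilon>"
  proof -
    have "C * \<eta> \<le> (\<bar>C\<bar> + 1) * \<eta>" by (rule mult_right_mono) (use \<eta> in auto)
    also have "\<dots> = \<epsilon> / 2" by (simp add: \<eta>_def field_simps)
    finally show ?thesis using \<epsilon> by simp
  qed
  ultimately show False by linarith
qed

section \<open>Weak topologies\<close>

lemma continuous_map_euclidean_compose:
  assumes "continuous_map T euclidean f" "continuous_on UNIV g"
  shows "continuous_map T euclidean (\<lambda>x. g (f x))"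
  using continuous_map_compose[OF assms(1), of euclidean g] assms(2) by (simp add: o_def)

lemma seminorm_onD:
  assumes "seminorm_on scl X p"
  shows "x \<in> X \<Longrightarrow> 0 \<le> p x" "x \<in> X \<Longrightarrow> y \<in> X \<Longrightarrow> p (x + y) \<le> p x + p y"
    "x \<in> X \<Longrightarrow> p (scl c x) = norm c * p x"
  using assms by (auto simp: seminorm_on_def)

lemma topspace_seminorm_topology [simp]: "topspace (seminorm_topology X Q) = X"
  by (auto simp: seminorm_topology_def)

lemma topspace_weak_topology [simp]: "topspace (weak_topology scl X Q) = X"
  by (auto simp: weak_topology_def)

lemma openin_seminorm_ball:
  "p \<in> Q \<Longrightarrow> x \<in> X \<Longrightarrow> 0 < r \<Longrightarrow> openin (seminorm_topology X Q) {y \<in> X. p (y - x) < r}"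
  unfolding seminorm_topology_def by (rule topology_generated_by_Basis) blast

locale normed_field_vector_space = vector_space scale
  for scale :: "'k::real_normed_field \<Rightarrow> 'x::ab_group_add \<Rightarrow> 'x"
begin

lemma seminorm_on_neg:
  assumes "seminorm_on scale X p" "x \<in> X"
  shows "p (- x) = p x"
  using seminorm_onD(3)[OF assms, of "-1"] by simp

lemma seminorm_on_diff:
  assumes "seminorm_on scale X p" "subspace X" "x \<in> X" "y \<in> X"
  shows "p (x - y) \<le> p x + p y"
  using seminorm_onD(2)[OF assms(1,3), of "- y"] seminorm_on_neg[OF assms(1,4)]
    subspace_neg[OF assms(2,4)] by simp

lemma locally_convex_spaceI:
  assumes X: "subspace X" and Q: "\<And>p. p \<in> Q \<Longrightarrow> seminorm_on scale X p"
    and sep: "\<And>x. x \<in> X \<Longrightarrow> x \<noteq> 0 \<Longrightarrow> \<exists>p\<in>Q. p x \<noteq> 0"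
  shows "locally_convex_space scale X Q"
proof unfold_locales
  show "Hausdorff_space (seminorm_topology X Q)"
    unfolding Hausdorff_space_def
  proof clarsimp
    fix x y assume x: "x \<in> X" and y: "y \<in> X" and "x \<noteq> y"
    then obtain p where p: "p \<in> Q" "p (x - y) \<noteq> 0"
      using sep[of "x - y"] subspace_diff[OF X x y] by auto
    define r where "r = p (x - y) / 2"
    have r: "r > 0" using seminorm_onD(1)[OF Q[OF p(1)] subspace_diff[OF X x y]] p(2) by (simp add: r_def)
    have "disjnt {z \<in> X. p (z - x) < r} {z \<in> X. p (z - y) < r}"
    proof -
      have False if z: "z \<in> X" "p (z - x) < r" "p (z - y) < r" for z
      proof -
        have "p (x - y) = p ((z - y) - (z - x))" by simp
        also have "\<dots> \<le> p (z - y) + p (z - x)"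
          by (intro seminorm_on_diff[OF Q[OF p(1)] X] subspace_diff X x y z)
        finally show False using z by (simp add: r_def)
      qed
      then show ?thesis by (auto simp: disjnt_def)
    qed
    moreover have "x \<in> {z \<in> X. p (z - x) < r}" "y \<in> {z \<in> X. p (z - y) < r}"
      using seminorm_onD(3)[OF Q[OF p(1)] x, of 0] r x y by auto
    ultimately show "\<exists>U. openin (seminorm_topology X Q) U \<and>
         (\<exists>V. openin (seminorm_topology X Q) V \<and> x \<in> U \<and> y \<in> V \<and> disjnt U V)"
      using openin_seminorm_ball[OF p(1) x r] openin_seminorm_ball[OF p(1) y r] by blast
  qed
qed (use X Q in auto)

end

context locally_convex_space
begin

sublocale normed_field_vector_space scl ..

lemma carrier_closed:
  "0 \<in> X" "x \<in> X \<Longrightarrow> y \<in> X \<Longrightarrow> x + y \<in> X" "x \<in> X \<Longrightarrow> scl c x \<in> X" "x \<in> X \<Longrightarrow> - x \<in> X"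
  "x \<in> X \<Longrightarrow> y \<in> X \<Longrightarrow> x - y \<in> X"
  using subspace_carrier by (auto intro: subspace_0 subspace_add subspace_scale subspace_neg subspace_diff)

lemma linear_functional_on_diff:
  assumes "linear_functional_on scl X \<phi>" "x \<in> X" "y \<in> X"
  shows "\<phi> (x - y) = \<phi> x - \<phi> y"
proof -
  have "\<phi> (x - y + y) = \<phi> (x - y) + \<phi> y"
    using assms carrier_closed(5) unfolding linear_functional_on_def by blast
  then show ?thesis by simp
qed

lemma linear_functional_on_sum:
  assumes "linear_functional_on scl X \<phi>" "\<And>i. i \<in> I \<Longrightarrow> x i \<in> X"
  shows "\<phi> (\<Sum>i\<in>I. scl (c i) (x i)) = (\<Sum>i\<in>I. c i * \<phi> (x i))"
proof -
  have add: "\<phi> (x + y) = \<phi> x + \<phi> y" and sc: "\<phi> (scl r x) = r * \<phi> x"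
    if "x \<in> X" "y \<in> X" for x y r
    using assms(1) that by (auto simp: linear_functional_on_def)
  have zero: "\<phi> 0 = 0" using add[of 0 0] carrier_closed(1) by simp
  show ?thesis using assms(2)
  proof (induction I rule: infinite_finite_induct)
    case (insert i I)
    have "(\<Sum>i\<in>I. scl (c i) (x i)) \<in> X"
      by (intro subspace_sum subspace_carrier carrier_closed(3)) (use insert in auto)
    then show ?case using insert by (simp add: add sc carrier_closed)
  qed (auto simp: zero)
qed

text \<open>If all seminorms vanish at \<open>x - y\<close>, no subbasic set contains
  \<open>x\<close> without \<open>y\<close>; by induction on the generation of open sets no open set
  does, against the Hausdorff property.\<close>

lemma seminorm_separates:
  assumes "x \<in> X" "y \<in> X" "x \<noteq> y"
  obtains p where "p \<in> Q" "0 < p (x - y)"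
proof (rule ccontr)
  assume neg: "\<not> thesis"
  have zero: "p (x - y) = 0" if "p \<in> Q" for p
    using seminorm_onD(1)[OF seminorms[OF that] carrier_closed(5)[OF assms(1,2)]] neg \<open>p \<in> Q\<close> that
    by (metis \<open>\<And>p. \<lbrakk>p \<in> Q; 0 < p (x - y)\<rbrakk> \<Longrightarrow> thesis\<close> less_eq_real_def)
  have same: "x \<in> U \<Longrightarrow> y \<in> U" if "openin (seminorm_topology X Q) U" for U
  proof -
    have "generate_topology_on (insert X {{y \<in> X. p (y - x) < r} |p x r. p \<in> Q \<and> x \<in> X \<and> 0 < r}) U"
      using that unfolding seminorm_topology_def by (rule openin_topology_generated_by)
    then show "x \<in> U \<Longrightarrow> y \<in> U"
    proof (induction rule: generate_topology_on.induct)
      case (Basis s)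
      then consider "s = X" | p z r where "s = {y \<in> X. p (y - z) < r}" "p \<in> Q" "z \<in> X" by blast
      then show ?case
      proof cases
        case 2
        have "p (y - z) = p ((x - z) - (x - y))" by simp
        also have "\<dots> \<le> p (x - z) + p (x - y)"
          by (rule seminorm_on_diff[OF seminorms[OF 2(2)] subspace_carrier])
             (use 2 assms carrier_closed in auto)
        also have "\<dots> = p (x - z)" using zero 2 by simp
        finally show ?thesis using 2 Basis(2) assms by auto
      qed (use assms in auto)
    qed auto
  qed
  obtain U V where "openin (seminorm_topology X Q) U" "openin (seminorm_topology X Q) V"
    "x \<in> U" "y \<in> V" "disjnt U V"
    using Hausdorff assms unfolding Hausdorff_space_def topspace_seminorm_topology by blast
  with same show False by (auto simp: disjnt_def)
qed

lemma continuous_dualI: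
  assumes lin: "linear_functional_on scl X \<phi>" and p: "p \<in> Q" and le: "\<And>x. x \<in> X \<Longrightarrow> norm (\<phi> x) \<le> C * p x"
  shows "\<phi> \<in> continuous_dual scl X Q"
proof -
  have "openin (seminorm_topology X Q) {x \<in> X. \<phi> x \<in> U}" if U: "open U" for U
  proof (subst openin_subopen, clarify)
    fix x assume x: "x \<in> X" "\<phi> x \<in> U"
    obtain e where e: "e > 0" "ball (\<phi> x) e \<subseteq> U" using U x(2) by (meson openE)
    define r where "r = e / (\<bar>C\<bar> + 1)"
    have r: "r > 0" using e by (simp add: r_def)
    have "\<phi> y \<in> U" if y: "y \<in> X" "p (y - x) < r" for y
    proof -
      have "norm (\<phi> y - \<phi> x) \<le> C * p (y - x)"
        using le[of "y - x"] linear_functional_on_diff[OF lin y(1) x(1)] carrier_closed(5)[OF y(1) x(1)] by simp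
      also have "\<dots> \<le> (\<bar>C\<bar> + 1) * p (y - x)"
        by (rule mult_right_mono) (use seminorm_onD(1)[OF seminorms[OF p]] carrier_closed x y in auto)
      also have "\<dots> < (\<bar>C\<bar> + 1) * r" by (rule mult_strict_left_mono) (use y in auto)
      also have "\<dots> = e" by (simp add: r_def)
      finally show ?thesis using e(2) by (auto simp: dist_norm norm_minus_commute)
    qed
    moreover have "x \<in> {y \<in> X. p (y - x) < r}"
      using x r seminorm_onD(3)[OF seminorms[OF p] x(1), of 0] by simp
    ultimately show "\<exists>T. openin (seminorm_topology X Q) T \<and> x \<in> T \<and> T \<subseteq> {x \<in> X. \<phi> x \<in> U}"
      using openin_seminorm_ball[OF p x(1) r] by blast
  qed
  then show ?thesis using lin by (auto simp: continuous_dual_def continuous_map_def)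
qed

text \<open>Directedness makes the balls of single seminorms a neighbourhood base at 0, so one of
  them lies in the preimage of the unit disc; scaling does the rest.\<close>

lemma continuous_dual_dominated:
  assumes \<phi>: "\<phi> \<in> continuous_dual scl X Q" and ne: "Q \<noteq> {}"
    and dir: "\<And>p q. p \<in> Q \<Longrightarrow> q \<in> Q \<Longrightarrow> \<exists>r\<in>Q. \<forall>x\<in>X. p x \<le> r x \<and> q x \<le> r x"
  obtains p C where "p \<in> Q" "0 \<le> C" "\<And>x. x \<in> X \<Longrightarrow> norm (\<phi> x) \<le> C * p x"
proof -
  have lin: "linear_functional_on scl X \<phi>" and cont: "continuous_map (seminorm_topology X Q) euclidean \<phi>"
    using \<phi> by (auto simp: continuous_dual_def)
  have nbhd: "\<exists>p\<in>Q. \<exists>r>0. \<forall>x\<in>X. p x < r \<longrightarrow> x \<in> U" if "openin (seminorm_topology X Q) U" "0 \<in> U" for U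
  proof -
    have "generate_topology_on (insert X {{y \<in> X. p (y - x) < r} |p x r. p \<in> Q \<and> x \<in> X \<and> 0 < r}) U"
      using that unfolding seminorm_topology_def by (intro openin_topology_generated_by)
    then show ?thesis using that(2)
    proof (induction rule: generate_topology_on.induct)
      case (Int a b)
      then obtain p r q s where pq: "p \<in> Q" "r > 0" "\<forall>x\<in>X. p x < r \<longrightarrow> x \<in> a" "q \<in> Q" "s > 0"
        "\<forall>x\<in>X. q x < s \<longrightarrow> x \<in> b" by blast
      obtain t where t: "t \<in> Q" "\<forall>x\<in>X. p x \<le> t x \<and> q x \<le> t x" using dir pq by blast
      have "\<forall>x\<in>X. t x < min r s \<longrightarrow> x \<in> a \<inter> b" using pq t by (auto dest: order.strict_trans1)
      then show ?case using t(1) pq by (intro bexI[of _ t] exI[of _ "min r s"]) auto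
    next
      case (UN K)
      then show ?case by (metis UnionE UnionI)
    next
      case (Basis s)
      then consider "s = X" | p z r where "s = {y \<in> X. p (y - z) < r}" "p \<in> Q" "z \<in> X" by blast
      then show ?case
      proof cases
        case 1
        then show ?thesis using ne by (auto intro: zero_less_one)
      next
        case 2
        have pz: "p z < r" using Basis 2 seminorm_on_neg[OF seminorms[OF 2(2)] 2(3)] by auto
        have "x \<in> s" if "x \<in> X" "p x < r - p z" for x
          using seminorm_on_diff[OF seminorms[OF 2(2)] subspace_carrier that(1) 2(3)] that 2(1) by simp
        then show ?thesis using pz 2(2) by (intro bexI[of _ p] exI[of _ "r - p z"]) auto
      qed
    qed auto
  qed
  have zero: "\<phi> 0 = 0" using linear_functional_on_diff[OF lin, of 0 0] carrier_closed by simp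
  have "openin (seminorm_topology X Q) {x \<in> X. \<phi> x \<in> ball 0 1}"
    using openin_continuous_map_preimage[OF cont, of "ball 0 1"] by simp
  then obtain p r where p: "p \<in> Q" and r: "r > 0" and pr: "\<And>x. x \<in> X \<Longrightarrow> p x < r \<Longrightarrow> norm (\<phi> x) < 1"
    using nbhd[of "{x \<in> X. \<phi> x \<in> ball 0 1}"] zero carrier_closed(1) by auto
  have "norm (\<phi> x) \<le> (1 / r) * p x" if x: "x \<in> X" for x
  proof (rule field_le_epsilon)
    fix e :: real assume e: "e > 0"
    have p0: "0 \<le> p x" using seminorm_onD(1)[OF seminorms[OF p] x] .
    \<comment> \<open>The summand \<open>r * e\<close> keeps the denominator positive when
      \<open>p x = 0\<close> and brings \<open>scl s x\<close> strictly inside the ball of radius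
      \<open>r\<close>; it costs exactly the error \<open>e\<close>.\<close>
    define s where "s = r / (p x + r * e)"
    have pos: "p x + r * e > 0" using p0 r e by (simp add: add_nonneg_pos)
    have s: "s > 0" using pos r by (simp add: s_def)
    have "p (scl (of_real s) x) = s * p x" using seminorm_onD(3)[OF seminorms[OF p] x] s by simp
    also have "\<dots> < r" using pos r e by (simp add: s_def field_simps)
    finally have "norm (\<phi> (scl (of_real s) x)) < 1" using pr carrier_closed(3)[OF x] by blast
    moreover have "\<phi> (scl (of_real s) x) = of_real s * \<phi> x"
      using lin x by (auto simp: linear_functional_on_def)
    ultimately have "s * norm (\<phi> x) < 1" using s by (simp add: norm_mult)
    then have "norm (\<phi> x) < 1 / s" using s by (simp add: field_simps)
    also have "1 / s = (1 / r) * p x + e" using r pos by (simp add: s_def field_simps)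
    finally show "norm (\<phi> x) \<le> (1 / r) * p x + e" by simp
  qed
  with p r that show ?thesis by (metis less_eq_real_def zero_less_divide_1_iff)
qed

lemma continuous_map_weak_functional:
  assumes "\<phi> \<in> continuous_dual scl X Q"
  shows "continuous_map (weak_topology scl X Q) euclidean \<phi>"
proof -
  have "openin (weak_topology scl X Q) {x \<in> X. \<phi> x \<in> V}" if "open V" for V
    unfolding weak_topology_def by (rule topology_generated_by_Basis) (use assms that in blast)
  then show ?thesis by (simp add: continuous_map_def)
qed

text \<open>The universal property of the initial topology for the dual; all weak continuity below
  is checked through it.\<close>

lemma continuous_map_into_weak:
  "continuous_map Z (weak_topology scl X Q) g \<longleftrightarrow>
     g ` topspace Z \<subseteq> X \<and> (\<forall>\<phi>\<in>continuous_dual scl X Q. continuous_map Z euclidean (\<lambda>z. \<phi> (g z)))"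
  (is "?L \<longleftrightarrow> ?R")
proof
  assume L: ?L
  then have "g ` topspace Z \<subseteq> X" using continuous_map_image_subset_topspace by fastforce
  moreover have "continuous_map Z euclidean (\<lambda>z. \<phi> (g z))" if "\<phi> \<in> continuous_dual scl X Q" for \<phi>
    using continuous_map_compose[OF L continuous_map_weak_functional[OF that]] by (simp add: o_def)
  ultimately show ?R by blast
next
  assume R: ?R
  show ?L unfolding weak_topology_def
  proof (rule continuous_on_generated_topo)
    fix U assume "U \<in> insert X {{x \<in> X. \<phi> x \<in> V} |\<phi> V. \<phi> \<in> continuous_dual scl X Q \<and> open V}"
    then consider "U = X" | \<phi> V where "U = {x \<in> X. \<phi> x \<in> V}" "\<phi> \<in> continuous_dual scl X Q" "open V" by blast
    then show "openin Z (g -` U \<inter> topspace Z)"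
    proof cases
      case 1
      then have "g -` U \<inter> topspace Z = topspace Z" using R by auto
      then show ?thesis by simp
    next
      case 2
      have "openin Z {z \<in> topspace Z. \<phi> (g z) \<in> V}"
        by (rule openin_continuous_map_preimage[where Y = euclidean]) (use R 2 in auto)
      moreover have "g -` U \<inter> topspace Z = {z \<in> topspace Z. \<phi> (g z) \<in> V}" using R 2 by auto
      ultimately show ?thesis by simp
    qed
  qed (use R in auto)
qed

end

locale real_locally_convex_space = locally_convex_space scl X Q
  for scl :: "real \<Rightarrow> 'x::ab_group_add \<Rightarrow> 'x" and X Q
begin

sublocale real_subspace scl X
  by unfold_locales (rule subspace_carrier)

lemma seminorm_sublinear: "p \<in> Q \<Longrightarrow> sublinear_on scl X p"
  using seminorm_onD[OF seminorms[of p]] by (auto simp: sublinear_on_def)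

lemma dominated_continuous_dual:
  assumes "linear_functional_on scl X \<phi>" "p \<in> Q" "\<And>x. x \<in> X \<Longrightarrow> \<phi> x \<le> p x"
  shows "\<phi> \<in> continuous_dual scl X Q"
proof (rule continuous_dualI[OF assms(1,2), of 1])
  fix x assume x: "x \<in> X"
  have "- \<phi> x = \<phi> (- x)"
    using linear_functional_on_diff[OF assms(1), of 0 x] linear_functional_on_diff[OF assms(1), of 0 0]
      zero_mem x by simp
  also have "\<dots> \<le> p x" using assms(3)[OF neg_mem[OF x]] seminorm_on_neg[OF seminorms[OF assms(2)] x] by simp
  finally show "norm (\<phi> x) \<le> 1 * p x" using assms(3)[OF x] by simp
qed

lemma separating_functional:
  assumes "p \<in> Q" "A \<subseteq> X" "A \<noteq> {}" "convex_on_scale scl A" "\<And>a. a \<in> A \<Longrightarrow> \<epsilon> \<le> p a"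
  obtains \<phi> where "\<phi> \<in> continuous_dual scl X Q" "linear_functional_on scl X \<phi>"
    "\<And>x. x \<in> X \<Longrightarrow> \<phi> x \<le> p x" "\<And>a. a \<in> A \<Longrightarrow> \<epsilon> \<le> \<phi> a"
  using Hahn_Banach_separation[OF seminorm_sublinear[OF assms(1)] assms(2-5)]
    dominated_continuous_dual[OF _ assms(1)] by metis

lemma norming_functional:
  assumes "p \<in> Q" "x \<in> X"
  obtains \<phi> where "\<phi> \<in> continuous_dual scl X Q" "linear_functional_on scl X \<phi>"
    "\<And>y. y \<in> X \<Longrightarrow> \<phi> y \<le> p y" "\<phi> x = p x"
proof -
  have conv: "convex_on_scale scl {x}"
    by (auto simp: convex_on_scale_def simp flip: scale_left_distrib)
  show ?thesis
    by (rule separating_functional[OF assms(1) _ _ conv, of "p x"])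
       (use assms that in \<open>auto intro: antisym\<close>)
qed

lemma openin_weak_halfspace:
  assumes "\<phi> \<in> continuous_dual scl X Q"
  shows "openin (weak_topology scl X Q) {x \<in> X. c < \<phi> x}"
  using openin_continuous_map_preimage[OF continuous_map_weak_functional[OF assms], of "{c<..}"] by simp

lemma Hausdorff_weak: "Hausdorff_space (weak_topology scl X Q)"
  unfolding Hausdorff_space_def
proof clarsimp
  fix x y assume x: "x \<in> X" and y: "y \<in> X" and "x \<noteq> y"
  then obtain p where p: "p \<in> Q" "0 < p (x - y)" by (rule seminorm_separates)
  obtain \<phi> where \<phi>: "\<phi> \<in> continuous_dual scl X Q" "linear_functional_on scl X \<phi>" "\<phi> (x - y) = p (x - y)"
    using norming_functional[OF p(1) diff_mem[OF x y]] by metis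
  then have "\<phi> x \<noteq> \<phi> y" using p linear_functional_on_diff[OF \<phi>(2) x y] by simp
  then obtain U V where UV: "open U" "open V" "\<phi> x \<in> U" "\<phi> y \<in> V" "U \<inter> V = {}"
    using hausdorff by meson
  have "openin (weak_topology scl X Q) {x \<in> X. \<phi> x \<in> W}" if "open W" for W
    using openin_continuous_map_preimage[OF continuous_map_weak_functional[OF \<phi>(1)], of W] that by simp
  then show "\<exists>U. openin (weak_topology scl X Q) U \<and>
     (\<exists>V. openin (weak_topology scl X Q) V \<and> x \<in> U \<and> y \<in> V \<and> disjnt U V)"
    using UV x y by (intro exI[of _ "{x \<in> X. \<phi> x \<in> U}"] conjI exI[of _ "{x \<in> X. \<phi> x \<in> V}"])
      (auto simp: disjnt_def)
qed

text \<open>A point \<open>x\<close> outside the ball is cut off from it by a weakly open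
  half-space, given by a functional below \<open>p\<close> that attains \<open>p\<close> at
  \<open>x - y\<close>.\<close>

lemma closedin_weak_seminorm_ball:
  assumes p: "p \<in> Q" and y: "y \<in> X"
  shows "closedin (weak_topology scl X Q) {x \<in> X. p (x - y) \<le> r}"
proof -
  have "openin (weak_topology scl X Q) (X - {x \<in> X. p (x - y) \<le> r})"
  proof (subst openin_subopen, intro ballI)
    fix x assume "x \<in> X - {x \<in> X. p (x - y) \<le> r}"
    then have x: "x \<in> X" "\<not> p (x - y) \<le> r" by auto
    obtain \<phi> where \<phi>: "\<phi> \<in> continuous_dual scl X Q" "linear_functional_on scl X \<phi>"
      "\<And>y. y \<in> X \<Longrightarrow> \<phi> y \<le> p y" "\<phi> (x - y) = p (x - y)"
      using norming_functional[OF p diff_mem[OF x(1) y]] by metis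
    have "z \<in> X - {x \<in> X. p (x - y) \<le> r}" if "z \<in> {z \<in> X. r + \<phi> y < \<phi> z}" for z
      using that \<phi>(3)[of "z - y"] linear_functional_on_diff[OF \<phi>(2) _ y] diff_mem[OF _ y] by force
    moreover have "x \<in> {z \<in> X. r + \<phi> y < \<phi> z}"
      using x \<phi>(4) linear_functional_on_diff[OF \<phi>(2) x(1) y] by auto
    ultimately show "\<exists>T. openin (weak_topology scl X Q) T \<and> x \<in> T \<and> T \<subseteq> X - {x \<in> X. p (x - y) \<le> r}"
      using openin_weak_halfspace[OF \<phi>(1)] by blast
  qed
  then show ?thesis by (auto simp: closedin_def)
qed

text \<open>Iterating binary rational combinations keeps each level countable, and the union over
  all levels is closed under such combinations, which gives a countable dense part of the convex
  hull.\<close>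

primrec rational_hull :: "'x set \<Rightarrow> nat \<Rightarrow> 'x set" where
  "rational_hull D 0 = D"
| "rational_hull D (Suc n) =
     (\<lambda>(q, a, b). scl (1 - of_rat q) a + scl (of_rat q) b) ` ({q. 0 \<le> q \<and> q \<le> 1} \<times> rational_hull D n \<times> rational_hull D n)"

lemma countable_rational_hull: "countable D \<Longrightarrow> countable (rational_hull D n)"
  by (induction n) auto

lemma rational_hull_subset: "D \<subseteq> X \<Longrightarrow> rational_hull D n \<subseteq> X"
  by (induction n) (auto intro!: add_mem scale_mem)

lemma rational_hull_mono:
  assumes "m \<le> n"
  shows "rational_hull D m \<subseteq> rational_hull D n"
proof (rule lift_Suc_mono_le[OF _ assms])
  fix n
  show "rational_hull D n \<subseteq> rational_hull D (Suc n)"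
  proof
    fix x assume "x \<in> rational_hull D n"
    then show "x \<in> rational_hull D (Suc n)"
      by (auto intro!: image_eqI[of _ _ "(0, x, x)"])
  qed
qed

text \<open>Mazur's theorem: the seminorm closure of the rational convex hull is convex, hence weakly closed.\<close>

lemma weak_closure_countable:
  assumes p: "p \<in> Q" and D: "countable D" "D \<subseteq> X"
  obtains Z where "countable Z" "Z \<subseteq> X"
    "\<And>y e. y \<in> weak_topology scl X Q closure_of D \<Longrightarrow> 0 < e \<Longrightarrow> \<exists>z\<in>Z. p (y - z) < e"
proof -
  define Z where "Z = (\<Union>n. rational_hull D n)"
  have "D \<subseteq> Z" unfolding Z_def using UN_upper[of 0 UNIV "rational_hull D"] by simp
  moreover have "countable Z" "Z \<subseteq> X"
    using countable_rational_hull[OF D(1)] rational_hull_subset[OF D(2)] by (auto simp: Z_def)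
  ultimately have Z: "countable Z" "Z \<subseteq> X" "D \<subseteq> Z" by auto
  have comb: "scl (1 - of_rat q) a + scl (of_rat q) b \<in> Z" if ab: "a \<in> Z" "b \<in> Z" and q: "0 \<le> q" "q \<le> 1" for a b q
  proof -
    obtain m n where "a \<in> rational_hull D m" "b \<in> rational_hull D n" using ab by (auto simp: Z_def)
    then have "a \<in> rational_hull D (max m n)" "b \<in> rational_hull D (max m n)"
      using rational_hull_mono[of m "max m n" D] rational_hull_mono[of n "max m n" D] by auto
    then have "scl (1 - of_rat q) a + scl (of_rat q) b \<in> rational_hull D (Suc (max m n))"
      using q by (auto intro!: image_eqI[of _ _ "(q, a, b)"])
    then show ?thesis unfolding Z_def by blast
  qed
  define C where "C = {x \<in> X. \<forall>e>0. \<exists>z\<in>Z. p (x - z) < e}"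
  note sn = seminorms[OF p]
  have p0: "p 0 = 0" using seminorm_onD(3)[OF sn zero_mem, of 0] by simp
  have ZC: "Z \<subseteq> C"
  proof
    fix z assume z: "z \<in> Z"
    then have "\<exists>z'\<in>Z. p (z - z') < e" if "e > 0" for e using that p0 by (intro bexI[of _ z]) auto
    then show "z \<in> C" using z Z by (auto simp: C_def)
  qed
  have conv: "convex_on_scale scl C" unfolding convex_on_scale_def
  proof (intro ballI allI impI)
    fix x y and t :: real assume x: "x \<in> C" and y: "y \<in> C" and t: "0 \<le> t \<and> t \<le> 1"
    have xy: "x \<in> X" "y \<in> X" using x y by (auto simp: C_def)
    have "\<exists>z\<in>Z. p (scl (1 - t) x + scl t y - z) < e" if e: "e > 0" for e
    proof -
      obtain a b where a: "a \<in> Z" "p (x - a) < e/2" and b: "b \<in> Z" "p (y - b) < e/2"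
        using x y e by (auto simp: C_def dest!: spec[of _ "e/2"])
      have ab: "a \<in> X" "b \<in> X" using a b Z by auto
      \<comment> \<open>Replacing \<open>t\<close> by a rational \<open>q\<close> costs at most
        \<bar>\<open>t - q\<close>\<bar> times \<open>p (a - b)\<close>; with this \<open>d\<close>
        the cost stays below \<open>e / 2\<close>.\<close>
      define d where "d = e / (2 * (p (a - b) + 1))"
      have pab: "0 \<le> p (a - b)" by (rule seminorm_onD(1)[OF sn diff_mem[OF ab]])
      have d: "d > 0" using e pab by (simp add: d_def)
      obtain q where q: "0 \<le> q" "q \<le> 1" "\<bar>t - of_rat q\<bar> < d"
      proof (cases "t = 0")
        case True
        then show ?thesis using that[of 0] d by simp
      next
        case False
        then obtain q where "max 0 (t - d) < of_rat q" "of_rat q < t"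
          using of_rat_dense[of "max 0 (t - d)" t] t d by auto
        then have "0 < q" "q < 1" "\<bar>t - of_rat q\<bar> < d" using t
          by (auto simp: abs_if) (metis of_rat_1 of_rat_less order.strict_trans2)
        then show ?thesis using that[of q] by simp
      qed
      let ?z = "scl (1 - of_rat q) a + scl (of_rat q) b"
      have "scl (1 - t) x + scl t y - ?z =
          scl (1 - t) (x - a) + (scl t (y - b) + scl (t - of_rat q) (b - a))"
        by (simp add: algebra_simps)
      also have "p \<dots> \<le> p (scl (1 - t) (x - a)) + (p (scl t (y - b)) + p (scl (t - of_rat q) (b - a)))"
        by (intro order_trans[OF seminorm_onD(2)[OF sn]] add_left_mono seminorm_onD(2)[OF sn]
              add_mem scale_mem diff_mem ab xy)
      also have "\<dots> = (1 - t) * p (x - a) + (t * p (y - b) + \<bar>t - of_rat q\<bar> * p (a - b))"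
        using t seminorm_onD(3)[OF sn] seminorm_on_neg[OF sn diff_mem[OF ab]] ab xy diff_mem by simp
      also have "\<dots> \<le> (1 - t) * (e/2) + (t * (e/2) + d * p (a - b))"
        using a b q t pab by (intro add_mono mult_left_mono mult_right_mono) auto
      also have "\<dots> = e/2 + d * p (a - b)" by (simp add: field_simps)
      also have "d * p (a - b) < d * (p (a - b) + 1)" using d by simp
      also have "\<dots> = e/2" using pab by (simp add: d_def field_simps)
      finally have "p (scl (1 - t) x + scl t y - ?z) < e" by simp
      then show ?thesis using comb[OF a(1) b(1) q(1,2)] by blast
    qed
    then show "scl (of_real (1 - t)) x + scl (of_real t) y \<in> C"
      using xy by (auto simp: C_def intro!: add_mem scale_mem)
  qed
  have "\<exists>z\<in>Z. p (y - z) < e" if y: "y \<in> weak_topology scl X Q closure_of D" and e: "0 < e" for y e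
  proof (rule ccontr)
    assume "\<not> (\<exists>z\<in>Z. p (y - z) < e)"
    then have far: "e \<le> p (y - z)" if "z \<in> Z" for z using that by force
    have yX: "y \<in> X" using y closure_of_subset_topspace[of "weak_topology scl X Q" D] by auto
    \<comment> \<open>On this convex set \<open>p\<close> is at least \<open>e\<close>. A separating
      \<open>\<phi>\<close> satisfies \<open>\<phi> d \<le> \<phi> y - e\<close> on
      \<open>D\<close>, whereas a weak half-space around \<open>y\<close> must meet
      \<open>D\<close>.\<close>
    define A where "A = (\<lambda>c. y - c) ` C"
    have CX: "C \<subseteq> X" by (auto simp: C_def)
    have "D \<noteq> {}" using y by auto
    then have Ane: "A \<noteq> {}" using Z(3) ZC by (auto simp: A_def)
    have AX: "A \<subseteq> X" using CX yX diff_mem by (auto simp: A_def)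
    have "convex_on_scale scl A" unfolding convex_on_scale_def A_def
    proof clarify
      fix t :: real and a b assume "0 \<le> t" "t \<le> 1" "a \<in> C" "b \<in> C"
      then have "scl (1 - t) a + scl t b \<in> C" using conv by (auto simp: convex_on_scale_def)
      moreover have "scl (of_real (1 - t)) (y - a) + scl (of_real t) (y - b) = y - (scl (1 - t) a + scl t b)"
        by (simp add: algebra_simps)
      ultimately show "scl (of_real (1 - t)) (y - a) + scl (of_real t) (y - b) \<in> (-) y ` C" by blast
    qed
    moreover have "e \<le> p a" if a: "a \<in> A" for a
    proof (rule field_le_epsilon)
      fix r :: real assume r: "r > 0"
      obtain c where c: "c \<in> C" "a = y - c" using a by (auto simp: A_def)
      obtain z where z: "z \<in> Z" "p (c - z) < r" using c(1) r by (auto simp: C_def)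
      have "p (y - z) = p ((y - c) + (c - z))" by simp
      also have "\<dots> \<le> p (y - c) + p (c - z)"
        by (intro seminorm_onD(2)[OF sn] diff_mem) (use yX c CX z Z in auto)
      finally show "e \<le> p a + r" using far[OF z(1)] z(2) c by simp
    qed
    ultimately obtain \<phi> where \<phi>: "\<phi> \<in> continuous_dual scl X Q" "linear_functional_on scl X \<phi>"
      "\<And>a. a \<in> A \<Longrightarrow> e \<le> \<phi> a"
      using separating_functional[OF p AX Ane] by metis
    have "\<exists>d\<in>D. d \<in> {x \<in> X. \<phi> y - e < \<phi> x}"
      using y openin_weak_halfspace[OF \<phi>(1), of "\<phi> y - e"] yX e unfolding in_closure_of
      by (metis (no_types, lifting) diff_less_eq less_add_same_cancel1 mem_Collect_eq)
    then obtain d where d: "d \<in> D" "\<phi> y - e < \<phi> d" by auto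
    then have "e \<le> \<phi> (y - d)" using \<phi>(3) Z(3) ZC by (auto simp: A_def)
    then show False using d linear_functional_on_diff[OF \<phi>(2) yX, of d] D(2) by auto
  qed
  with Z that show ?thesis by blast
qed

end

text \<open>Real continuous functionals are exactly the real parts of complex ones, by the formula
  \<open>\<psi> x = \<phi> x - \<i> \<phi> (\<i> x)\<close>, so both duals induce the same weak
  topology.\<close>

lemma real_restriction:
  fixes scl :: "complex \<Rightarrow> 'x::ab_group_add \<Rightarrow> 'x"
  assumes "locally_convex_space scl X Q"
  defines "rscl \<equiv> \<lambda>r::real. scl (of_real r)"
  shows "locally_convex_space rscl X Q" "weak_topology rscl X Q = weak_topology scl X Q"
proof -
  interpret C: locally_convex_space scl X Q by fact
  interpret V: vector_space rscl
    by unfold_locales (auto simp: rscl_def C.scale_right_distrib C.scale_left_distrib)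
  have sub: "V.subspace X"
    unfolding V.subspace_def by (auto simp: rscl_def C.carrier_closed)
  have "seminorm_on rscl X p" if "p \<in> Q" for p
    using C.seminorms[OF that] by (simp add: seminorm_on_def rscl_def)
  with sub C.Hausdorff show L: "locally_convex_space rscl X Q" by unfold_locales
  interpret R: locally_convex_space rscl X Q by (rule L)
  have ReIm: "(\<lambda>x. Re (\<phi> x)) \<in> continuous_dual rscl X Q \<and> (\<lambda>x. Im (\<phi> x)) \<in> continuous_dual rscl X Q"
    if "\<phi> \<in> continuous_dual scl X Q" for \<phi>
    using that unfolding continuous_dual_def linear_functional_on_def rscl_def
    by (auto intro!: continuous_map_euclidean_compose[where g = Re] continuous_map_euclidean_compose[where g = Im]
        continuous_intros)
  have cplx: "\<exists>\<psi>\<in>continuous_dual scl X Q. \<forall>x\<in>X. \<phi> x = Re (\<psi> x)" if \<phi>: "\<phi> \<in> continuous_dual rscl X Q" for \<phi>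
  proof
    define \<psi> where "\<psi> = (\<lambda>x. complex_of_real (\<phi> x) - \<i> * of_real (\<phi> (scl \<i> x)))"
    show "\<forall>x\<in>X. \<phi> x = Re (\<psi> x)" by (simp add: \<psi>_def)
    have add: "\<phi> (x + y) = \<phi> x + \<phi> y" and sc: "\<phi> (scl (of_real r) x) = r * \<phi> x"
      if "x \<in> X" "y \<in> X" for x y r
      using \<phi> that by (auto simp: continuous_dual_def linear_functional_on_def rscl_def)
    have cont: "continuous_map (seminorm_topology X Q) euclideanreal \<phi>"
      using \<phi> by (auto simp: continuous_dual_def)
    \<comment> \<open>Multiplication by \<open>\<i>\<close> preserves every seminorm, so the
      preimage of a ball about \<open>x\<close> is the ball of the same radius about
      \<open>-\<i> x\<close>.\<close>
    have "continuous_map (seminorm_topology X Q) (seminorm_topology X Q) (scl \<i>)"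
    proof (subst (2) seminorm_topology_def, rule continuous_on_generated_topo)
      fix U assume "U \<in> insert X {{y \<in> X. p (y - x) < r} |p x r. p \<in> Q \<and> x \<in> X \<and> 0 < r}"
      then consider "U = X" | p x r where "U = {y \<in> X. p (y - x) < r}" "p \<in> Q" "x \<in> X" "0 < r" by blast
      then show "openin (seminorm_topology X Q) (scl \<i> -` U \<inter> topspace (seminorm_topology X Q))"
      proof cases
        case 1
        then have "scl \<i> -` U \<inter> topspace (seminorm_topology X Q) = topspace (seminorm_topology X Q)"
          using C.carrier_closed by auto
        then show ?thesis by (metis openin_topspace)
      next
        case 2
        have "p (scl \<i> y - x) = p (y - scl (-\<i>) x)" if "y \<in> X" for y
        proof -
          have "scl \<i> y - x = scl \<i> (y - scl (-\<i>) x)"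
            by (simp add: C.scale_right_diff_distrib C.scale_right_distrib)
          then show ?thesis
            using seminorm_onD(3)[OF C.seminorms[OF 2(2)], of "y - scl (-\<i>) x" \<i>] that 2(3) C.carrier_closed
            by simp
        qed
        then have "scl \<i> -` U \<inter> topspace (seminorm_topology X Q) = {y \<in> X. p (y - scl (-\<i>) x) < r}"
          using 2 C.carrier_closed by auto
        then show ?thesis using openin_seminorm_ball[OF 2(2) C.carrier_closed(3)[OF 2(3)] 2(4), of "-\<i>"] by simp
      qed
    qed (use C.carrier_closed in auto)
    then have "continuous_map (seminorm_topology X Q) euclidean \<psi>"
      unfolding \<psi>_def using cont continuous_map_compose[of "seminorm_topology X Q" "seminorm_topology X Q" "scl \<i>" euclideanreal \<phi>]
      by (intro continuous_map_diff continuous_map_euclidean_compose[where g = "\<lambda>z. \<i> * z"]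
          continuous_map_euclidean_compose[where g = complex_of_real]) (auto simp: o_def intro!: continuous_intros)
    moreover have "linear_functional_on scl X \<psi>"
      unfolding linear_functional_on_def
    proof (intro conjI ballI allI)
      fix x y assume x: "x \<in> X" and y: "y \<in> X"
      then show "\<psi> (x + y) = \<psi> x + \<psi> y"
        by (simp add: \<psi>_def add C.scale_right_distrib C.carrier_closed algebra_simps)
    next
      fix c x assume x: "x \<in> X"
      have split: "scl d x = scl (of_real (Re d)) x + scl (of_real (Im d)) (scl \<i> x)" for d
        by (simp flip: C.scale_left_distrib add: complex_eq mult.commute)
      have \<phi>s: "\<phi> (scl d x) = Re d * \<phi> x + Im d * \<phi> (scl \<i> x)" for d
        using sc[of x x] sc[of "scl \<i> x" x] add[of "scl (of_real (Re d)) x" "scl (of_real (Im d)) (scl \<i> x)"] x C.carrier_closed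
        by (subst split) simp
      show "\<psi> (scl c x) = c * \<psi> x"
        unfolding \<psi>_def C.scale_scale \<phi>s[of c] \<phi>s[of "\<i> * c"] by (simp add: complex_eq_iff algebra_simps)
    qed
    ultimately show "\<psi> \<in> continuous_dual scl X Q" by (auto simp: continuous_dual_def)
  qed
  have "continuous_map (weak_topology rscl X Q) (weak_topology scl X Q) (\<lambda>x. x)"
    unfolding C.continuous_map_into_weak
  proof (intro conjI ballI)
    fix \<phi> assume "\<phi> \<in> continuous_dual scl X Q"
    then have "continuous_map (weak_topology rscl X Q) euclidean (\<lambda>x. complex_of_real (Re (\<phi> x)) + \<i> * of_real (Im (\<phi> x)))"
      using R.continuous_map_weak_functional ReIm
      by (intro continuous_map_add continuous_map_euclidean_compose[where g = "\<lambda>z. \<i> * z"]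
          continuous_map_euclidean_compose[where g = complex_of_real]) (auto intro!: continuous_intros)
    then show "continuous_map (weak_topology rscl X Q) euclidean \<phi>" by (simp add: complex_eq[symmetric])
  qed auto
  moreover have "continuous_map (weak_topology scl X Q) (weak_topology rscl X Q) (\<lambda>x. x)"
    unfolding R.continuous_map_into_weak
  proof (intro conjI ballI)
    fix \<phi> assume "\<phi> \<in> continuous_dual rscl X Q"
    then obtain \<psi> where \<psi>: "\<psi> \<in> continuous_dual scl X Q" "\<forall>x\<in>X. \<phi> x = Re (\<psi> x)" using cplx by blast
    have "continuous_map (weak_topology scl X Q) euclidean (\<lambda>x. Re (\<psi> x))"
      using C.continuous_map_weak_functional[OF \<psi>(1)] by (rule continuous_map_euclidean_compose) (intro continuous_intros)
    then show "continuous_map (weak_topology scl X Q) euclidean \<phi>"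
      by (rule continuous_map_eq) (use \<psi>(2) in auto)
  qed auto
  ultimately show "weak_topology rscl X Q = weak_topology scl X Q"
    unfolding topology_eq
    using topology_finer_continuous_id[of "weak_topology scl X Q" "weak_topology rscl X Q"]
      topology_finer_continuous_id[of "weak_topology rscl X Q" "weak_topology scl X Q"]
    by (auto simp: id_def)
qed

section \<open>Compact semitopological semigroups\<close>

text \<open>Zorn's lemma with compactness supplying nonempty intersections of chains. It is applied
  to subsemigroups, to right ideals and to invariant convex sets, all of them stable under
  intersection.\<close>

lemma minimal_closed_set:
  assumes comp: "compact_space T" and C0: "closedin T C0" "C0 \<noteq> {}" "P C0"
    and Inter: "\<And>\<C>. \<C> \<noteq> {} \<Longrightarrow> (\<And>C. C \<in> \<C> \<Longrightarrow> P C) \<Longrightarrow> P (\<Inter>\<C>)"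
  obtains M where "closedin T M" "M \<noteq> {}" "M \<subseteq> C0" "P M"
    "\<And>N. closedin T N \<Longrightarrow> N \<noteq> {} \<Longrightarrow> N \<subseteq> M \<Longrightarrow> P N \<Longrightarrow> N = M"
proof -
  define \<S> where "\<S> = {C. closedin T C \<and> C \<noteq> {} \<and> C \<subseteq> C0 \<and> P C}"
  have "\<exists>M\<in>\<S>. \<forall>N\<in>\<S>. M \<supseteq> N \<longrightarrow> N = M"
  proof (rule predicate_Zorn)
    show "partial_order_on \<S> (relation_of (\<supseteq>) \<S>)"
      by (rule partial_order_on_relation_ofI) auto
  next
    fix \<C> assume \<C>: "\<C> \<in> Chains (relation_of (\<supseteq>) \<S>)"
    then have sub: "\<C> \<subseteq> \<S>" and chain: "\<And>A B. A \<in> \<C> \<Longrightarrow> B \<in> \<C> \<Longrightarrow> A \<subseteq> B \<or> B \<subseteq> A"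
      by (auto simp: Chains_def relation_of_def)
    show "\<exists>U\<in>\<S>. \<forall>A\<in>\<C>. A \<supseteq> U"
    proof (cases "\<C> = {}")
      case True
      then show ?thesis using C0 by (auto simp: \<S>_def)
    next
      case False
      \<comment> \<open>A finite nonempty subfamily of a chain contains its own intersection, which
        gives the finite intersection property.\<close>
      have min: "\<F> \<noteq> {} \<Longrightarrow> \<Inter>\<F> \<in> \<F>" if "finite \<F>" "\<F> \<subseteq> \<C>" for \<F>
        using that
      proof (induction \<F>)
        case (insert A \<F>)
        show ?case
        proof (cases "\<F> = {}")
          case False
          then have "\<Inter>\<F> \<in> \<F>" using insert by auto
          then have "A \<subseteq> \<Inter>\<F> \<or> \<Inter>\<F> \<subseteq> A" using chain[of A "\<Inter>\<F>"] insert.prems by auto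
          then show ?thesis using \<open>\<Inter>\<F> \<in> \<F>\<close> by (auto simp: Int_absorb1 Int_absorb2)
        qed auto
      qed auto
      have "\<Inter>\<C> \<noteq> {}"
      proof (rule comp[unfolded compact_space_fip, rule_format, OF conjI])
        show "\<forall>C\<in>\<C>. closedin T C" using sub by (auto simp: \<S>_def)
        show "\<forall>\<F>. finite \<F> \<and> \<F> \<subseteq> \<C> \<longrightarrow> \<Inter>\<F> \<noteq> {}"
        proof (intro allI impI)
          fix \<F> assume \<F>: "finite \<F> \<and> \<F> \<subseteq> \<C>"
          show "\<Inter>\<F> \<noteq> {}"
          proof (cases "\<F> = {}")
            case False
            then have "\<Inter>\<F> \<in> \<S>" using min \<F> sub by blast
            then show ?thesis by (auto simp: \<S>_def)
          qed auto
        qed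
      qed
      moreover have "closedin T (\<Inter>\<C>)" using sub False by (intro closedin_Inter) (auto simp: \<S>_def)
      moreover have "P (\<Inter>\<C>)" by (rule Inter[OF False]) (use sub in \<open>auto simp: \<S>_def\<close>)
      moreover have "\<Inter>\<C> \<subseteq> C0" using sub False by (auto simp: \<S>_def)
      ultimately have "\<Inter>\<C> \<in> \<S>" by (simp add: \<S>_def)
      then show ?thesis by blast
    qed
  qed
  then obtain M where M: "M \<in> \<S>" "\<And>N. N \<in> \<S> \<Longrightarrow> N \<subseteq> M \<Longrightarrow> N = M" by blast
  have "N = M" if "closedin T N" "N \<noteq> {}" "N \<subseteq> M" "P N" for N
    by (rule M(2)) (use that M(1) in \<open>auto simp: \<S>_def\<close>)
  then show ?thesis using that M(1) by (auto simp: \<S>_def)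
qed

text \<open>Two one-sided limits: first the left factor runs to the closure while the right one
  stays in \<open>D\<close>, then the right factor follows. Accordingly right translations are taken
  by elements of \<open>D\<close> and left translations by elements of the closure.\<close>

lemma closure_of_subsemigroup:
  assumes D: "D \<subseteq> topspace T" "\<And>x y. x \<in> D \<Longrightarrow> y \<in> D \<Longrightarrow> m x y \<in> D"
    and right: "\<And>d. d \<in> D \<Longrightarrow> continuous_map T T (\<lambda>x. m x d)"
    and left: "\<And>x. x \<in> T closure_of D \<Longrightarrow> continuous_map T T (m x)"
    and x: "x \<in> T closure_of D" and y: "y \<in> T closure_of D"
  shows "m x y \<in> T closure_of D"
proof -
  have "m x d \<in> T closure_of D" if d: "d \<in> D" for d
  proof -
    have "(\<lambda>x. m x d) ` (T closure_of D) \<subseteq> T closure_of ((\<lambda>x. m x d) ` D)"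
      by (rule continuous_map_image_closure_subset[OF right[OF d]])
    moreover have "T closure_of ((\<lambda>x. m x d) ` D) \<subseteq> T closure_of D"
      using D(2) d by (intro closure_of_mono) auto
    ultimately show ?thesis using x by auto
  qed
  then have "T closure_of (m x ` D) \<subseteq> T closure_of D"
    by (intro closure_of_minimal) auto
  moreover have "m x ` (T closure_of D) \<subseteq> T closure_of (m x ` D)"
    by (rule continuous_map_image_closure_subset[OF left[OF x]])
  ultimately show ?thesis using y by auto
qed

locale compact_semitopological_semigroup =
  fixes T :: "'e topology" and m :: "'e \<Rightarrow> 'e \<Rightarrow> 'e" (infixl "\<cdot>" 70)
  assumes compact: "compact_space T" and Hausdorff: "Hausdorff_space T" and nonempty: "topspace T \<noteq> {}"
    and closed: "x \<in> topspace T \<Longrightarrow> y \<in> topspace T \<Longrightarrow> x \<cdot> y \<in> topspace T"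
    and assoc: "x \<in> topspace T \<Longrightarrow> y \<in> topspace T \<Longrightarrow> z \<in> topspace T \<Longrightarrow> x \<cdot> y \<cdot> z = x \<cdot> (y \<cdot> z)"
    and left_continuous: "x \<in> topspace T \<Longrightarrow> continuous_map T T (\<lambda>y. x \<cdot> y)"
    and right_continuous: "y \<in> topspace T \<Longrightarrow> continuous_map T T (\<lambda>x. x \<cdot> y)"
begin

abbreviation "E \<equiv> topspace T"

lemma closedin_left_image:
  assumes "x \<in> E" "closedin T C"
  shows "closedin T ((\<lambda>y. x \<cdot> y) ` C)"
proof -
  have "compactin T ((\<lambda>y. x \<cdot> y) ` C)"
    by (rule image_compactin[OF closedin_compact_space[OF compact assms(2)] left_continuous[OF assms(1)]])
  then show ?thesis by (rule compactin_imp_closedin[OF Hausdorff])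
qed

lemma closedin_left_stabilizer:
  assumes "x \<in> E" "z \<in> E"
  shows "closedin T {y \<in> E. x \<cdot> y = z}"
  using closedin_continuous_map_preimage[OF left_continuous[OF assms(1)], of "{z}"]
    closedin_Hausdorff_sing_eq[OF Hausdorff] assms(2) by simp

text \<open>The Ellis-Numakura lemma. In a minimal closed subsemigroup \<open>M\<close>, both
  \<open>a M\<close> and the set of \<open>y \<in> M\<close> with \<open>a y = a\<close> are closed
  subsemigroups; the first equals \<open>M\<close>, so the second is nonempty and also equals
  \<open>M\<close>.\<close>

lemma idempotent_exists:
  assumes "closedin T C" "C \<noteq> {}" "\<And>x y. x \<in> C \<Longrightarrow> y \<in> C \<Longrightarrow> x \<cdot> y \<in> C"
  obtains e where "e \<in> C" "e \<cdot> e = e"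
proof -
  obtain M where M: "closedin T M" "M \<noteq> {}" "M \<subseteq> C" and sg': "\<forall>x\<in>M. \<forall>y\<in>M. x \<cdot> y \<in> M"
    and min: "\<And>N. closedin T N \<Longrightarrow> N \<noteq> {} \<Longrightarrow> N \<subseteq> M \<Longrightarrow> (\<forall>x\<in>N. \<forall>y\<in>N. x \<cdot> y \<in> N) \<Longrightarrow> N = M"
  proof (rule minimal_closed_set[OF compact assms(1,2), of "\<lambda>N. \<forall>x\<in>N. \<forall>y\<in>N. x \<cdot> y \<in> N"])
    show "\<forall>x\<in>C. \<forall>y\<in>C. x \<cdot> y \<in> C" using assms(3) by blast
    show "\<forall>x\<in>\<Inter>\<C>. \<forall>y\<in>\<Inter>\<C>. x \<cdot> y \<in> \<Inter>\<C>" if "\<And>C. C \<in> \<C> \<Longrightarrow> \<forall>x\<in>C. \<forall>y\<in>C. x \<cdot> y \<in> C" for \<C>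
      using that by (intro ballI InterI) (simp only: Inter_iff)
  qed (rule that)
  note sg = sg'[rule_format]
  have ME: "M \<subseteq> E" using M(1) closedin_subset by blast
  obtain a where a: "a \<in> M" using M by auto
  have aE: "a \<in> E" using a ME by auto
  have "(\<lambda>y. a \<cdot> y) ` M = M"
  proof (rule min)
    show "closedin T ((\<lambda>y. a \<cdot> y) ` M)" by (rule closedin_left_image[OF aE M(1)])
    show "\<forall>x\<in>(\<lambda>y. a \<cdot> y) ` M. \<forall>y\<in>(\<lambda>y. a \<cdot> y) ` M. x \<cdot> y \<in> (\<lambda>y. a \<cdot> y) ` M"
    proof clarify
      fix x y assume "x \<in> M" "y \<in> M"
      then have "a \<cdot> x \<cdot> (a \<cdot> y) = a \<cdot> (x \<cdot> (a \<cdot> y))" "x \<cdot> (a \<cdot> y) \<in> M"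
        using assoc[of a x "a \<cdot> y"] a ME sg by auto
      then show "a \<cdot> x \<cdot> (a \<cdot> y) \<in> (\<lambda>y. a \<cdot> y) ` M" by auto
    qed
  qed (use M a sg in auto)
  then have "a \<in> (\<lambda>y. a \<cdot> y) ` M" using a by simp
  then have ne: "M \<inter> {y \<in> E. a \<cdot> y = a} \<noteq> {}" using ME by force
  have "M \<inter> {y \<in> E. a \<cdot> y = a} = M"
  proof (rule min[OF _ ne])
    show "closedin T (M \<inter> {y \<in> E. a \<cdot> y = a})"
      by (intro closedin_Int M(1) closedin_left_stabilizer aE)
    show "\<forall>x\<in>M \<inter> {y \<in> E. a \<cdot> y = a}. \<forall>y\<in>M \<inter> {y \<in> E. a \<cdot> y = a}. x \<cdot> y \<in> M \<inter> {y \<in> E. a \<cdot> y = a}"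
      using sg closed by (auto simp flip: assoc[OF aE])
  qed auto
  then have "a \<cdot> a = a" using a by auto
  with a M(3) that show ?thesis by blast
qed

text \<open>The last condition says that \<open>e E\<close> is a minimal right ideal: each of its
  elements generates it.\<close>

definition minimal_idempotent :: "'e \<Rightarrow> bool" where
  "minimal_idempotent e \<longleftrightarrow> e \<in> E \<and> e \<cdot> e = e \<and> (\<forall>a\<in>(\<lambda>y. e \<cdot> y) ` E. (\<lambda>y. a \<cdot> y) ` E = (\<lambda>y. e \<cdot> y) ` E)"

text \<open>In a minimal closed right ideal \<open>R\<close> every \<open>a E\<close> is again a
  closed right ideal, hence all of \<open>R\<close>; any idempotent of \<open>R\<close> is therefore
  minimal.\<close>

lemma minimal_idempotent_exists:
  obtains e where "minimal_idempotent e"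
proof -
  obtain R where R: "closedin T R" "R \<noteq> {}" and id': "\<forall>x\<in>R. \<forall>y\<in>E. x \<cdot> y \<in> R"
    and min: "\<And>N. closedin T N \<Longrightarrow> N \<noteq> {} \<Longrightarrow> N \<subseteq> R \<Longrightarrow> (\<forall>x\<in>N. \<forall>y\<in>E. x \<cdot> y \<in> N) \<Longrightarrow> N = R"
  proof (rule minimal_closed_set[OF compact closedin_topspace nonempty, of "\<lambda>N. \<forall>x\<in>N. \<forall>y\<in>E. x \<cdot> y \<in> N"])
    show "\<forall>x\<in>E. \<forall>y\<in>E. x \<cdot> y \<in> E" using closed by blast
    show "\<forall>x\<in>\<Inter>\<C>. \<forall>y\<in>E. x \<cdot> y \<in> \<Inter>\<C>" if "\<And>C. C \<in> \<C> \<Longrightarrow> \<forall>x\<in>C. \<forall>y\<in>E. x \<cdot> y \<in> C" for \<C>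
      using that by (intro ballI InterI) (simp only: Inter_iff)
  qed (rule that)
  note id = id'[rule_format]
  have RE: "R \<subseteq> E" using R(1) closedin_subset by blast
  have aR: "(\<lambda>y. a \<cdot> y) ` E = R" if a: "a \<in> R" for a
  proof (rule min)
    have aE: "a \<in> E" using a RE by auto
    show "closedin T ((\<lambda>y. a \<cdot> y) ` E)" by (rule closedin_left_image[OF aE closedin_topspace])
    show "\<forall>x\<in>(\<lambda>y. a \<cdot> y) ` E. \<forall>y\<in>E. x \<cdot> y \<in> (\<lambda>y. a \<cdot> y) ` E"
      using assoc[OF aE] closed by auto
  qed (use a id nonempty in auto)
  obtain e where e: "e \<in> R" "e \<cdot> e = e"
    using idempotent_exists[OF R] id RE by blast
  have "minimal_idempotent e"
    using e aR RE by (auto simp: minimal_idempotent_def)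
  then show ?thesis using that by blast
qed

text \<open>For an idempotent \<open>e\<close> this is \<open>e E e\<close>. Written by equations it
  is visibly closed; it is a group once \<open>e\<close> is minimal.\<close>

definition unit_group :: "'e \<Rightarrow> 'e set" where
  "unit_group e = {x \<in> E. e \<cdot> x = x \<and> x \<cdot> e = x}"

lemma unit_group_subset: "unit_group e \<subseteq> E"
  by (auto simp: unit_group_def)

lemma unit_group_closed:
  "e \<in> E \<Longrightarrow> x \<in> unit_group e \<Longrightarrow> y \<in> unit_group e \<Longrightarrow> x \<cdot> y \<in> unit_group e"
  using closed assoc by (auto simp: unit_group_def) (metis assoc)+

text \<open>Minimality gives \<open>a E = e E\<close>, so \<open>e = a c\<close> for some
  \<open>c\<close>, and \<open>e c e\<close> is a right inverse within \<open>e E e\<close>. A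
  monoid in which every element has a right inverse is a group.\<close>

lemma unit_group_inverse:
  assumes e: "minimal_idempotent e" and a: "a \<in> unit_group e"
  obtains b where "b \<in> unit_group e" "a \<cdot> b = e" "b \<cdot> a = e"
proof -
  have eE: "e \<in> E" "e \<cdot> e = e" using e by (auto simp: minimal_idempotent_def)
  have right: "\<exists>b\<in>unit_group e. a \<cdot> b = e" if a: "a \<in> unit_group e" for a
  proof -
    have aE: "a \<in> E" "e \<cdot> a = a" "a \<cdot> e = a" using a by (auto simp: unit_group_def)
    have "a \<in> (\<lambda>y. e \<cdot> y) ` E" using aE by (metis imageI)
    then have "(\<lambda>y. a \<cdot> y) ` E = (\<lambda>y. e \<cdot> y) ` E" using e by (auto simp: minimal_idempotent_def)
    then have "e \<in> (\<lambda>y. a \<cdot> y) ` E" using eE by (metis imageI)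
    then obtain c where c: "c \<in> E" "e = a \<cdot> c" by auto
    have "e \<cdot> c \<cdot> e \<in> unit_group e"
      using c(1) eE closed by (auto simp: unit_group_def assoc) (metis assoc closed)+
    moreover have "a \<cdot> (e \<cdot> c \<cdot> e) = e"
    proof -
      have "a \<cdot> (e \<cdot> c \<cdot> e) = a \<cdot> c \<cdot> e"
        using assoc[of a "e \<cdot> c" e] assoc[of a e c] c(1) eE aE closed by simp
      then show ?thesis using c eE by simp
    qed
    ultimately show ?thesis by blast
  qed
  obtain b where b: "b \<in> unit_group e" "a \<cdot> b = e" using right[OF a] by blast
  obtain d where d: "d \<in> unit_group e" "b \<cdot> d = e" using right[OF b(1)] by blast
  have "a = a \<cdot> (b \<cdot> d)" using d a by (simp add: unit_group_def)
  also have "\<dots> = a \<cdot> b \<cdot> d" using assoc[of a b d] a b(1) d(1) by (simp add: unit_group_def)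
  also have "\<dots> = e \<cdot> d" by (simp add: b(2))
  also have "\<dots> = d" using d by (simp add: unit_group_def)
  finally show ?thesis using that b d by simp
qed

lemma closedin_unit_group:
  assumes "e \<in> E"
  shows "closedin T (unit_group e)"
proof -
  have "closedin T {x \<in> E. e \<cdot> x = x}" "closedin T {x \<in> E. x \<cdot> e = x}"
    using closedin_continuous_maps_eq[OF Hausdorff left_continuous[OF assms] continuous_map_id]
      closedin_continuous_maps_eq[OF Hausdorff right_continuous[OF assms] continuous_map_id] by (auto simp: id_def)
  then have "closedin T ({x \<in> E. e \<cdot> x = x} \<inter> {x \<in> E. x \<cdot> e = x})" by (rule closedin_Int)
  moreover have "unit_group e = {x \<in> E. e \<cdot> x = x} \<inter> {x \<in> E. x \<cdot> e = x}" by (auto simp: unit_group_def)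
  ultimately show ?thesis by simp
qed

lemma closed_subsemigroup:
  assumes "closedin T H" "H \<noteq> {}" "\<And>x y. x \<in> H \<Longrightarrow> y \<in> H \<Longrightarrow> x \<cdot> y \<in> H"
  shows "compact_semitopological_semigroup (subtopology T H) m"
proof -
  have HE: "H \<subseteq> E" using assms(1) closedin_subset by blast
  then have top: "topspace (subtopology T H) = H" by auto
  show ?thesis
  proof (unfold_locales, unfold top)
    show "compact_space (subtopology T H)"
      by (intro compact_space_subtopology closedin_compact_space[OF compact] assms)
    show "continuous_map (subtopology T H) (subtopology T H) (\<lambda>y. x \<cdot> y)" if "x \<in> H" for x
      by (rule continuous_map_into_subtopology[OF continuous_map_from_subtopology[OF left_continuous]])
         (use that HE assms(3) top in auto)
    show "continuous_map (subtopology T H) (subtopology T H) (\<lambda>y. y \<cdot> x)" if "x \<in> H" for x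
      by (rule continuous_map_into_subtopology[OF continuous_map_from_subtopology[OF right_continuous]])
         (use that HE assms(3) top in auto)
  qed (use assms HE in \<open>auto intro: Hausdorff_space_subtopology Hausdorff assoc\<close>)
qed

text \<open>A closed subsemigroup of a compact group contains an idempotent, which can only be the unit.\<close>

lemma closed_subsemigroup_of_group:
  assumes e: "minimal_idempotent e" and H: "closedin T H" "H \<noteq> {}" "H \<subseteq> unit_group e"
    and sg: "\<And>x y. x \<in> H \<Longrightarrow> y \<in> H \<Longrightarrow> x \<cdot> y \<in> H" and h: "h \<in> H"
  obtains b where "b \<in> H" "h \<cdot> b = e" "b \<cdot> h = e"
proof -
  have HE: "H \<subseteq> E" using H(3) unit_group_subset by blast
  then have top: "topspace (subtopology T H) = H" by auto
  interpret H: compact_semitopological_semigroup "subtopology T H" m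
    by (rule closed_subsemigroup[OF H(1,2) sg])
  obtain e' where "H.minimal_idempotent e'" by (rule H.minimal_idempotent_exists)
  then have e': "e' \<in> H" "e' \<cdot> e' = e'" "\<And>a. a \<in> (\<lambda>y. e' \<cdot> y) ` H \<Longrightarrow> (\<lambda>y. a \<cdot> y) ` H = (\<lambda>y. e' \<cdot> y) ` H"
    unfolding H.minimal_idempotent_def top by auto
  obtain c where c: "c \<in> unit_group e" "e' \<cdot> c = e" "c \<cdot> e' = e"
    using unit_group_inverse[OF e subsetD[OF H(3) e'(1)]] by blast
  have inE: "e' \<in> E" "c \<in> E" using e'(1) HE c(1) unit_group_subset by auto
  \<comment> \<open>Cancelling \<open>e'\<close> in \<open>e' e' = e'\<close> by its inverse in the
    large group leaves \<open>e' = e\<close>.\<close>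
  have "e' = e" using assoc[OF inE(1,1,2)] e'(2) c(2) e'(1) H(3) by (auto simp: unit_group_def)
  moreover have "(\<lambda>y. e \<cdot> y) ` H = H" using H(3) by (force simp: unit_group_def)
  ultimately have "(\<lambda>y. h \<cdot> y) ` H = H" using e'(3) h by simp
  then obtain b where b: "b \<in> H" "h \<cdot> b = e" using e'(1) \<open>e' = e\<close> by (metis imageE)
  obtain h' where h': "h' \<in> unit_group e" "h' \<cdot> h = e"
    using unit_group_inverse[OF e subsetD[OF H(3) h]] by blast
  have "h' \<cdot> h \<cdot> b = h' \<cdot> (h \<cdot> b)" using assoc h h'(1) b(1) HE unit_group_subset by blast
  then have "b = h'" using h' b H(3) by (auto simp: unit_group_def)
  then show ?thesis using that b h'(2) by simp
qed

text \<open>A common point \<open>a e b = e c\<close> of the two right ideals suffices: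
  \<open>e b\<close> generates the minimal right ideal \<open>e E\<close>, so multiplying by some
  \<open>d\<close> gives \<open>a e = e (c d)\<close>. Thus \<open>a e\<close> belongs to the group,
  and \<open>a\<close> acts on the group as left multiplication by \<open>a e\<close>, a
  bijection.\<close>

lemma reversible_acts_on_unit_group:
  assumes rev: "\<And>a b. a \<in> E \<Longrightarrow> b \<in> E \<Longrightarrow> (\<lambda>y. a \<cdot> y) ` E \<inter> (\<lambda>y. b \<cdot> y) ` E \<noteq> {}"
    and e: "minimal_idempotent e" and a: "a \<in> E" and g: "g \<in> unit_group e"
  shows "a \<cdot> g \<in> unit_group e" "\<exists>h\<in>unit_group e. a \<cdot> h = g"
proof -
  have eE: "e \<in> E" "e \<cdot> e = e" and
    R: "\<And>r. r \<in> (\<lambda>y. e \<cdot> y) ` E \<Longrightarrow> (\<lambda>y. r \<cdot> y) ` E = (\<lambda>y. e \<cdot> y) ` E"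
    using e by (auto simp: minimal_idempotent_def)
  have aeE: "a \<cdot> e \<in> E" by (rule closed[OF a eE(1)])
  obtain b c where b: "b \<in> E" and c: "c \<in> E" and eq: "a \<cdot> e \<cdot> b = e \<cdot> c"
    using rev[OF aeE eE(1)] by auto
  have r: "e \<cdot> b \<in> (\<lambda>y. e \<cdot> y) ` E" using b by blast
  then have "e \<in> (\<lambda>y. e \<cdot> b \<cdot> y) ` E" using R[OF r] eE by (metis imageI)
  then obtain d where d: "d \<in> E" "e = e \<cdot> b \<cdot> d" by auto
  have "a \<cdot> e = a \<cdot> (e \<cdot> b \<cdot> d)" using d(2) by simp
  also have "\<dots> = a \<cdot> e \<cdot> b \<cdot> d" using a eE b d(1) closed by (simp add: assoc)
  also have "\<dots> = e \<cdot> (c \<cdot> d)" using eq eE c d(1) by (simp add: assoc)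
  finally have "a \<cdot> e = e \<cdot> (c \<cdot> d)" .
  then have "e \<cdot> (a \<cdot> e) = a \<cdot> e" using eE c d(1) closed by (simp flip: assoc)
  moreover have "a \<cdot> e \<cdot> e = a \<cdot> e" using a eE by (simp add: assoc)
  ultimately have ae: "a \<cdot> e \<in> unit_group e" using aeE by (simp add: unit_group_def)
  have ag: "a \<cdot> h = a \<cdot> e \<cdot> h" if "h \<in> unit_group e" for h
    using that a eE by (simp add: unit_group_def assoc)
  show "a \<cdot> g \<in> unit_group e" unfolding ag[OF g] by (rule unit_group_closed[OF eE(1) ae g])
  obtain k where k: "k \<in> unit_group e" "a \<cdot> e \<cdot> k = e" using unit_group_inverse[OF e ae] by blast
  have kg: "k \<cdot> g \<in> unit_group e" by (rule unit_group_closed[OF eE(1) k(1) g])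
  have "a \<cdot> (k \<cdot> g) = a \<cdot> e \<cdot> k \<cdot> g"
    unfolding ag[OF kg] using aeE k(1) g by (simp add: unit_group_def assoc)
  also have "\<dots> = g" using k(2) g by (simp add: unit_group_def)
  finally show "\<exists>h\<in>unit_group e. a \<cdot> h = g" using kg by blast
qed

end

section \<open>Weakly almost periodic functions\<close>

lemma norm_le_sup_norm: "bounded (range f) \<Longrightarrow> cmod (f t) \<le> sup_norm f"
  unfolding sup_norm_def bounded_iff by (rule cSUP_upper) (auto simp: bdd_above_def)

lemma sup_norm_le: "(\<And>t. cmod (f t) \<le> c) \<Longrightarrow> sup_norm f \<le> c"
  unfolding sup_norm_def by (rule cSUP_least) auto

interpretation complex_function: normed_field_vector_space "scale_fun :: complex \<Rightarrow> ('s \<Rightarrow> complex) \<Rightarrow> ('s \<Rightarrow> complex)"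
  by unfold_locales (auto simp: scale_fun_def fun_eq_iff algebra_simps)

lemma bounded_range_add: "bounded (range f) \<Longrightarrow> bounded (range g) \<Longrightarrow> bounded (range (f + g))"
  for f g :: "'s \<Rightarrow> complex"
  using bounded_plus_comp[of f UNIV g] by (simp add: plus_fun_def)

lemma bounded_range_scale: "bounded (range f) \<Longrightarrow> bounded (range (scale_fun c f))"
  unfolding scale_fun_def using bounded_linear_image[OF _ bounded_linear_mult_right, of "range f" c]
  by (simp add: image_image)

text \<open>Serves both \<open>sup_norm\<close> on functions and \<open>compact_seminorm\<close> on
  functionals.\<close>

lemma seminorm_on_Sup_norm:
  assumes Y: "complex_function.subspace Y" and A: "A \<noteq> {}"
    and bdd: "\<And>f. f \<in> Y \<Longrightarrow> bdd_above ((\<lambda>a. cmod (f a)) ` A)"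
  shows "seminorm_on scale_fun Y (\<lambda>f. SUP a\<in>A. cmod (f a))"
proof -
  define p where "p = (\<lambda>f :: 'a \<Rightarrow> complex. SUP a\<in>A. cmod (f a))"
  have upper: "cmod (f a) \<le> p f" if "f \<in> Y" "a \<in> A" for f a
    unfolding p_def by (rule cSUP_upper[OF that(2) bdd[OF that(1)]])
  have least: "p f \<le> c" if "\<And>a. a \<in> A \<Longrightarrow> cmod (f a) \<le> c" for f c
    unfolding p_def by (rule cSUP_least[OF A that])
  have nonneg: "0 \<le> p f" if "f \<in> Y" for f
    using order_trans[OF norm_ge_zero upper[OF that]] A by blast
  have "seminorm_on scale_fun Y p"
    unfolding seminorm_on_def
  proof (intro conjI ballI allI)
    show "p (f + g) \<le> p f + p g" if "f \<in> Y" "g \<in> Y" for f g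
      by (rule least) (use upper that in \<open>auto intro: norm_triangle_le add_mono\<close>)
    fix c f assume f: "f \<in> Y"
    have le: "p (scale_fun c f) \<le> cmod c * p f" if "f \<in> Y" for c f
      by (rule least) (auto simp: scale_fun_def norm_mult intro!: mult_left_mono upper that)
    have cf: "scale_fun c f \<in> Y" by (rule complex_function.subspace_scale[OF Y f])
    show "p (scale_fun c f) = cmod c * p f"
    proof (cases "c = 0")
      case True
      then show ?thesis using le[OF f, of c] nonneg[OF cf] by simp
    next
      case False
      have "p f = p (scale_fun (1 / c) (scale_fun c f))"
        using False by (simp add: scale_fun_def)
      also have "\<dots> \<le> p (scale_fun c f) / cmod c"
        using le[OF cf, of "1 / c"] by (simp add: norm_divide)
      finally show ?thesis using False le[OF f, of c] by (simp add: field_simps)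
    qed
  qed (rule nonneg)
  then show ?thesis by (simp add: p_def)
qed

lemma locally_convex_sup_norm:
  assumes Y: "complex_function.subspace Y" and bd: "\<And>f. f \<in> Y \<Longrightarrow> bounded (range f)"
  shows "locally_convex_space scale_fun Y {sup_norm}"
proof (rule complex_function.locally_convex_spaceI[OF Y])
  fix p :: "('a \<Rightarrow> complex) \<Rightarrow> real" assume "p \<in> {sup_norm}"
  then have p: "p = (\<lambda>f. SUP t. cmod (f t))" by (auto simp: sup_norm_def)
  show "seminorm_on scale_fun Y p"
    unfolding p
    by (rule seminorm_on_Sup_norm[OF Y]) (use bd in \<open>auto simp: bounded_iff bdd_above_def\<close>)
next
  fix f assume f: "f \<in> Y" "f \<noteq> 0"
  then obtain t where "f t \<noteq> 0" by (auto simp: fun_eq_iff)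
  then have "0 < cmod (f t)" by simp
  also have "\<dots> \<le> sup_norm f" by (rule norm_le_sup_norm[OF bd[OF f(1)]])
  finally show "\<exists>p\<in>{sup_norm}. p f \<noteq> 0" by simp
qed

lemma subspace_bounded_continuous: "complex_function.subspace (bounded_continuous :: ('s::topological_space \<Rightarrow> complex) set)"
  unfolding complex_function.subspace_def
proof (intro conjI ballI allI)
  fix f g :: "'s \<Rightarrow> complex" and c
  assume f: "f \<in> bounded_continuous"
  show "scale_fun c f \<in> bounded_continuous"
    using f bounded_range_scale by (auto simp: bounded_continuous_def scale_fun_def intro!: continuous_intros)
  assume g: "g \<in> bounded_continuous"
  show "f + g \<in> bounded_continuous"
    using f g bounded_range_add by (auto simp: bounded_continuous_def plus_fun_def intro!: continuous_intros)
qed (auto simp: bounded_continuous_def zero_fun_def)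

interpretation BC: locally_convex_space scale_fun "bounded_continuous :: ('s::topological_space \<Rightarrow> complex) set" "{sup_norm}"
  by (rule locally_convex_sup_norm[OF subspace_bounded_continuous]) (simp add: bounded_continuous_def)

abbreviation weakC :: "('s::topological_space \<Rightarrow> complex) topology" where
  "weakC \<equiv> weak_topology scale_fun bounded_continuous {sup_norm}"

lemma bounded_functional_iff:
  assumes "locally_convex_space scale_fun Y {sup_norm}"
  shows "\<phi> \<in> continuous_dual scale_fun Y {sup_norm} \<longleftrightarrow>
    linear_functional_on scale_fun Y \<phi> \<and> (\<exists>C\<ge>0. \<forall>f\<in>Y. cmod (\<phi> f) \<le> C * sup_norm f)"
proof -
  interpret Y: locally_convex_space scale_fun Y "{sup_norm}" by fact
  show ?thesis
  proof
    assume \<phi>: "\<phi> \<in> continuous_dual scale_fun Y {sup_norm}"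
    then obtain C where "0 \<le> C" "\<And>f. f \<in> Y \<Longrightarrow> cmod (\<phi> f) \<le> C * sup_norm f"
      by (rule Y.continuous_dual_dominated) auto
    then show "linear_functional_on scale_fun Y \<phi> \<and> (\<exists>C\<ge>0. \<forall>f\<in>Y. cmod (\<phi> f) \<le> C * sup_norm f)"
      using \<phi> by (auto simp: continuous_dual_def)
  qed (auto intro: Y.continuous_dualI)
qed

lemma evaluation_continuous_dual: "(\<lambda>f. f t) \<in> continuous_dual scale_fun bounded_continuous {sup_norm}"
  unfolding bounded_functional_iff[OF BC.locally_convex_space_axioms]
  using norm_le_sup_norm
  by (auto simp: linear_functional_on_def scale_fun_def bounded_continuous_def intro!: exI[of _ 1])

lemma continuous_map_weakC_evaluation: "continuous_map weakC euclidean (\<lambda>f. f t)"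
  by (rule BC.continuous_map_weak_functional[OF evaluation_continuous_dual])

text \<open>Evaluations at points are bounded functionals and already separate functions.\<close>

lemma Hausdorff_weakC: "Hausdorff_space (weakC :: ('s::topological_space \<Rightarrow> complex) topology)"
  unfolding Hausdorff_space_def
proof (intro allI impI, elim conjE)
  fix f g :: "'s \<Rightarrow> complex" assume f: "f \<in> topspace weakC" and g: "g \<in> topspace weakC" and "f \<noteq> g"
  then obtain t where "f t \<noteq> g t" by auto
  then obtain U V where UV: "open U" "open V" "f t \<in> U" "g t \<in> V" "U \<inter> V = {}" using hausdorff by meson
  have "openin weakC {f \<in> topspace weakC. f t \<in> W}" if "open W" for W
    by (rule openin_continuous_map_preimage[OF continuous_map_weakC_evaluation]) (use that in simp)
  then show "\<exists>U V. openin weakC U \<and> openin weakC V \<and> f \<in> U \<and> g \<in> V \<and> disjnt U V"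
    using UV f g by (intro exI[of _ "{f \<in> topspace weakC. f t \<in> U}"] exI[of _ "{f \<in> topspace weakC. f t \<in> V}"])
      (auto simp: disjnt_def)
qed

text \<open>A weakly compact set is weakly closed, so it contains the closure of every orbit inside
  it. This reduces weak almost periodicity to exhibiting a compact set.\<close>

lemma WAP_I:
  assumes f: "f \<in> bounded_continuous" and B: "compactin weakC B" and orbit: "\<And>s. left_translate s f \<in> B"
  shows "f \<in> WAP"
proof -
  have "weakC closure_of range (\<lambda>s. left_translate s f) \<subseteq> B"
    using orbit by (intro closure_of_minimal compactin_imp_closedin[OF Hausdorff_weakC B]) auto
  then have "compactin weakC (weakC closure_of range (\<lambda>s. left_translate s f))"
    by (rule closed_compactin[OF B _ closedin_closure_of])
  with f show ?thesis by (simp add: WAP_def)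
qed

lemma WAP_bounded_continuous: "f \<in> WAP \<Longrightarrow> f \<in> bounded_continuous"
  by (simp add: WAP_def)

lemma continuous_translations:
  fixes t :: "'s::semitopological_semigroup"
  shows "continuous_on UNIV (\<lambda>s. t * s)" "continuous_on UNIV (\<lambda>s. s * t)"
  using tendsto_mult_left_at tendsto_mult_right_at by (auto simp: continuous_on_def)

lemma left_translate_bounded_continuous:
  fixes f :: "'s::semitopological_semigroup \<Rightarrow> complex"
  assumes "f \<in> bounded_continuous"
  shows "left_translate s f \<in> bounded_continuous"
proof -
  have "continuous_on UNIV (\<lambda>t. f (s * t))"
    by (rule continuous_on_compose2[of UNIV f UNIV "(*) s", OF _ continuous_translations(1)]) (use assms in \<open>auto simp: bounded_continuous_def\<close>)
  moreover have "bounded (range (left_translate s f))"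
    by (rule bounded_subset[of "range f"]) (use assms in \<open>auto simp: bounded_continuous_def left_translate_def\<close>)
  ultimately show ?thesis by (simp add: bounded_continuous_def left_translate_def)
qed

lemma orbit_subset_closure:
  fixes f :: "'s::semitopological_semigroup \<Rightarrow> complex"
  assumes "f \<in> bounded_continuous"
  shows "left_translate s f \<in> weakC closure_of range (\<lambda>s. left_translate s f)"
  using closure_of_subset[of "range (\<lambda>s. left_translate s f)" weakC]
    left_translate_bounded_continuous[OF assms] by auto

text \<open>The orbit of a sum lies in the image of a product of two weakly compact sets under the
  weakly continuous addition; scalar multiples are treated likewise.\<close>

lemma subspace_WAP: "complex_function.subspace (WAP :: ('s::semitopological_semigroup \<Rightarrow> complex) set)"
  unfolding complex_function.subspace_def
proof (intro conjI ballI allI)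
  show "(0 :: 's \<Rightarrow> complex) \<in> WAP"
    by (rule WAP_I[of _ "{0}"])
       (auto simp: bounded_continuous_def finite_imp_compactin left_translate_def zero_fun_def)
next
  fix f g :: "'s \<Rightarrow> complex" assume f: "f \<in> WAP" and g: "g \<in> WAP"
  define A where "A = (\<lambda>f :: 's \<Rightarrow> complex. weakC closure_of range (\<lambda>s. left_translate s f))"
  have "continuous_map (prod_topology weakC weakC) weakC (\<lambda>z :: ('s \<Rightarrow> complex) \<times> ('s \<Rightarrow> complex). fst z + snd z)"
    unfolding BC.continuous_map_into_weak
  proof (intro conjI ballI)
    fix \<phi> :: "('s \<Rightarrow> complex) \<Rightarrow> complex" assume \<phi>: "\<phi> \<in> continuous_dual scale_fun bounded_continuous {sup_norm}"
    have "continuous_map (prod_topology weakC weakC) euclidean (\<lambda>z. \<phi> (fst z) + \<phi> (snd z))"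
      using BC.continuous_map_weak_functional[OF \<phi>]
      by (intro continuous_map_add) (auto intro: continuous_map_compose[OF continuous_map_fst, unfolded o_def] continuous_map_compose[OF continuous_map_snd, unfolded o_def])
    then show "continuous_map (prod_topology weakC weakC) euclidean (\<lambda>z. \<phi> (fst z + snd z))"
      by (rule continuous_map_eq) (use \<phi> in \<open>auto simp: continuous_dual_def linear_functional_on_def\<close>)
  qed (auto intro: BC.carrier_closed)
  moreover have "compactin (prod_topology weakC weakC) (A f \<times> A g)"
    using f g by (auto simp: compactin_Times WAP_def A_def)
  ultimately have "compactin weakC ((\<lambda>z. fst z + snd z) ` (A f \<times> A g))"
    by (rule image_compactin[rotated])
  moreover have "left_translate s (f + g) \<in> (\<lambda>z. fst z + snd z) ` (A f \<times> A g)" for s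
  proof (rule image_eqI[of _ _ "(left_translate s f, left_translate s g)"])
    show "left_translate s (f + g) = fst (left_translate s f, left_translate s g) + snd (left_translate s f, left_translate s g)"
      by (simp add: left_translate_def fun_eq_iff)
  qed (use f g WAP_bounded_continuous orbit_subset_closure in \<open>auto simp: A_def\<close>)
  ultimately show "f + g \<in> WAP"
    by (rule WAP_I[OF BC.carrier_closed(2)[OF WAP_bounded_continuous[OF f] WAP_bounded_continuous[OF g]]])
next
  fix c and f :: "'s \<Rightarrow> complex" assume f: "f \<in> WAP"
  define A where "A = weakC closure_of range (\<lambda>s. left_translate s f)"
  have "continuous_map weakC weakC (scale_fun c :: ('s \<Rightarrow> complex) \<Rightarrow> _)"
    unfolding BC.continuous_map_into_weak
  proof (intro conjI ballI)
    fix \<phi> :: "('s \<Rightarrow> complex) \<Rightarrow> complex" assume \<phi>: "\<phi> \<in> continuous_dual scale_fun bounded_continuous {sup_norm}"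
    have "continuous_map weakC euclidean (\<lambda>z. c * \<phi> z)"
      by (rule continuous_map_euclidean_compose[OF BC.continuous_map_weak_functional[OF \<phi>]]) (intro continuous_intros)
    then show "continuous_map weakC euclidean (\<lambda>z. \<phi> (scale_fun c z))"
      by (rule continuous_map_eq) (use \<phi> in \<open>auto simp: continuous_dual_def linear_functional_on_def\<close>)
  qed (auto intro: BC.carrier_closed)
  then have "compactin weakC (scale_fun c ` A)"
    using f by (intro image_compactin[of weakC]) (auto simp: WAP_def A_def)
  moreover have "left_translate s (scale_fun c f) \<in> scale_fun c ` A" for s
    by (rule image_eqI[of _ _ "left_translate s f"])
       (use f WAP_bounded_continuous orbit_subset_closure in \<open>auto simp: A_def left_translate_def scale_fun_def\<close>)
  ultimately show "scale_fun c f \<in> WAP"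
    by (rule WAP_I[OF BC.carrier_closed(3)[OF WAP_bounded_continuous[OF f]]])
qed

interpretation WAP: locally_convex_space scale_fun "WAP :: ('s::semitopological_semigroup \<Rightarrow> complex) set" "{sup_norm}"
  by (rule locally_convex_sup_norm[OF subspace_WAP]) (auto simp: bounded_continuous_def dest!: WAP_bounded_continuous)

lemma const_WAP: "(\<lambda>_. c) \<in> WAP"
  by (rule WAP_I[of _ "{\<lambda>_. c}"])
     (auto simp: bounded_continuous_def finite_imp_compactin left_translate_def)

section \<open>The enveloping semigroup and the almost periodic functions it produces\<close>

locale wap_system = dynamical_system act T
  for act :: "'s::semitopological_semigroup \<Rightarrow> 'a \<Rightarrow> 'a" and T :: "'a topology" +
  assumes compact: "compact_space T" and Hausdorff: "Hausdorff_space T" and nonempty: "topspace T \<noteq> {}"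
    and continuous_enveloping: "f \<in> enveloping_semigroup act T \<Longrightarrow> continuous_map T T f"
begin

abbreviation "K \<equiv> topspace T"
abbreviation "PT \<equiv> product_topology (\<lambda>_. T) K"
abbreviation "E \<equiv> enveloping_semigroup act T"
abbreviation "TE \<equiv> subtopology PT E"

definition translation :: "'s \<Rightarrow> 'a \<Rightarrow> 'a" where
  "translation s = restrict (act s) K"

lemma enveloping_closure: "E = PT closure_of range translation"
  by (simp add: enveloping_semigroup_def translation_def)

lemma act_mem: "x \<in> K \<Longrightarrow> act s x \<in> K"
  using continuous_translation[of s] continuous_map_image_subset_topspace by fastforce

lemma translation_mem: "translation s \<in> E"
proof -
  have "range translation \<subseteq> topspace PT" using act_mem by (auto simp: translation_def)
  then show ?thesis unfolding enveloping_closure using closure_of_subset by blast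
qed

lemma closedin_enveloping: "closedin PT E"
  by (simp add: enveloping_closure)

lemma enveloping_PiE: "E \<subseteq> K \<rightarrow>\<^sub>E K"
  using closedin_subset[OF closedin_enveloping] by simp

lemma enveloping_mem: "\<xi> \<in> E \<Longrightarrow> x \<in> K \<Longrightarrow> \<xi> x \<in> K"
  using enveloping_PiE by blast

lemma topspace_TE: "topspace TE = E"
  using enveloping_PiE by auto

lemma continuous_evaluation: "x \<in> K \<Longrightarrow> continuous_map TE T (\<lambda>\<xi>. \<xi> x)"
  by (intro continuous_map_from_subtopology continuous_map_product_projection)

text \<open>Here the assumed continuity of the members of \<open>E\<close> enters; composing on the
  other side is pointwise continuous for arbitrary maps.\<close>

lemma compose_left_continuous:
  assumes "\<xi> \<in> E"
  shows "continuous_map PT PT (compose K \<xi>)"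
  unfolding continuous_map_componentwise
proof (intro conjI ballI)
  fix x assume x: "x \<in> K"
  have "continuous_map PT T (\<lambda>\<eta>. \<xi> (\<eta> x))"
    using continuous_map_compose[OF continuous_map_product_projection[OF x] continuous_enveloping[OF assms]]
    by (simp add: o_def)
  then show "continuous_map PT T (\<lambda>\<eta>. compose K \<xi> \<eta> x)" using x by (simp add: compose_def)
qed (auto simp: compose_def)

lemma compose_right_continuous:
  assumes "\<eta> \<in> K \<rightarrow>\<^sub>E K"
  shows "continuous_map PT PT (\<lambda>\<xi>. compose K \<xi> \<eta>)"
  unfolding continuous_map_componentwise
proof (intro conjI ballI)
  fix x assume x: "x \<in> K"
  then have "\<eta> x \<in> K" using assms by blast
  then have "continuous_map PT T (\<lambda>\<xi>. \<xi> (\<eta> x))" by (rule continuous_map_product_projection)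
  then show "continuous_map PT T (\<lambda>\<xi>. compose K \<xi> \<eta> x)" using x by (simp add: compose_def)
qed (auto simp: compose_def)

lemma compose_translation: "compose K (translation s) (translation t) = translation (s * t)"
  using act_act act_mem by (auto simp: compose_def translation_def fun_eq_iff)

lemma compose_enveloping:
  assumes "\<xi> \<in> E" "\<eta> \<in> E"
  shows "compose K \<xi> \<eta> \<in> E"
  unfolding enveloping_closure
proof (rule closure_of_subsemigroup[of "range translation" PT "compose K"])
  show "range translation \<subseteq> topspace PT" using translation_mem enveloping_PiE by auto
  show "continuous_map PT PT (\<lambda>\<xi>. compose K \<xi> \<eta>)" if "\<eta> \<in> range translation" for \<eta>
    using that translation_mem enveloping_PiE by (intro compose_right_continuous) auto
qed (use assms compose_left_continuous in \<open>auto simp: compose_translation simp flip: enveloping_closure\<close>)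

sublocale env: compact_semitopological_semigroup TE "compose K"
proof (unfold_locales, unfold topspace_TE)
  show "compact_space TE"
    by (intro compact_space_subtopology closedin_compact_space closedin_enveloping)
       (simp add: compact_space_product_topology compact)
  show "Hausdorff_space TE"
    by (intro Hausdorff_space_subtopology) (simp add: Hausdorff_space_product_topology Hausdorff)
  show "E \<noteq> {}" using translation_mem by blast
  show "continuous_map TE TE (\<lambda>\<eta>. compose K \<xi> \<eta>)" if "\<xi> \<in> E" for \<xi>
    by (rule continuous_map_into_subtopology[OF continuous_map_from_subtopology[OF compose_left_continuous[OF that]]])
       (use that compose_enveloping topspace_TE in auto)
  show "continuous_map TE TE (\<lambda>\<xi>. compose K \<xi> \<eta>)" if "\<eta> \<in> E" for \<eta>
    by (rule continuous_map_into_subtopology[OF continuous_map_from_subtopology[OF compose_right_continuous]])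
       (use that compose_enveloping topspace_TE enveloping_PiE in auto)
  show "compose K (compose K \<xi> \<eta>) \<zeta> = compose K \<xi> (compose K \<eta> \<zeta>)" if "\<xi> \<in> E" "\<eta> \<in> E" "\<zeta> \<in> E" for \<xi> \<eta> \<zeta>
    using enveloping_mem[OF that(3)] by (auto simp: compose_def fun_eq_iff)
qed (rule compose_enveloping)

lemmas env_left_continuous = env.left_continuous[unfolded topspace_TE]
  and env_assoc = env.assoc[unfolded topspace_TE]

lemma translations_dense:
  assumes "\<xi> \<in> E" "openin TE U" "\<xi> \<in> U"
  obtains s where "translation s \<in> U"
proof -
  have "\<xi> \<in> TE closure_of range translation"
    using assms(1) translation_mem by (auto simp: closure_of_subtopology enveloping_closure Int_absorb1 image_subset_iff)
  then show ?thesis using that assms(2,3) unfolding in_closure_of by blast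
qed

lemma enveloping_in_closed:
  assumes "\<xi> \<in> E" "closedin TE C" "\<And>s. translation s \<in> C"
  shows "\<xi> \<in> C"
proof (rule ccontr)
  assume "\<xi> \<notin> C"
  then have "\<xi> \<in> topspace TE - C" using assms(1) unfolding topspace_TE by blast
  moreover have "openin TE (topspace TE - C)" using assms(2) unfolding closedin_def by blast
  ultimately obtain s where "translation s \<in> topspace TE - C" using translations_dense[OF assms(1)] by blast
  then show False using assms(3) by simp
qed

lemma continuous_translation_map: "continuous_map euclidean TE translation"
proof (rule continuous_map_into_subtopology)
  show "continuous_map euclidean PT translation"
    unfolding continuous_map_componentwise
    using continuous_orbit by (auto simp: translation_def)
qed (use translation_mem in auto)

text \<open>The parameter \<open>\<xi>\<close> makes the family stable under left translation:
  translating by \<open>s\<close> replaces \<open>\<xi>\<close> by its composition with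
  \<open>translation s\<close>.\<close>

definition coefficient :: "(('a \<Rightarrow> 'a) \<Rightarrow> real) \<Rightarrow> ('a \<Rightarrow> 'a) \<Rightarrow> 's \<Rightarrow> complex" where
  "coefficient h \<xi> t = complex_of_real (h (compose K \<xi> (translation t)))"

context
  fixes h :: "('a \<Rightarrow> 'a) \<Rightarrow> real"
  assumes h: "continuous_map TE euclideanreal h" and h01: "\<And>\<xi>. \<xi> \<in> E \<Longrightarrow> \<bar>h \<xi>\<bar> \<le> 1"
begin

lemma continuous_translation_compose:
  assumes "continuous_map TE euclideanreal k"
  shows "continuous_on UNIV (\<lambda>t. complex_of_real (k (translation t)))"
  using continuous_map_compose[OF continuous_translation_map assms]
  by (auto simp: o_def intro!: continuous_intros)

lemma coefficient_bounded_continuous: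
  assumes "\<xi> \<in> E"
  shows "coefficient h \<xi> \<in> bounded_continuous"
proof -
  have "continuous_map TE euclideanreal (\<lambda>\<eta>. h (compose K \<xi> \<eta>))"
    using continuous_map_compose[OF env_left_continuous[OF assms] h] by (simp add: o_def)
  then have "continuous_on UNIV (coefficient h \<xi>)"
    unfolding coefficient_def by (rule continuous_translation_compose)
  moreover have "cmod (coefficient h \<xi> t) \<le> 1" for t
    using h01 compose_enveloping[OF assms translation_mem] by (simp add: coefficient_def)
  ultimately show ?thesis by (auto simp: bounded_continuous_def bounded_iff)
qed

text \<open>Grothendieck's theorem for the separately continuous function
  \<open>h (\<xi> \<circ> \<eta>)\<close> on \<open>E\<close> times \<open>E\<close>. Domination
  holds because the supremum norm of a combination of coefficients runs over the translations only,
  hence is bounded by the supremum over all \<open>\<eta> \<in> E\<close>. Both the bounded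
  continuous functions and \<open>WAP\<close> are inserted for \<open>Y\<close>.\<close>

lemma coefficient_functional_continuous:
  assumes Y: "locally_convex_space scale_fun Y {sup_norm}" "\<And>\<xi>. \<xi> \<in> E \<Longrightarrow> coefficient h \<xi> \<in> Y"
    and \<phi>: "\<phi> \<in> continuous_dual scale_fun Y {sup_norm}"
  shows "continuous_map TE euclidean (\<lambda>\<xi>. \<phi> (coefficient h \<xi>))"
proof -
  interpret Y: locally_convex_space scale_fun Y "{sup_norm}" by (rule Y(1))
  obtain C where lin: "linear_functional_on scale_fun Y \<phi>" and C: "0 \<le> C" "\<And>f. f \<in> Y \<Longrightarrow> cmod (\<phi> f) \<le> C * sup_norm f"
    using \<phi> unfolding bounded_functional_iff[OF Y(1)] by blast
  show ?thesis
  proof (rule dominated_functional_continuous[OF env.compact env.compact, of "\<lambda>\<xi> \<eta>. complex_of_real (h (compose K \<xi> \<eta>))" 1 _ C])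
    show "continuous_map TE euclidean (\<lambda>\<xi>. complex_of_real (h (compose K \<xi> \<eta>)))" if "\<eta> \<in> topspace TE" for \<eta>
      by (rule continuous_map_euclidean_compose[OF continuous_map_compose[OF env.right_continuous[OF that] h, unfolded o_def]])
         (intro continuous_intros)
    show "continuous_map TE euclidean (\<lambda>\<eta>. complex_of_real (h (compose K \<xi> \<eta>)))" if "\<xi> \<in> topspace TE" for \<xi>
      by (rule continuous_map_euclidean_compose[OF continuous_map_compose[OF env.left_continuous[OF that] h, unfolded o_def]])
         (intro continuous_intros)
    show "cmod (complex_of_real (h (compose K \<xi> \<eta>))) \<le> 1" if "\<xi> \<in> topspace TE" "\<eta> \<in> topspace TE" for \<xi> \<eta>
      using h01[of "compose K \<xi> \<eta>"] env.closed[OF that] by (simp add: topspace_TE)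
  next
    fix N and \<kappa> :: "nat \<Rightarrow> 'a \<Rightarrow> 'a" and c :: "nat \<Rightarrow> complex" and e :: real
    assume \<kappa>: "\<And>n. \<kappa> n \<in> topspace TE"
      and le: "\<And>\<eta>. \<eta> \<in> topspace TE \<Longrightarrow> cmod (\<Sum>n<N. c n * complex_of_real (h (compose K (\<kappa> n) \<eta>))) \<le> e"
    have \<kappa>E: "\<kappa> n \<in> E" for n using \<kappa> topspace_TE by blast
    have sum: "(\<Sum>n<N. scale_fun (c n) (coefficient h (\<kappa> n))) t = (\<Sum>n<N. c n * complex_of_real (h (compose K (\<kappa> n) (translation t))))" for t
      by (induction N) (auto simp: scale_fun_def coefficient_def)
    have mem: "(\<Sum>n<N. scale_fun (c n) (coefficient h (\<kappa> n))) \<in> Y"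
      by (intro complex_function.subspace_sum Y.subspace_carrier Y.carrier_closed Y(2) \<kappa>E)
    have "(\<Sum>n<N. c n * \<phi> (coefficient h (\<kappa> n))) = \<phi> (\<Sum>n<N. scale_fun (c n) (coefficient h (\<kappa> n)))"
      by (rule Y.linear_functional_on_sum[OF lin, symmetric]) (rule Y(2)[OF \<kappa>E])
    also have "cmod \<dots> \<le> C * sup_norm (\<Sum>n<N. scale_fun (c n) (coefficient h (\<kappa> n)))"
      by (rule C(2)[OF mem])
    also have "\<dots> \<le> C * e"
      by (intro mult_left_mono C sup_norm_le)
        (unfold sum, rule le, simp only: topspace_TE translation_mem)
    finally show "cmod (\<Sum>n<N. c n * \<phi> (coefficient h (\<kappa> n))) \<le> C * e" .
  qed
qed

lemma compactin_coefficients: "compactin weakC (coefficient h ` E)"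
proof -
  have "continuous_map TE weakC (coefficient h)"
    unfolding BC.continuous_map_into_weak
    using coefficient_functional_continuous[OF BC.locally_convex_space_axioms coefficient_bounded_continuous]
      coefficient_bounded_continuous topspace_TE by auto
  then have "compactin weakC (coefficient h ` topspace TE)"
    by (rule image_compactin[OF env.compact[unfolded compact_space_def]])
  then show ?thesis by (simp only: topspace_TE)
qed

lemma coefficient_WAP:
  assumes "\<xi> \<in> E"
  shows "coefficient h \<xi> \<in> WAP"
proof (rule WAP_I[OF coefficient_bounded_continuous[OF assms] compactin_coefficients])
  fix s
  have "compose K \<xi> (translation (s * t)) = compose K (compose K \<xi> (translation s)) (translation t)" for t
    using env_assoc[OF assms translation_mem translation_mem, of s t] by (simp only: compose_translation)
  then have "left_translate s (coefficient h \<xi>) = coefficient h (compose K \<xi> (translation s))"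
    by (intro ext) (simp add: left_translate_def coefficient_def)
  then show "left_translate s (coefficient h \<xi>) \<in> coefficient h ` E"
    using compose_enveloping[OF assms translation_mem] by blast
qed

text \<open>The function \<open>f\<close> plays the role of the coefficient at the identity, which
  need not lie in \<open>E\<close>. Its translates are the coefficients at translations, so
  \<open>\<mu>\<close> takes the value \<open>\<mu> f\<close> at all of these, and by density and
  continuity at every coefficient.\<close>

lemma invariant_mean_coefficient:
  assumes \<mu>: "left_invariant_mean (WAP :: ('s \<Rightarrow> complex) set) \<mu>"
    and \<xi>: "\<xi> \<in> E" and \<eta>: "\<eta> \<in> E"
  shows "\<mu> (coefficient h \<xi>) = \<mu> (coefficient h \<eta>)"
proof -
  define f where "f = (\<lambda>t. complex_of_real (h (translation t)))"
  have tr: "left_translate s f = coefficient h (translation s)" for s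
    by (simp add: left_translate_def f_def coefficient_def compose_translation fun_eq_iff)
  have "f \<in> bounded_continuous"
    using continuous_translation_compose[OF h] h01[OF translation_mem]
    by (auto simp: f_def bounded_continuous_def bounded_iff)
  then have fW: "f \<in> WAP"
    by (rule WAP_I[OF _ compactin_coefficients]) (use tr translation_mem in auto)
  have cont: "continuous_map TE euclidean (\<lambda>\<xi>. \<mu> (coefficient h \<xi>))"
    using \<mu> coefficient_functional_continuous[OF WAP.locally_convex_space_axioms coefficient_WAP]
    by (simp add: left_invariant_mean_def)
  have "\<mu> (coefficient h \<xi>) = \<mu> f" if \<xi>: "\<xi> \<in> E" for \<xi>
  proof -
    have "\<xi> \<in> {\<xi> \<in> topspace TE. \<mu> (coefficient h \<xi>) \<in> {\<mu> f}}"
    proof (rule enveloping_in_closed[OF \<xi>])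
      show "closedin TE {\<xi> \<in> topspace TE. \<mu> (coefficient h \<xi>) \<in> {\<mu> f}}"
        by (rule closedin_continuous_map_preimage[OF cont]) simp
      show "translation s \<in> {\<xi> \<in> topspace TE. \<mu> (coefficient h \<xi>) \<in> {\<mu> f}}" for s
        using \<mu> fW translation_mem topspace_TE by (auto simp: left_invariant_mean_def simp flip: tr)
    qed
    then show ?thesis by simp
  qed
  then show ?thesis using \<xi> \<eta> by simp
qed

end

text \<open>A Urysohn function that is 0 on \<open>a E\<close> and 1 on \<open>b E\<close> would
  make the coefficients at \<open>a\<close> and \<open>b\<close> the constants 0 and 1, which an
  invariant mean would have to identify.\<close>

lemma enveloping_reversible:
  assumes \<mu>: "left_invariant_mean (WAP :: ('s \<Rightarrow> complex) set) \<mu>"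
    and a: "a \<in> E" and b: "b \<in> E"
  shows "compose K a ` E \<inter> compose K b ` E \<noteq> {}"
proof
  assume disj: "compose K a ` E \<inter> compose K b ` E = {}"
  have closed: "closedin TE (compose K c ` E)" if "c \<in> E" for c
    by (rule env.closedin_left_image[OF _ closedin_topspace, unfolded topspace_TE, OF that])
  have "normal_space TE"
    using compact_Hausdorff_or_regular_imp_normal_space env.compact env.Hausdorff by blast
  then obtain h where h: "continuous_map TE (top_of_set {0..1::real}) h"
    "h ` (compose K a ` E) \<subseteq> {0}" "h ` (compose K b ` E) \<subseteq> {1}"
    using Urysohn_lemma[of TE "compose K a ` E" "compose K b ` E" 0 1] closed a b disj
    by (auto simp: disjnt_def)
  have cont: "continuous_map TE euclideanreal h" and h01: "\<And>\<xi>. \<xi> \<in> E \<Longrightarrow> \<bar>h \<xi>\<bar> \<le> 1"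
    using h(1) topspace_TE by (fastforce simp: continuous_map_in_subtopology Pi_iff abs_le_iff)+
  have "coefficient h a = (\<lambda>_. 0)" "coefficient h b = (\<lambda>_. 1)"
    using h(2,3) translation_mem by (fastforce simp: coefficient_def image_subset_iff)+
  then have "\<mu> (\<lambda>_. 0) = \<mu> (\<lambda>_. 1)"
    using invariant_mean_coefficient[OF cont h01 \<mu> a b] by simp
  moreover have "\<mu> (\<lambda>_. 0) = 0"
    using \<mu> WAP.linear_functional_on_diff[of \<mu> 0 0] WAP.carrier_closed(1)
    by (auto simp: left_invariant_mean_def continuous_dual_def zero_fun_def)
  ultimately show False using \<mu> by (simp add: left_invariant_mean_def)
qed

end

section \<open>Nonexpansive systems\<close>

text \<open>Without a finite net, points chosen greedily far from all earlier ones form a separated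
  sequence; symmetry covers both orders of the indices.\<close>

lemma finite_net_of_no_separated_sequence:
  fixes d :: "'a \<Rightarrow> 'a \<Rightarrow> real"
  assumes sym: "\<And>x y. x \<in> F \<Longrightarrow> y \<in> F \<Longrightarrow> d x y = d y x"
    and seq: "\<And>g :: nat \<Rightarrow> 'a. range g \<subseteq> F \<Longrightarrow> \<exists>m n. m \<noteq> n \<and> d (g m) (g n) < \<epsilon>"
  obtains N where "finite N" "N \<subseteq> F" "\<And>y. y \<in> F \<Longrightarrow> \<exists>z\<in>N. d y z < \<epsilon>"
proof (rule ccontr)
  assume neg: "\<not> thesis"
  have "\<exists>y\<in>F. \<forall>z\<in>N. \<epsilon> \<le> d y z" if "finite N" "N \<subseteq> F" for N
    using neg \<open>\<And>N. \<lbrakk>finite N; N \<subseteq> F; \<And>y. y \<in> F \<Longrightarrow> \<exists>z\<in>N. d y z < \<epsilon>\<rbrakk> \<Longrightarrow> thesis\<close>[OF that]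
    by (meson not_le)
  then obtain c where c: "\<And>N. finite N \<Longrightarrow> N \<subseteq> F \<Longrightarrow> c N \<in> F \<and> (\<forall>z\<in>N. \<epsilon> \<le> d (c N) z)" by metis
  define N where "N = rec_nat {} (\<lambda>_ N. insert (c N) N)"
  have N0: "N 0 = {}" and NS: "N (Suc n) = insert (c (N n)) (N n)" for n by (auto simp: N_def)
  have N: "finite (N n) \<and> N n \<subseteq> F" for n by (induction n) (auto simp: N0 NS c)
  have mem: "c (N m) \<in> N n" if "m < n" for m n
    using that by (induction n) (auto simp: NS less_Suc_eq)
  have far: "\<epsilon> \<le> d (c (N n)) (c (N m))" if "m < n" for m n using c N mem[OF that] by blast
  have cF: "c (N n) \<in> F" for n using c N by blast
  obtain m n where "m \<noteq> n" "d (c (N m)) (c (N n)) < \<epsilon>"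
    using seq[of "\<lambda>n. c (N n)"] cF by auto
  then show False using far[of m n] far[of n m] sym[OF cF cF, of m n] by (cases "m < n") auto
qed

locale nonexpansive_system =
  real_locally_convex_space scl X Q +
  sys: wap_system act "subtopology (weak_topology scl X Q) C"
  for scl :: "real \<Rightarrow> 'x::ab_group_add \<Rightarrow> 'x" and X Q
    and act :: "'s::semitopological_semigroup \<Rightarrow> 'x \<Rightarrow> 'x" and C +
  assumes C_subset: "C \<subseteq> X" and convex_C: "convex_on_scale scl C" and nonexp: "nonexpansive Q act C"
begin

lemma topspace_C: "sys.K = C"
  using C_subset by auto

lemma continuous_evaluation_weak: "x \<in> C \<Longrightarrow> continuous_map sys.TE (weak_topology scl X Q) (\<lambda>\<xi>. \<xi> x)"
  using sys.continuous_evaluation[of x] unfolding topspace_C by (rule continuous_map_into_fulltopology)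

lemma enveloping_mem_C: "\<xi> \<in> sys.E \<Longrightarrow> x \<in> C \<Longrightarrow> \<xi> x \<in> C"
  using sys.enveloping_mem unfolding topspace_C .

lemma translation_apply: "x \<in> C \<Longrightarrow> sys.translation s x = act s x"
  using topspace_C by (simp add: sys.translation_def)

text \<open>Seminorms are weakly lower semicontinuous: a violation at \<open>\<xi>\<close> is
  detected by a norming functional on a whole neighbourhood of \<open>\<xi>\<close>, and that
  neighbourhood contains a translation.\<close>

lemma enveloping_nonexpansive:
  assumes \<xi>: "\<xi> \<in> sys.E" and p: "p \<in> Q" and x: "x \<in> C" and y: "y \<in> C"
  shows "p (\<xi> x - \<xi> y) \<le> p (x - y)"
proof (rule ccontr)
  assume less: "\<not> p (\<xi> x - \<xi> y) \<le> p (x - y)"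
  have inX: "\<eta> z \<in> X" if "\<eta> \<in> sys.E" "z \<in> C" for \<eta> z
    using enveloping_mem_C[OF that] C_subset by blast
  obtain \<phi> where \<phi>: "\<phi> \<in> continuous_dual scl X Q" "linear_functional_on scl X \<phi>"
    "\<And>z. z \<in> X \<Longrightarrow> \<phi> z \<le> p z" "\<phi> (\<xi> x - \<xi> y) = p (\<xi> x - \<xi> y)"
    using norming_functional[OF p diff_mem[OF inX[OF \<xi> x] inX[OF \<xi> y]]] by blast
  define U where "U = {\<eta> \<in> topspace sys.TE. \<phi> (\<eta> x) - \<phi> (\<eta> y) \<in> {p (x - y)<..}}"
  have "openin sys.TE U" unfolding U_def
    using continuous_map_compose[OF continuous_evaluation_weak[OF x] continuous_map_weak_functional[OF \<phi>(1)]]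
      continuous_map_compose[OF continuous_evaluation_weak[OF y] continuous_map_weak_functional[OF \<phi>(1)]]
    by (intro openin_continuous_map_preimage[where Y = euclidean] continuous_map_diff) (auto simp: o_def)
  moreover have "\<xi> \<in> U"
    using less \<xi> \<phi>(4) linear_functional_on_diff[OF \<phi>(2) inX[OF \<xi> x] inX[OF \<xi> y]]
    unfolding U_def sys.topspace_TE by simp
  ultimately obtain s where s: "sys.translation s \<in> U" using sys.translations_dense[OF \<xi>] by blast
  have "p (x - y) < \<phi> (act s x) - \<phi> (act s y)" using s by (simp add: U_def translation_apply x y)
  also have "\<dots> = \<phi> (act s x - act s y)"
    using linear_functional_on_diff[OF \<phi>(2)] inX[OF sys.translation_mem[of s]] translation_apply x y by metis
  also have "\<dots> \<le> p (act s x - act s y)"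
    using \<phi>(3) diff_mem inX[OF sys.translation_mem[of s]] translation_apply x y by metis
  also have "\<dots> \<le> p (x - y)" using nonexp p x y by (auto simp: nonexpansive_def)
  finally show False by simp
qed

text \<open>By Mazur's theorem a countably generated closed subgroup \<open>H\<close> moves \<open>x\<close> inside a seminorm
  separable set, so by Baire's theorem its orbit map has small oscillation on an open set, hence,
  by translation, everywhere.\<close>

lemma group_orbit_no_separated_sequence:
  fixes g :: "nat \<Rightarrow> 'x \<Rightarrow> 'x"
  assumes e: "sys.env.minimal_idempotent e" and x: "x \<in> C" and p: "p \<in> Q" and \<epsilon>: "0 < \<epsilon>"
    and g: "\<And>n. g n \<in> sys.env.unit_group e"
  shows "\<exists>m n. m \<noteq> n \<and> p (g m x - g n x) < \<epsilon>"
proof -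
  define G where "G = sys.env.unit_group e"
  let ?m = "compose sys.K"
  have eE: "e \<in> topspace sys.TE" "?m e e = e" using e unfolding sys.env.minimal_idempotent_def by blast+
  have GE: "G \<subseteq> topspace sys.TE" unfolding G_def by (rule sys.env.unit_group_subset)
  have Gm: "?m a b \<in> G" if "a \<in> G" "b \<in> G" for a b
    using sys.env.unit_group_closed[OF eE(1)] that unfolding G_def .
  have eG: "?m e a = a" "?m a e = a" if "a \<in> G" for a using that unfolding G_def sys.env.unit_group_def by blast+
  have gG: "g n \<in> G" for n using g by (simp add: G_def)
  have inE: "a \<in> sys.E" if "a \<in> topspace sys.TE" for a using that unfolding sys.topspace_TE .
  have eG': "e \<in> G" using eE unfolding G_def sys.env.unit_group_def by blast
  \<comment> \<open>Words in the \<open>g n\<close>, multiplied from the left starting at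
    \<open>a\<close>. The words starting at \<open>e\<close> form the countable semigroup
    \<open>D\<close>, in which the empty word is the unit \<open>e\<close>.\<close>
  define w where "w = foldl (\<lambda>(a :: 'x \<Rightarrow> 'x) i. ?m a (g i))"
  have w_Nil: "w a [] = a" and w_Cons: "w a (i # l) = w (?m a (g i)) l"
    and w_append: "w a (k @ l) = w (w a k) l" for a i k l
    by (simp_all only: w_def foldl_Nil foldl_Cons foldl_append)
  have wG: "w a l \<in> G" if "a \<in> G" for a l
    using that
  proof (induction l arbitrary: a)
    case (Cons i l)
    show ?case unfolding w_Cons by (rule Cons.IH[OF Gm[OF Cons.prems gG]])
  qed (simp only: w_Nil)
  have w_eq: "w a l = ?m a (w e l)" if a: "a \<in> G" for a l
  proof (induction l rule: rev_induct)
    case (snoc i l)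
    have "w a (l @ [i]) = ?m (?m a (w e l)) (g i)" unfolding w_append w_Cons w_Nil snoc ..
    also have "\<dots> = ?m a (?m (w e l) (g i))"
      by (rule sys.env.assoc) (use a wG[OF eG'] gG GE in blast)+
    finally show ?case unfolding w_append w_Cons w_Nil .
  qed (simp only: w_Nil eG a)
  define D where "D = range (w e)"
  have DG: "D \<subseteq> G" using wG[OF eG'] by (auto simp: D_def)
  have Dm: "?m a b \<in> D" if ab: "a \<in> D" "b \<in> D" for a b
  proof -
    obtain k l where "a = w e k" "b = w e l" using ab by (auto simp: D_def)
    then have "?m a b = w e (k @ l)" unfolding w_append using w_eq[OF wG[OF eG']] by metis
    then show ?thesis unfolding D_def by blast
  qed
  have gD: "g n \<in> D" for n
    unfolding D_def by (rule range_eqI[of _ _ "[n]"]) (simp only: w_Cons w_Nil eG gG)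
  have DT: "D \<subseteq> topspace sys.TE" using DG GE by blast
  define H where "H = sys.TE closure_of D"
  have DH: "D \<subseteq> H" unfolding H_def by (rule closure_of_subset[OF DT])
  have Hcl: "closedin sys.TE H" by (simp add: H_def)
  have HG: "H \<subseteq> G"
    unfolding H_def G_def
    by (rule closure_of_minimal[OF DG[unfolded G_def] sys.env.closedin_unit_group[OF eE(1)]])
  have HE: "h \<in> sys.E" if "h \<in> H" for h using that HG GE inE by blast
  have HT: "H \<subseteq> topspace sys.TE" using HG GE by blast
  have Hne: "H \<noteq> {}" using gD DH by auto
  have Hm: "?m a b \<in> H" if "a \<in> H" "b \<in> H" for a b
    unfolding H_def
    by (rule closure_of_subsemigroup[OF DT Dm sys.env.right_continuous sys.env.left_continuous])
       (use that HT DT in \<open>auto simp: H_def\<close>)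
  have inv: "\<exists>b\<in>H. ?m h b = e \<and> ?m b h = e" if "h \<in> H" for h
    using sys.env.closed_subsemigroup_of_group[OF e Hcl Hne HG[unfolded G_def] Hm that] by metis
  define TH where "TH = subtopology sys.TE H"
  have topTH: "topspace TH = H" using HT by (auto simp: TH_def)
  interpret TH: compact_semitopological_semigroup TH "?m"
    unfolding TH_def by (rule sys.env.closed_subsemigroup[OF Hcl Hne Hm])
  have ev: "continuous_map TH (weak_topology scl X Q) (\<lambda>h. h x)"
    unfolding TH_def by (rule continuous_map_from_subtopology[OF continuous_evaluation_weak[OF x]])
  have DX: "(\<lambda>h. h x) ` D \<subseteq> X" using DG GE inE enveloping_mem_C[OF _ x] C_subset by blast
  have "countable ((\<lambda>h. h x) ` D)" by (simp add: D_def)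
  from this DX obtain Z where Z: "countable Z" "Z \<subseteq> X" and
    Zd: "\<And>y r. y \<in> weak_topology scl X Q closure_of (\<lambda>h. h x) ` D \<Longrightarrow> 0 < r \<Longrightarrow> \<exists>z\<in>Z. p (y - z) < r"
    by (rule weak_closure_countable[OF p]) blast
  \<comment> \<open>Countably many closed sets covering the compact group, so one of them has
    interior. Radius \<open>\<epsilon> / 4\<close> leaves oscillation \<open>\<epsilon> / 2\<close>
    on that interior, strictly below \<open>\<epsilon>\<close>.\<close>
  define S where "S = (\<lambda>z. {h \<in> topspace TH. h x \<in> {y \<in> X. p (y - z) \<le> \<epsilon> / 4}})"
  have Scl: "closedin TH (S z)" if "z \<in> Z" for z
    unfolding S_def using that Z(2)
    by (intro closedin_continuous_map_preimage[OF ev] closedin_weak_seminorm_ball p) auto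
  have cover: "topspace TH \<subseteq> \<Union>(S ` Z)"
  proof
    fix h assume h: "h \<in> topspace TH"
    then have "h x \<in> weak_topology scl X Q closure_of (\<lambda>h. h x) ` D"
      using continuous_map_image_closure_subset[OF continuous_evaluation_weak[OF x], of D] topTH H_def by auto
    then obtain z where "z \<in> Z" "p (h x - z) < \<epsilon> / 4" using Zd \<epsilon> by (metis zero_less_divide_iff zero_less_numeral)
    moreover have "h x \<in> X" using enveloping_mem_C[OF HE x] h topTH C_subset by blast
    ultimately show "h \<in> \<Union>(S ` Z)" using h by (auto simp: S_def intro!: bexI[of _ z])
  qed
  have "\<exists>z\<in>Z. TH interior_of (S z) \<noteq> {}"
  proof (rule ccontr)
    assume no: "\<not> (\<exists>z\<in>Z. TH interior_of (S z) \<noteq> {})"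
    have "TH interior_of \<Union>(S ` Z) = {}"
    proof (rule Baire_category_alt)
      show "completely_metrizable_space TH \<or> locally_compact_space TH \<and> regular_space TH"
        using TH.compact TH.Hausdorff
        by (simp add: compact_imp_locally_compact_space compact_Hausdorff_imp_regular_space)
    qed (use Z Scl no in auto)
    moreover have "\<Union>(S ` Z) = topspace TH" using cover by (auto simp: S_def)
    ultimately show False using Hne topTH interior_of_topspace[of TH] by simp
  qed
  then obtain z where z: "z \<in> Z" "TH interior_of (S z) \<noteq> {}" by blast
  define U where "U = TH interior_of (S z)"
  have U: "openin TH U" "U \<subseteq> S z" by (auto simp: U_def interior_of_subset)
  obtain u0 where u0: "u0 \<in> U" using z by (auto simp: U_def)
  have UH: "U \<subseteq> H" using openin_subset[OF U(1)] topTH by simp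
  have u0H: "u0 \<in> H" using u0 UH by blast
  note TH_assoc = TH.assoc[unfolded topTH]
  have osc: "p (u x - v x) \<le> \<epsilon> / 2" if "u \<in> U" "v \<in> U" for u v
  proof -
    have uv: "u x \<in> X" "v x \<in> X" "p (u x - z) \<le> \<epsilon> / 4" "p (v x - z) \<le> \<epsilon> / 4"
      using that U(2) by (auto simp: S_def)
    have zX: "z \<in> X" using z Z by auto
    have "p (u x - v x) = p ((u x - z) - (v x - z))" by simp
    also have "\<dots> \<le> p (u x - z) + p (v x - z)"
      by (intro seminorm_on_diff[OF seminorms[OF p] subspace_X] diff_mem uv zX)
    finally show ?thesis using uv by simp
  qed
  have local: "\<exists>V. openin TH V \<and> y \<in> V \<and> (\<forall>a\<in>V. \<forall>b\<in>V. p (a x - b x) \<le> \<epsilon> / 2)" if y: "y \<in> H" for y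
  proof -
    \<comment> \<open>With \<open>b\<close> inverse to \<open>u0\<close>, the element
      \<open>h\<close> carries \<open>u0\<close> to \<open>y\<close>, and \<open>V\<close> is the
      translate of \<open>U\<close> by \<open>h\<close>. As \<open>h\<close> is nonexpansive, the
      oscillation bound passes from \<open>U\<close> to \<open>V\<close>.\<close>
    obtain b where b: "b \<in> H" "?m b u0 = e" using inv[OF u0H] by blast
    define h where "h = ?m y b"
    have hH: "h \<in> H" using Hm y b by (simp add: h_def)
    obtain h' where h': "h' \<in> H" "?m h h' = e" "?m h' h = e" using inv[OF hH] by blast
    define V where "V = {a \<in> topspace TH. ?m h' a \<in> U}"
    have "openin TH V" unfolding V_def
      by (rule openin_continuous_map_preimage[OF TH.left_continuous U(1)]) (simp add: topTH h')
    moreover have "y \<in> V"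
    proof -
      have "?m h u0 = y"
        unfolding h_def using TH_assoc[OF y b(1) u0H] b(2) eG(2)[OF subsetD[OF HG y]] by metis
      then have "?m h' y = ?m (?m h' h) u0" using TH_assoc[OF h'(1) hH u0H] by metis
      also have "\<dots> = u0" using h'(3) eG(1)[OF subsetD[OF HG u0H]] by metis
      finally show ?thesis using y u0 topTH by (simp add: V_def)
    qed
    moreover have "p (a x - c x) \<le> \<epsilon> / 2" if a: "a \<in> V" and c: "c \<in> V" for a c
    proof -
      have shift: "v x = h (?m h' v x)" "?m h' v x \<in> C" if v: "v \<in> V" for v
      proof -
        have vH: "v \<in> H" using v topTH by (simp add: V_def)
        have "?m h (?m h' v) = v"
          using TH_assoc[OF hH h'(1) vH] h'(2) eG(1)[OF subsetD[OF HG vH]] by metis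
        then have "v x = ?m h (?m h' v) x" by simp
        then show "v x = h (?m h' v x)" using x subsetD[OF C_subset x] by (simp add: compose_def)
        show "?m h' v x \<in> C" by (rule enveloping_mem_C[OF HE[OF Hm[OF h'(1) vH]] x])
      qed
      have "p (a x - c x) = p (h (?m h' a x) - h (?m h' c x))" using shift(1) a c by metis
      also have "\<dots> \<le> p (?m h' a x - ?m h' c x)"
        by (intro enveloping_nonexpansive HE hH p shift a c)
      also have "\<dots> \<le> \<epsilon> / 2" using a c by (intro osc) (auto simp: V_def)
      finally show ?thesis .
    qed
    ultimately show ?thesis by blast
  qed
  \<comment> \<open>The sequence accumulates in the compact group, so two different indices fall
    into one set of small oscillation.\<close>
  obtain y where y: "y \<in> topspace TH" and
    cl: "\<And>V. openin TH V \<Longrightarrow> y \<in> V \<Longrightarrow> infinite {n \<in> UNIV. g n \<in> V}"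
    by (rule compact_space_cluster_point[OF TH.compact infinite_UNIV_nat, of g]) (use gD DH topTH in auto)
  obtain V where V: "openin TH V" "y \<in> V" "\<forall>a\<in>V. \<forall>b\<in>V. p (a x - b x) \<le> \<epsilon> / 2"
    using local[of y] y topTH by blast
  have inf: "infinite {n. g n \<in> V}" using cl[OF V(1,2)] by simp
  then obtain m where m: "g m \<in> V" using infinite_imp_nonempty by blast
  have "infinite ({n. g n \<in> V} - {m})" using inf by simp
  then obtain n where "g n \<in> V" "n \<noteq> m" using infinite_imp_nonempty by blast
  then show ?thesis using m V(3) \<epsilon> by (intro exI[of _ m] exI[of _ n]) force
qed

text \<open>The point \<open>u\<close> is an iterated midpoint, so each member of \<open>N\<close>
  has positive weight in it, and being near one member pays off in proportion to that weight. The
  gain \<open>c\<close> halves with each new point. For the point just added the estimate is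
  \<open>\<delta> / 2 + \<delta> / 4\<close>, which is at most \<open>(1 - c/2) * \<delta>\<close>
  because \<open>c \<le> 1/2\<close>.\<close>

lemma off_center_point:
  assumes "finite N" "N \<noteq> {}" and M: "M \<subseteq> X" "convex_on_scale scl M" "N \<subseteq> M" and p: "p \<in> Q" and \<delta>: "0 \<le> \<delta>"
  shows "\<exists>u\<in>M. \<exists>c. 0 < c \<and> c \<le> 1/2 \<and> (\<forall>y\<in>X. (\<forall>z\<in>N. p (y - z) \<le> \<delta>) \<longrightarrow>
    p (y - u) \<le> \<delta> \<and> ((\<exists>z\<in>N. p (y - z) \<le> \<delta> / 2) \<longrightarrow> p (y - u) \<le> (1 - c) * \<delta>))"
  using assms(1,2,5)
proof (induction N rule: finite_ne_induct)
  case (singleton z)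
  then show ?case by (intro bexI[of _ z] exI[of _ "1/2"]) auto
next
  case (insert z N)
  then obtain u c where u: "u \<in> M" and c: "0 < c" "c \<le> 1/2" and
    uc: "\<And>y. y \<in> X \<Longrightarrow> \<forall>z\<in>N. p (y - z) \<le> \<delta> \<Longrightarrow>
      p (y - u) \<le> \<delta> \<and> ((\<exists>z\<in>N. p (y - z) \<le> \<delta> / 2) \<longrightarrow> p (y - u) \<le> (1 - c) * \<delta>)" by blast
  define v where "v = scl (1/2) u + scl (1/2) z"
  have z: "z \<in> M" using insert by auto
  have "v \<in> M" using M(2) u z unfolding convex_on_scale_def v_def
    by (drule_tac bspec[OF _ u], drule_tac bspec[OF _ z], drule_tac spec[of _ "1/2"]) simp
  moreover have "p (y - v) \<le> \<delta> \<and> ((\<exists>w\<in>insert z N. p (y - w) \<le> \<delta> / 2) \<longrightarrow> p (y - v) \<le> (1 - c/2) * \<delta>)"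
    if y: "y \<in> X" and near: "\<forall>w\<in>insert z N. p (y - w) \<le> \<delta>" for y
  proof -
    have uz: "u \<in> X" "z \<in> X" using u z M by auto
    have "scl (1/2) y + scl (1/2) y = y" by (simp flip: scale_left_distrib)
    then have "y - v = scl (1/2) (y - u) + scl (1/2) (y - z)"
      by (simp add: v_def scale_right_diff_distrib algebra_simps)
    then have "p (y - v) \<le> p (scl (1/2) (y - u)) + p (scl (1/2) (y - z))"
      using seminorm_onD(2)[OF seminorms[OF p]] scale_mem diff_mem y uz by metis
    then have half: "p (y - v) \<le> p (y - u) / 2 + p (y - z) / 2"
      using seminorm_onD(3)[OF seminorms[OF p]] diff_mem y uz by simp
    have u1: "p (y - u) \<le> \<delta>" and u2: "\<exists>w\<in>N. p (y - w) \<le> \<delta> / 2 \<Longrightarrow> p (y - u) \<le> (1 - c) * \<delta>"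
      using uc[OF y] near by auto
    have z1: "p (y - z) \<le> \<delta>" using near by simp
    have cd: "0 \<le> c * \<delta>" "c * \<delta> \<le> \<delta> / 2" using c \<delta> mult_right_mono[OF c(2) \<delta>] by auto
    show ?thesis
    proof (intro conjI impI)
      show "p (y - v) \<le> \<delta>" using half u1 z1 by simp
      assume "\<exists>w\<in>insert z N. p (y - w) \<le> \<delta> / 2"
      then consider "p (y - z) \<le> \<delta> / 2" | "\<exists>w\<in>N. p (y - w) \<le> \<delta> / 2" by auto
      then show "p (y - v) \<le> (1 - c/2) * \<delta>"
      proof cases
        case 1
        then show ?thesis using half u1 cd \<delta> by (simp add: algebra_simps)
      next
        case 2
        then show ?thesis using half u2 z1 by (simp add: algebra_simps)
      qed
    qed
  qed
  ultimately show ?case using c by (intro bexI[of _ v] exI[of _ "c/2"]) auto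
qed

theorem fixed_point:
  assumes \<mu>: "left_invariant_mean (WAP :: ('s \<Rightarrow> complex) set) \<mu>"
  shows "\<exists>x\<in>C. \<forall>s. act s x = x"
proof -
  let ?T = "subtopology (weak_topology scl X Q) C"
  define P where "P = (\<lambda>N. convex_on_scale scl N \<and> (\<forall>s. \<forall>x\<in>N. act s x \<in> N))"
  obtain M where M: "closedin ?T M" "M \<noteq> {}" "M \<subseteq> C" and PM: "P M"
    and min: "\<And>N. closedin ?T N \<Longrightarrow> N \<noteq> {} \<Longrightarrow> N \<subseteq> M \<Longrightarrow> P N \<Longrightarrow> N = M"
  proof (rule minimal_closed_set[OF sys.compact, of C P])
    show "closedin ?T C" using closedin_topspace[of ?T] by (simp only: topspace_C)
    show "C \<noteq> {}" using sys.nonempty unfolding topspace_C .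
    show "P C" using convex_C sys.act_mem unfolding P_def topspace_C by blast
    show "P (\<Inter>\<C>)" if "\<And>N. N \<in> \<C> \<Longrightarrow> P N" for \<C>
      using that unfolding P_def convex_on_scale_def by (auto simp del: of_real_eq_id id_apply)
  qed (rule that)
  have convM: "convex_on_scale scl M" and actM: "\<And>s x. x \<in> M \<Longrightarrow> act s x \<in> M" using PM by (auto simp: P_def)
  have MX: "M \<subseteq> X" using M(3) C_subset by blast
  have EM: "\<xi> y \<in> M" if \<xi>: "\<xi> \<in> sys.E" and y: "y \<in> M" for \<xi> y
  proof -
    have yC: "y \<in> C" using y M by auto
    have "\<xi> \<in> {\<xi> \<in> topspace sys.TE. \<xi> y \<in> M}"
    proof (rule sys.enveloping_in_closed[OF \<xi>])
      show "closedin sys.TE {\<xi> \<in> topspace sys.TE. \<xi> y \<in> M}"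
        by (rule closedin_continuous_map_preimage[OF sys.continuous_evaluation M(1)]) (simp only: topspace_C yC)
      show "sys.translation s \<in> {\<xi> \<in> topspace sys.TE. \<xi> y \<in> M}" for s
        using sys.translation_mem[of s] actM[OF y] translation_apply[OF yC] unfolding sys.topspace_TE by simp
    qed
    then show ?thesis by simp
  qed
  obtain x0 where x0: "x0 \<in> M" using M by auto
  have x0C: "x0 \<in> C" using x0 M by auto
  obtain e where e: "sys.env.minimal_idempotent e" by (rule sys.env.minimal_idempotent_exists)
  define G where "G = sys.env.unit_group e"
  \<comment> \<open>Since every \<open>g \<in> G\<close> equals its composition with
    \<open>e\<close>, this is also the orbit of \<open>e x0\<close>.\<close>
  define F where "F = (\<lambda>g. g x0) ` G"
  have GE: "G \<subseteq> sys.E" using sys.env.unit_group_subset unfolding G_def sys.topspace_TE .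
  have FM: "F \<subseteq> M" using EM[OF _ x0] GE by (auto simp: F_def)
  have FX: "F \<subseteq> X" using FM MX by blast
  have "e \<in> G" using e unfolding G_def sys.env.unit_group_def sys.env.minimal_idempotent_def by blast
  then have Fne: "F \<noteq> {}" by (auto simp: F_def)
  have rev: "compose sys.K (sys.translation s) g \<in> G" "\<exists>h\<in>G. compose sys.K (sys.translation s) h = g"
    if "g \<in> G" for s g
    using sys.env.reversible_acts_on_unit_group[unfolded sys.topspace_TE, OF _ e sys.translation_mem]
      sys.enveloping_reversible[OF \<mu>] that unfolding G_def by blast+
  have trans_apply: "compose sys.K (sys.translation s) g x0 = act s (g x0)" if "g \<in> G" for s g
    using that GE enveloping_mem_C[OF _ x0C] translation_apply topspace_C x0C by (auto simp: compose_def)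
  have actF: "act s y \<in> F" if y: "y \<in> F" for s y
  proof -
    obtain g where g: "g \<in> G" "y = g x0" using y by (auto simp: F_def)
    have "act s y = compose sys.K (sys.translation s) g x0" using trans_apply[OF g(1)] g(2) by simp
    then show ?thesis using rev(1)[OF g(1)] by (auto simp: F_def)
  qed
  have Fact: "\<exists>y'\<in>F. y = act s y'" if y: "y \<in> F" for s y
  proof -
    obtain g where g: "g \<in> G" "y = g x0" using y by (auto simp: F_def)
    obtain h where h: "h \<in> G" "compose sys.K (sys.translation s) h = g" using rev(2)[OF g(1)] by blast
    then have "y = act s (h x0)" using trans_apply[OF h(1)] g(2) by metis
    then show ?thesis using h(1) by (auto simp: F_def)
  qed
  have net: "\<exists>N. finite N \<and> N \<subseteq> F \<and> (\<forall>y\<in>F. \<exists>z\<in>N. p (y - z) < \<epsilon>)" if p: "p \<in> Q" and \<epsilon>: "0 < \<epsilon>" for p \<epsilon>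
  proof -
    have sym: "p (y - z) = p (z - y)" if "y \<in> F" "z \<in> F" for y z
      using seminorm_on_neg[OF seminorms[OF p] diff_mem, of y z] subsetD[OF FX] that by simp
    have sep: "\<exists>m n. m \<noteq> n \<and> p (f m - f n) < \<epsilon>" if f: "range f \<subseteq> F" for f :: "nat \<Rightarrow> 'x"
    proof -
      have "\<forall>n. \<exists>g\<in>G. f n = g x0" using f by (auto simp: F_def)
      then obtain g where g: "\<And>n. g n \<in> G" "\<And>n. f n = g n x0" by metis
      show ?thesis
        using group_orbit_no_separated_sequence[OF e x0C p \<epsilon>, of g] g by (simp add: G_def)
    qed
    show ?thesis
    proof (rule finite_net_of_no_separated_sequence[of F "\<lambda>y z. p (y - z)" \<epsilon>])
      fix N assume "finite N" "N \<subseteq> F" "\<And>y. y \<in> F \<Longrightarrow> \<exists>z\<in>N. p (y - z) < \<epsilon>"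
      then show ?thesis by blast
    qed (use sym sep in auto)
  qed
  have single: "y1 = y2" if y: "y1 \<in> F" "y2 \<in> F" for y1 y2
  proof (rule ccontr)
    assume "y1 \<noteq> y2"
    then obtain p where p: "p \<in> Q" and pos: "0 < p (y1 - y2)" using seminorm_separates y FX by blast
    note sn = seminorms[OF p]
    have tri: "p (a - c) \<le> p (a - b) + p (b - c)" if "a \<in> X" "b \<in> X" "c \<in> X" for a b c
      using seminorm_onD(2)[OF sn, of "a - b" "b - c"] that diff_mem by simp
    have sym: "p (a - b) = p (b - a)" if "a \<in> X" "b \<in> X" for a b
      using seminorm_on_neg[OF sn diff_mem, of a b] that by auto
    define \<delta> where "\<delta> = (SUP z\<in>F \<times> F. p (fst z - snd z))"
    have bdd: "bdd_above ((\<lambda>z. p (fst z - snd z)) ` (F \<times> F))"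
    proof -
      obtain N where N: "finite N" "N \<subseteq> F" "\<forall>y\<in>F. \<exists>z\<in>N. p (y - z) < 1" using net[OF p, of 1] by auto
      obtain B where B: "\<And>a b. a \<in> N \<Longrightarrow> b \<in> N \<Longrightarrow> p (a - b) \<le> B"
      proof
        show "p (a - b) \<le> Max ((\<lambda>z. p (fst z - snd z)) ` (N \<times> N))" if "a \<in> N" "b \<in> N" for a b
          by (rule Max_ge) (use N(1) that in \<open>auto intro: image_eqI[of _ _ "(a, b)"]\<close>)
      qed
      have "p (y - y') \<le> 2 + B" if yy: "y \<in> F" "y' \<in> F" for y y'
      proof -
        obtain a b where ab: "a \<in> N" "p (y - a) < 1" "b \<in> N" "p (y' - b) < 1" using N(3) yy by meson
        have X: "y \<in> X" "y' \<in> X" "a \<in> X" "b \<in> X" using ab yy N(2) FX by auto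
        show ?thesis using tri[OF X(1,3,2)] tri[OF X(3,4,2)] ab B[OF ab(1,3)] sym[OF X(2,4)] by simp
      qed
      then show ?thesis by (intro bdd_aboveI[of _ "2 + B"]) auto
    qed
    have le\<delta>: "p (a - b) \<le> \<delta>" if "a \<in> F" "b \<in> F" for a b
      using cSUP_upper[OF _ bdd, of "(a, b)"] that by (simp add: \<delta>_def)
    have \<delta>: "0 < \<delta>" using pos le\<delta>[OF y] by simp
    \<comment> \<open>\<open>\<delta>\<close> is the \<open>p\<close>-diameter of \<open>F\<close>.
      With a net of mesh \<open>\<delta> / 2\<close> every point of \<open>F\<close> is within
      \<open>\<delta>\<close> of all of \<open>N\<close> and within \<open>\<delta> / 2\<close> of
      some member, as \<open>off_center_point\<close> requires.\<close>
    obtain N where N: "finite N" "N \<subseteq> F" "\<forall>y\<in>F. \<exists>z\<in>N. p (y - z) < \<delta> / 2" using net[OF p, of "\<delta>/2"] \<delta> by auto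
    have Nne: "N \<noteq> {}" using N(3) Fne by blast
    have NM: "N \<subseteq> M" using N(2) FM by blast
    obtain u c where u: "u \<in> M" and c: "0 < c" and
      uc: "\<And>y. y \<in> X \<Longrightarrow> \<forall>z\<in>N. p (y - z) \<le> \<delta> \<Longrightarrow> \<exists>z\<in>N. p (y - z) \<le> \<delta> / 2 \<Longrightarrow> p (y - u) \<le> (1 - c) * \<delta>"
      using off_center_point[OF N(1) Nne MX convM NM p less_imp_le[OF \<delta>]] by blast
    define r where "r = (1 - c) * \<delta>"
    have uF: "p (y - u) \<le> r" if yF: "y \<in> F" for y
      unfolding r_def
    proof (rule uc)
      show "\<forall>z\<in>N. p (y - z) \<le> \<delta>" using le\<delta> yF N(2) by blast
      show "\<exists>z\<in>N. p (y - z) \<le> \<delta> / 2" using N(3) yF less_imp_le by blast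
    qed (use yF FX in blast)
    \<comment> \<open>The points of \<open>M\<close> within \<open>r\<close>, less than
      \<open>\<delta>\<close>, of all of \<open>F\<close>. Invariance uses that every
      \<open>y \<in> F\<close> has the form \<open>act s y'\<close> with \<open>y' \<in> F\<close>.
      Being all of \<open>M\<close>, the set contains \<open>F\<close>, whose diameter would then be
      at most \<open>r\<close>.\<close>
    define M' where "M' = M \<inter> (\<Inter>y\<in>F. {x \<in> X. p (x - y) \<le> r})"
    have "M' = M"
    proof (rule min)
      have "closedin ?T (C \<inter> {x \<in> X. p (x - y) \<le> r})" if "y \<in> F" for y
        using closedin_weak_seminorm_ball[OF p, of y r] that FX by (auto simp: closedin_subtopology)
      then have "closedin ?T (M \<inter> (\<Inter>y\<in>F. C \<inter> {x \<in> X. p (x - y) \<le> r}))"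
        using closedin_INT[OF Fne, of ?T "\<lambda>y. C \<inter> {x \<in> X. p (x - y) \<le> r}"]
        by (intro closedin_Int M(1)) blast
      moreover have "M' = M \<inter> (\<Inter>y\<in>F. C \<inter> {x \<in> X. p (x - y) \<le> r})" using M(3) Fne by (auto simp: M'_def)
      ultimately show "closedin ?T M'" by simp
      have "p (u - y) \<le> r" if "y \<in> F" for y
        using uF[OF that] sym[of u y] subsetD[OF FX that] subsetD[OF MX u] by simp
      then have "u \<in> M'" using u MX by (auto simp: M'_def)
      then show "M' \<noteq> {}" by blast
      have "convex_on_scale scl M'" unfolding convex_on_scale_def
      proof (intro ballI allI impI)
        fix a b and t :: real assume a: "a \<in> M'" and b: "b \<in> M'" and t: "0 \<le> t \<and> t \<le> 1"
        define v where "v = scl (1 - t) a + scl t b"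
        have vM: "v \<in> M" using convM a b t by (auto simp: convex_on_scale_def v_def M'_def)
        have "p (v - y) \<le> r" if yF: "y \<in> F" for y
        proof -
          have X: "a \<in> X" "b \<in> X" "y \<in> X" using a b yF FX MX by (auto simp: M'_def)
          have "scl (1 - t) y + scl t y = y" by (simp flip: scale_left_distrib)
          then have "v - y = scl (1 - t) (a - y) + scl t (b - y)"
            by (simp add: v_def scale_right_diff_distrib algebra_simps)
          then have "p (v - y) \<le> p (scl (1 - t) (a - y)) + p (scl t (b - y))"
            using seminorm_onD(2)[OF sn] scale_mem diff_mem X by metis
          also have "\<dots> = (1 - t) * p (a - y) + t * p (b - y)"
            using seminorm_onD(3)[OF sn] diff_mem X t by simp
          also have "\<dots> \<le> (1 - t) * r + t * r"
            using a b t yF by (intro add_mono mult_left_mono) (auto simp: M'_def)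
          finally show ?thesis by (simp add: algebra_simps)
        qed
        then show "scl (of_real (1 - t)) a + scl (of_real t) b \<in> M'" using vM MX by (auto simp: M'_def v_def)
      qed
      moreover have "act s x \<in> M'" if x: "x \<in> M'" for s x
      proof -
        have xM: "x \<in> M" using x by (simp add: M'_def)
        have "p (act s x - y) \<le> r" if "y \<in> F" for y
        proof -
          obtain y' where y': "y' \<in> F" "y = act s y'" using Fact[OF \<open>y \<in> F\<close>] by blast
          have "x \<in> C" "y' \<in> C" using xM y'(1) FM M(3) by auto
          then have "p (act s x - act s y') \<le> p (x - y')"
            using nonexp p unfolding nonexpansive_def by blast
          also have "\<dots> \<le> r" using x y'(1) by (auto simp: M'_def)
          finally show ?thesis using y'(2) by simp
        qed
        then show ?thesis using actM[OF xM] MX by (auto simp: M'_def)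
      qed
      ultimately show "P M'" by (auto simp: P_def)
    qed (auto simp: M'_def)
    then have "p (a - b) \<le> r" if "a \<in> F" "b \<in> F" for a b using that FM by (auto simp: M'_def)
    then have "\<delta> \<le> r" unfolding \<delta>_def using Fne by (intro cSUP_least) auto
    then show False using c \<delta> by (simp add: r_def algebra_simps mult_le_0_iff)
  qed
  obtain x where x: "x \<in> F" using Fne by blast
  have "act s x = x" for s by (rule single[OF actF[OF x] x])
  then show ?thesis using x FM M(3) by blast
qed

end

section \<open>The fixed point property over the real and the complex field\<close>

lemma fixed_point_property_real:
  assumes \<mu>: "left_invariant_mean (WAP :: ('s::semitopological_semigroup \<Rightarrow> complex) set) \<mu>"
  shows "fixed_point_property TYPE('s) TYPE(real) TYPE('x::ab_group_add)"
  unfolding fixed_point_property_def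
proof (intro allI impI)
  fix scl :: "real \<Rightarrow> 'x \<Rightarrow> 'x" and X Q C and act :: "'s \<Rightarrow> 'x \<Rightarrow> 'x"
  assume L: "locally_convex_space scl X Q" and ne: "C \<noteq> {}" and C: "compactin (weak_topology scl X Q) C"
    and conv: "convex_on_scale scl C" and dyn: "dynamical_system act (subtopology (weak_topology scl X Q) C)"
    and nonexp: "nonexpansive Q act C"
    and env: "\<forall>f\<in>enveloping_semigroup act (subtopology (weak_topology scl X Q) C).
      continuous_map (subtopology (weak_topology scl X Q) C) (subtopology (weak_topology scl X Q) C) f"
  interpret L: locally_convex_space scl X Q by (rule L)
  interpret real_locally_convex_space scl X Q ..
  interpret dynamical_system act "subtopology (weak_topology scl X Q) C" by (rule dyn)
  have CX: "C \<subseteq> X" using compactin_subset_topspace[OF C] by simp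
  interpret nonexpansive_system scl X Q act C
  proof unfold_locales
    show "compact_space (subtopology (weak_topology scl X Q) C)" by (rule compact_space_subtopology[OF C])
    show "Hausdorff_space (subtopology (weak_topology scl X Q) C)" by (rule Hausdorff_space_subtopology[OF Hausdorff_weak])
  qed (use ne CX conv nonexp env in auto)
  show "\<exists>x\<in>C. \<forall>s. act s x = x" by (rule fixed_point[OF \<mu>])
qed

text \<open>Forgetting multiplication by \<open>\<i>\<close> leaves seminorms, convexity, action and
  weak topology as they are.\<close>

lemma fixed_point_property_complex:
  assumes "fixed_point_property TYPE('s::semitopological_semigroup) TYPE(real) TYPE('x::ab_group_add)"
  shows "fixed_point_property TYPE('s) TYPE(complex) TYPE('x)"
  unfolding fixed_point_property_def
proof (intro allI impI)
  fix scl :: "complex \<Rightarrow> 'x \<Rightarrow> 'x" and X Q C and act :: "'s \<Rightarrow> 'x \<Rightarrow> 'x"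
  assume L: "locally_convex_space scl X Q" and ne: "C \<noteq> {}" and C: "compactin (weak_topology scl X Q) C"
    and conv: "convex_on_scale scl C" and dyn: "dynamical_system act (subtopology (weak_topology scl X Q) C)"
    and nonexp: "nonexpansive Q act C"
    and env: "\<forall>f\<in>enveloping_semigroup act (subtopology (weak_topology scl X Q) C).
      continuous_map (subtopology (weak_topology scl X Q) C) (subtopology (weak_topology scl X Q) C) f"
  define rscl where "rscl = (\<lambda>r::real. scl (of_real r))"
  have W: "locally_convex_space rscl X Q" "weak_topology rscl X Q = weak_topology scl X Q"
    using real_restriction[OF L] by (simp_all add: rscl_def)
  have "convex_on_scale rscl C" using conv by (simp add: convex_on_scale_def rscl_def)
  then show "\<exists>x\<in>C. \<forall>s. act s x = x"
    using assms[unfolded fixed_point_property_def, rule_format, of rscl X Q C act] W ne C dyn nonexp env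
    by simp
qed

section \<open>Means on weakly almost periodic functions\<close>

text \<open>A compact topology coincides with any coarser Hausdorff one, so continuity may be tested
  in the coarser. It lets pointwise continuity of orbits imply weak continuity.\<close>

lemma continuous_map_into_compact:
  assumes T: "compact_space T" and T': "Hausdorff_space T'" and id: "continuous_map T T' (\<lambda>x. x)"
    and g: "continuous_map Z T' g" "g ` topspace Z \<subseteq> topspace T"
  shows "continuous_map Z T g"
  unfolding continuous_map_closedin
proof (intro conjI allI impI)
  fix D assume D: "closedin T D"
  have "compactin T' ((\<lambda>x. x) ` D)" by (rule image_compactin[OF closedin_compact_space[OF T D] id])
  then have "closedin T' D" using compactin_imp_closedin[OF T'] by simp
  then show "closedin Z {x \<in> topspace Z. g x \<in> D}" by (rule closedin_continuous_map_preimage[OF g(1)])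
qed (use g in auto)

lemma continuous_map_euclidean_coordinatewise:
  "continuous_map T (euclidean :: ('i \<Rightarrow> 'b::topological_space) topology) g \<longleftrightarrow> (\<forall>i. continuous_map T euclidean (\<lambda>x. g x i))"
  unfolding euclidean_product_topology[symmetric] continuous_map_componentwise_UNIV ..

lemma left_translate_left_translate: "left_translate s (left_translate t f) = left_translate (t * s) f"
  by (simp add: left_translate_def mult.assoc)

lemma left_translate_linear:
  "left_translate s (f + g) = left_translate s f + left_translate s g"
  "left_translate s (scale_fun c f) = scale_fun c (left_translate s f)"
  by (auto simp: left_translate_def scale_fun_def)

lemma sup_norm_left_translate:
  assumes "f \<in> bounded_continuous"
  shows "sup_norm (left_translate s f) \<le> sup_norm f"
  using assms by (intro sup_norm_le) (auto simp: left_translate_def bounded_continuous_def intro: norm_le_sup_norm)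

lemma left_translate_dual:
  fixes \<phi> :: "('s::semitopological_semigroup \<Rightarrow> complex) \<Rightarrow> complex"
  assumes "\<phi> \<in> continuous_dual scale_fun bounded_continuous {sup_norm}"
  shows "(\<lambda>f. \<phi> (left_translate s f)) \<in> continuous_dual scale_fun bounded_continuous {sup_norm}"
proof -
  obtain C where lin: "linear_functional_on scale_fun bounded_continuous \<phi>"
    and C: "0 \<le> C" "\<And>f. f \<in> bounded_continuous \<Longrightarrow> cmod (\<phi> f) \<le> C * sup_norm f"
    using assms unfolding bounded_functional_iff[OF BC.locally_convex_space_axioms] by blast
  have "cmod (\<phi> (left_translate s f)) \<le> C * sup_norm f" if "f \<in> bounded_continuous" for f
    using C(2)[OF left_translate_bounded_continuous[OF that, of s]]
      mult_left_mono[OF sup_norm_left_translate[OF that, of s] C(1)] by linarith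
  moreover have "linear_functional_on scale_fun bounded_continuous (\<lambda>f. \<phi> (left_translate s f))"
    using lin left_translate_bounded_continuous[of _ s] by (auto simp: linear_functional_on_def left_translate_linear)
  ultimately show ?thesis
    unfolding bounded_functional_iff[OF BC.locally_convex_space_axioms] using C(1) by blast
qed

lemma continuous_map_left_translate:
  "continuous_map weakC weakC (left_translate (s :: 's::semitopological_semigroup))"
  unfolding BC.continuous_map_into_weak
  using left_translate_bounded_continuous BC.continuous_map_weak_functional[OF left_translate_dual] by auto

section \<open>Functionals with the seminorms of invariant weakly compact sets\<close>

text \<open>Invariance will make the seminorms nonexpansive, weak compactness makes Grothendieck's
  theorem applicable, and the norm bound keeps the suprema finite.\<close>

definition invariant_compact :: "('s::semitopological_semigroup \<Rightarrow> complex) set set" where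
  "invariant_compact = {A. A \<noteq> {} \<and> A \<subseteq> WAP \<and> compactin weakC A \<and> (\<exists>M. \<forall>a\<in>A. sup_norm a \<le> M) \<and>
     (\<forall>s. \<forall>a\<in>A. left_translate s a \<in> A)}"

text \<open>The weak closure of the orbit is invariant since translations are weakly continuous, and
  it keeps the bound \<open>sup_norm f\<close> since evaluations are. Without a unit in the
  semigroup \<open>f\<close> may lie outside this closure, so it is adjoined.\<close>

lemma invariant_compact_exists:
  fixes f :: "'s::semitopological_semigroup \<Rightarrow> complex"
  assumes f: "f \<in> WAP"
  obtains A where "A \<in> invariant_compact" "f \<in> A"
proof -
  define Orb where "Orb = range (\<lambda>s. left_translate s f)"
  define B where "B = weakC closure_of Orb"
  have fb: "f \<in> bounded_continuous" by (rule WAP_bounded_continuous[OF f])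
  have comp: "compactin weakC B" using f by (simp add: WAP_def B_def Orb_def)
  have OB: "left_translate s f \<in> B" for s using orbit_subset_closure[OF fb] by (simp add: B_def Orb_def)
  have Bb: "B \<subseteq> bounded_continuous"
    using closure_of_subset_topspace[of weakC Orb] by (simp add: B_def)
  have inv: "left_translate s g \<in> B" if g: "g \<in> B" for s g
  proof -
    have "left_translate s ` B \<subseteq> weakC closure_of (left_translate s ` Orb)"
      unfolding B_def by (rule continuous_map_image_closure_subset[OF continuous_map_left_translate])
    moreover have "weakC closure_of (left_translate s ` Orb) \<subseteq> B"
      unfolding B_def by (rule closure_of_mono) (auto simp: Orb_def left_translate_left_translate)
    ultimately show ?thesis using g by auto
  qed
  have BW: "B \<subseteq> WAP"
    using WAP_I[OF _ comp inv] Bb by blast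
  have le: "sup_norm g \<le> sup_norm f" if g: "g \<in> B" for g
  proof (rule sup_norm_le)
    fix t :: 's
    have "closedin weakC {g \<in> topspace weakC. g t \<in> cball 0 (sup_norm f)}"
      by (rule closedin_continuous_map_preimage[OF continuous_map_weakC_evaluation]) simp
    moreover have "Orb \<subseteq> {g \<in> topspace weakC. g t \<in> cball 0 (sup_norm f)}"
      using left_translate_bounded_continuous[OF fb] norm_le_sup_norm[of f] fb
      by (auto simp: Orb_def left_translate_def bounded_continuous_def)
    ultimately have "B \<subseteq> {g \<in> topspace weakC. g t \<in> cball 0 (sup_norm f)}"
      unfolding B_def by (intro closure_of_minimal)
    then show "cmod (g t) \<le> sup_norm f" using g by auto
  qed
  have "compactin weakC (insert f B)"
    using compactin_Un[of weakC "{f}" B] comp fb finite_imp_compactin[of "{f}" weakC] by simp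
  then have "insert f B \<in> invariant_compact"
    using f BW le inv OB by (auto simp: invariant_compact_def intro!: exI[of _ "sup_norm f"])
  then show ?thesis using that by blast
qed

lemma invariant_compactD:
  assumes "A \<in> invariant_compact"
  shows "A \<noteq> {}" "A \<subseteq> WAP" "compactin weakC A" "a \<in> A \<Longrightarrow> left_translate s a \<in> A"
  using assms by (auto simp: invariant_compact_def)

lemma left_translate_WAP: "f \<in> WAP \<Longrightarrow> left_translate s f \<in> WAP"
  by (metis invariant_compact_exists invariant_compactD(2,4) subsetD)

lemma invariant_compact_Un:
  assumes "A \<in> invariant_compact" "B \<in> invariant_compact"
  shows "A \<union> B \<in> invariant_compact"
proof -
  obtain M N where "\<forall>a\<in>A. sup_norm a \<le> M" "\<forall>a\<in>B. sup_norm a \<le> N"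
    using assms by (auto simp: invariant_compact_def)
  then have "\<forall>a\<in>A \<union> B. sup_norm a \<le> max M N" by (auto simp: le_max_iff_disj)
  then show ?thesis using assms by (auto simp: invariant_compact_def intro: compactin_Un)
qed

text \<open>The value 0 outside \<open>WAP\<close> identifies functionals that agree on
  \<open>WAP\<close>, so that the seminorms separate points.\<close>

definition restrict_WAP :: "(('s::semitopological_semigroup \<Rightarrow> complex) \<Rightarrow> complex) \<Rightarrow> ('s \<Rightarrow> complex) \<Rightarrow> complex" where
  "restrict_WAP \<phi> f = (if f \<in> WAP then \<phi> f else 0)"

text \<open>Only those functionals that extend to all bounded continuous functions are used, which saves an
  application of the Hahn-Banach theorem: they are weakly continuous by definition.\<close>

definition WAP_dual :: "(('s::semitopological_semigroup \<Rightarrow> complex) \<Rightarrow> complex) set" where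
  "WAP_dual = restrict_WAP ` continuous_dual scale_fun bounded_continuous {sup_norm}"

definition compact_seminorm :: "('s \<Rightarrow> complex) set \<Rightarrow> (('s \<Rightarrow> complex) \<Rightarrow> complex) \<Rightarrow> real" where
  "compact_seminorm A \<mu> = (SUP a\<in>A. cmod (\<mu> a))"

definition compact_seminorms :: "((('s::semitopological_semigroup \<Rightarrow> complex) \<Rightarrow> complex) \<Rightarrow> real) set" where
  "compact_seminorms = compact_seminorm ` invariant_compact"

abbreviation "weakX \<equiv> weak_topology scale_fun WAP_dual compact_seminorms"

lemma subspace_WAP_dual: "complex_function.subspace (WAP_dual :: (('s::semitopological_semigroup \<Rightarrow> complex) \<Rightarrow> complex) set)"
  unfolding complex_function.subspace_def
proof (intro conjI ballI allI)
  let ?D = "continuous_dual scale_fun bounded_continuous {sup_norm} :: (('s \<Rightarrow> complex) \<Rightarrow> complex) set"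
  note iff = bounded_functional_iff[OF BC.locally_convex_space_axioms]
  have "(\<lambda>_. 0) \<in> ?D" unfolding iff by (auto simp: linear_functional_on_def intro!: exI[of _ 0])
  then show "0 \<in> (WAP_dual :: (('s \<Rightarrow> complex) \<Rightarrow> complex) set)"
    by (auto simp: WAP_dual_def restrict_WAP_def fun_eq_iff intro!: image_eqI[of _ _ "\<lambda>_. 0"])
  fix \<mu> \<nu> :: "('s \<Rightarrow> complex) \<Rightarrow> complex" and c :: complex
  assume "\<mu> \<in> WAP_dual"
  then obtain \<phi> where \<phi>: "\<phi> \<in> ?D" "\<mu> = restrict_WAP \<phi>" by (auto simp: WAP_dual_def)
  obtain C where C: "0 \<le> C" "\<forall>f\<in>bounded_continuous. cmod (\<phi> f) \<le> C * sup_norm f" using \<phi>(1) unfolding iff by blast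
  have "(\<lambda>f. c * \<phi> f) \<in> ?D"
    unfolding iff
  proof (intro conjI exI[of _ "cmod c * C"] ballI)
    show "cmod (c * \<phi> f) \<le> cmod c * C * sup_norm f" if "f \<in> bounded_continuous" for f
      using mult_left_mono[OF C(2)[rule_format, OF that], of "cmod c"] by (simp add: norm_mult mult.assoc)
  qed (use \<phi>(1) C in \<open>auto simp: iff linear_functional_on_def algebra_simps\<close>)
  then show "scale_fun c \<mu> \<in> WAP_dual"
    unfolding WAP_dual_def \<phi>(2) by (rule image_eqI[rotated]) (auto simp: restrict_WAP_def scale_fun_def)
  assume "\<nu> \<in> WAP_dual"
  then obtain \<psi> where \<psi>: "\<psi> \<in> ?D" "\<nu> = restrict_WAP \<psi>" by (auto simp: WAP_dual_def)
  obtain D where D: "0 \<le> D" "\<forall>f\<in>bounded_continuous. cmod (\<psi> f) \<le> D * sup_norm f" using \<psi>(1) unfolding iff by blast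
  have "(\<lambda>f. \<phi> f + \<psi> f) \<in> ?D"
    unfolding iff
  proof (intro conjI exI[of _ "C + D"] ballI)
    show "cmod (\<phi> f + \<psi> f) \<le> (C + D) * sup_norm f" if "f \<in> bounded_continuous" for f
      using C(2) D(2) that norm_triangle_le[of "\<phi> f" "\<psi> f"] by (force simp: distrib_right)
  qed (use \<phi>(1) \<psi>(1) C D in \<open>auto simp: iff linear_functional_on_def algebra_simps\<close>)
  then show "\<mu> + \<nu> \<in> WAP_dual"
    unfolding WAP_dual_def \<phi>(2) \<psi>(2) by (rule image_eqI[rotated]) (auto simp: restrict_WAP_def)
qed

lemma WAP_dual_linear:
  assumes "\<mu> \<in> WAP_dual"
  shows "linear_functional_on scale_fun WAP \<mu>"
  using assms
  by (auto simp: WAP_dual_def restrict_WAP_def continuous_dual_def linear_functional_on_def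
      WAP_bounded_continuous WAP.carrier_closed)

lemma WAP_dual_zero: "\<mu> \<in> WAP_dual \<Longrightarrow> f \<notin> WAP \<Longrightarrow> \<mu> f = 0"
  by (auto simp: WAP_dual_def restrict_WAP_def)

lemma WAP_dual_bounded:
  assumes "\<mu> \<in> WAP_dual"
  obtains C where "0 \<le> C" "\<And>f. f \<in> WAP \<Longrightarrow> cmod (\<mu> f) \<le> C * sup_norm f"
proof -
  obtain \<phi> where \<phi>: "\<phi> \<in> continuous_dual scale_fun bounded_continuous {sup_norm}" "\<mu> = restrict_WAP \<phi>"
    using assms by (auto simp: WAP_dual_def)
  obtain C where "0 \<le> C" "\<forall>f\<in>bounded_continuous. cmod (\<phi> f) \<le> C * sup_norm f"
    using \<phi>(1) unfolding bounded_functional_iff[OF BC.locally_convex_space_axioms] by blast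
  then show ?thesis using that[of C] by (auto simp: \<phi>(2) restrict_WAP_def WAP_bounded_continuous)
qed

lemma WAP_dual_weakly_continuous:
  assumes "\<mu> \<in> WAP_dual" "A \<subseteq> WAP"
  shows "continuous_map (subtopology weakC A) euclidean \<mu>"
proof -
  obtain \<phi> where \<phi>: "\<phi> \<in> continuous_dual scale_fun bounded_continuous {sup_norm}" "\<mu> = restrict_WAP \<phi>"
    using assms by (auto simp: WAP_dual_def)
  have "continuous_map (subtopology weakC A) euclidean \<phi>"
    by (rule continuous_map_from_subtopology[OF BC.continuous_map_weak_functional[OF \<phi>(1)]])
  then show ?thesis
    by (rule continuous_map_eq) (use assms(2) in \<open>auto simp: \<phi>(2) restrict_WAP_def\<close>)
qed

lemma bdd_above_compact_seminorm:
  assumes "\<mu> \<in> WAP_dual" "A \<in> invariant_compact"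
  shows "bdd_above ((\<lambda>a. cmod (\<mu> a)) ` A)"
proof -
  obtain C where C: "0 \<le> C" "\<And>f. f \<in> WAP \<Longrightarrow> cmod (\<mu> f) \<le> C * sup_norm f" by (rule WAP_dual_bounded[OF assms(1)]) blast
  obtain M where M: "\<forall>a\<in>A. sup_norm a \<le> M" and AW: "A \<subseteq> WAP" using assms(2) by (auto simp: invariant_compact_def)
  have "cmod (\<mu> a) \<le> C * M" if "a \<in> A" for a
    using C(2)[of a] mult_left_mono[OF _ C(1), of "sup_norm a" M] M AW that by force
  then show ?thesis by (auto intro: bdd_aboveI[of _ "C * M"])
qed

lemma compact_seminorm_upper:
  "\<mu> \<in> WAP_dual \<Longrightarrow> A \<in> invariant_compact \<Longrightarrow> a \<in> A \<Longrightarrow> cmod (\<mu> a) \<le> compact_seminorm A \<mu>"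
  unfolding compact_seminorm_def by (rule cSUP_upper[OF _ bdd_above_compact_seminorm])

lemma compact_seminorm_least:
  "A \<in> invariant_compact \<Longrightarrow> (\<And>a. a \<in> A \<Longrightarrow> cmod (\<mu> a) \<le> c) \<Longrightarrow> compact_seminorm A \<mu> \<le> c"
  unfolding compact_seminorm_def by (rule cSUP_least) (auto simp: invariant_compactD)

lemma seminorm_on_compact_seminorm:
  assumes A: "A \<in> invariant_compact"
  shows "seminorm_on scale_fun WAP_dual (compact_seminorm A)"
proof -
  have "compact_seminorm A = (\<lambda>\<mu>. SUP a\<in>A. cmod (\<mu> a))" by (auto simp: compact_seminorm_def)
  then show ?thesis
    using seminorm_on_Sup_norm[OF subspace_WAP_dual invariant_compactD(1)[OF A]]
      bdd_above_compact_seminorm[OF _ A] by simp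
qed

interpretation dual: locally_convex_space scale_fun
  "WAP_dual :: (('s::semitopological_semigroup \<Rightarrow> complex) \<Rightarrow> complex) set" compact_seminorms
proof (rule complex_function.locally_convex_spaceI[OF subspace_WAP_dual])
  show "seminorm_on scale_fun WAP_dual p" if "p \<in> compact_seminorms"
    for p :: "(('s \<Rightarrow> complex) \<Rightarrow> complex) \<Rightarrow> real"
    using that seminorm_on_compact_seminorm by (auto simp: compact_seminorms_def)
  fix \<mu> :: "('s \<Rightarrow> complex) \<Rightarrow> complex" assume \<mu>: "\<mu> \<in> WAP_dual" "\<mu> \<noteq> 0"
  then obtain f where f: "\<mu> f \<noteq> 0" by (auto simp: fun_eq_iff)
  then have "f \<in> WAP" using WAP_dual_zero[OF \<mu>(1)] by blast
  then obtain A where A: "A \<in> invariant_compact" "f \<in> A" by (rule invariant_compact_exists)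
  have "0 < compact_seminorm A \<mu>" using compact_seminorm_upper[OF \<mu>(1) A] f by (simp add: order_less_le_trans[of 0 "cmod (\<mu> f)"])
  then show "\<exists>p\<in>compact_seminorms. p \<mu> \<noteq> 0"
    using A(1) by (intro bexI[of _ "compact_seminorm A"]) (auto simp: compact_seminorms_def)
qed

text \<open>A union of two invariant compact sets is again one, so the seminorms are directed and a
  single set controls the functional.\<close>

lemma compact_seminorms_dominated:
  fixes \<phi> :: "(('s::semitopological_semigroup \<Rightarrow> complex) \<Rightarrow> complex) \<Rightarrow> complex"
  assumes "\<phi> \<in> continuous_dual scale_fun WAP_dual compact_seminorms"
  obtains A C where "A \<in> invariant_compact" "0 \<le> C" "\<And>\<mu>. \<mu> \<in> WAP_dual \<Longrightarrow> cmod (\<phi> \<mu>) \<le> C * compact_seminorm A \<mu>"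
proof (rule dual.continuous_dual_dominated[OF assms])
  obtain A :: "('s \<Rightarrow> complex) set" where "A \<in> invariant_compact"
    using invariant_compact_exists[OF const_WAP] by blast
  then show "(compact_seminorms :: ((('s \<Rightarrow> complex) \<Rightarrow> complex) \<Rightarrow> real) set) \<noteq> {}" by (auto simp: compact_seminorms_def)
next
  fix p q :: "(('s \<Rightarrow> complex) \<Rightarrow> complex) \<Rightarrow> real"
  assume "p \<in> compact_seminorms" "q \<in> compact_seminorms"
  then obtain A B where AB: "A \<in> invariant_compact" "B \<in> invariant_compact" "p = compact_seminorm A" "q = compact_seminorm B"
    by (auto simp: compact_seminorms_def)
  have U: "A \<union> B \<in> invariant_compact" by (rule invariant_compact_Un[OF AB(1,2)])
  have "compact_seminorm A \<mu> \<le> compact_seminorm (A \<union> B) \<mu> \<and> compact_seminorm B \<mu> \<le> compact_seminorm (A \<union> B) \<mu>"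
    if "\<mu> \<in> WAP_dual" for \<mu>
    using compact_seminorm_upper[OF that U] by (intro conjI compact_seminorm_least AB) auto
  then show "\<exists>r\<in>compact_seminorms. \<forall>\<mu>\<in>WAP_dual. p \<mu> \<le> r \<mu> \<and> q \<mu> \<le> r \<mu>"
    using U AB(3,4) by (intro bexI[of _ "compact_seminorm (A \<union> B)"]) (auto simp: compact_seminorms_def)
next
  fix p C assume p: "p \<in> compact_seminorms" and C: "0 \<le> C" "\<And>\<mu>. \<mu> \<in> WAP_dual \<Longrightarrow> cmod (\<phi> \<mu>) \<le> C * p \<mu>"
  then show thesis using that by (auto simp: compact_seminorms_def)
qed

section \<open>The compact convex set of means\<close>

text \<open>These are means on all bounded continuous functions, restricted to \<open>WAP\<close>
  afterwards. The value 0 elsewhere places the set inside a product of discs.\<close>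

definition means :: "(('s::semitopological_semigroup \<Rightarrow> complex) \<Rightarrow> complex) set" where
  "means = {\<phi>. linear_functional_on scale_fun bounded_continuous \<phi> \<and>
     (\<forall>f\<in>bounded_continuous. cmod (\<phi> f) \<le> sup_norm f) \<and> \<phi> (\<lambda>_. 1) = 1 \<and> (\<forall>f. f \<notin> bounded_continuous \<longrightarrow> \<phi> f = 0)}"

abbreviation "WAP_means \<equiv> restrict_WAP ` means"

lemma means_dual: "\<phi> \<in> means \<Longrightarrow> \<phi> \<in> continuous_dual scale_fun bounded_continuous {sup_norm}"
  unfolding bounded_functional_iff[OF BC.locally_convex_space_axioms] means_def
  by (auto intro!: exI[of _ 1])

lemma WAP_means_dual: "WAP_means \<subseteq> WAP_dual"
  by (auto simp: WAP_dual_def means_dual)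

lemma WAP_means_norm: "\<mu> \<in> WAP_means \<Longrightarrow> f \<in> WAP \<Longrightarrow> cmod (\<mu> f) \<le> sup_norm f"
  by (auto simp: means_def restrict_WAP_def WAP_bounded_continuous)

lemma WAP_means_one: "\<mu> \<in> WAP_means \<Longrightarrow> \<mu> (\<lambda>_. 1) = 1"
  by (auto simp: means_def restrict_WAP_def const_WAP)

lemma const_bounded_continuous: "(\<lambda>_. c) \<in> bounded_continuous"
  by (simp add: bounded_continuous_def)

lemma WAP_means_nonempty: "WAP_means \<noteq> {}"
proof -
  have "(\<lambda>f. if f \<in> bounded_continuous then f undefined else 0) \<in> means"
    using BC.carrier_closed(2,3)
    by (auto simp: means_def linear_functional_on_def scale_fun_def const_bounded_continuous BC.carrier_closed(2,3)[unfolded scale_fun_def]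
        intro!: norm_le_sup_norm) (auto simp: bounded_continuous_def)
  then show ?thesis by blast
qed

text \<open>The Banach-Alaoglu argument: linearity and the normalization are closed conditions in a
  Tychonoff product of discs with radii \<open>sup_norm f\<close>, or 0 off the bounded continuous
  functions.\<close>

lemma compact_means: "compact (means :: (('s::semitopological_semigroup \<Rightarrow> complex) \<Rightarrow> complex) set)"
proof -
  define B where "B = (\<lambda>f :: 's \<Rightarrow> complex. cball (0::complex) (if f \<in> bounded_continuous then sup_norm f else 0))"
  have "compactin (product_topology (\<lambda>_. euclidean) UNIV) (PiE UNIV B)"
    unfolding compactin_PiE by (auto simp: B_def)
  then have comp: "compact (PiE UNIV B)" by (simp add: euclidean_product_topology)
  have "closed {\<phi> :: ('s \<Rightarrow> complex) \<Rightarrow> complex. \<phi> (f + g) = \<phi> f + \<phi> g}"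
    "closed {\<phi> :: ('s \<Rightarrow> complex) \<Rightarrow> complex. \<phi> (scale_fun c f) = c * \<phi> f}" for f g c
    by (intro closed_Collect_eq continuous_intros continuous_on_product_coordinates)+
  then have "closed ((\<Inter>f\<in>bounded_continuous. \<Inter>g\<in>bounded_continuous. {\<phi> :: ('s \<Rightarrow> complex) \<Rightarrow> complex. \<phi> (f + g) = \<phi> f + \<phi> g}) \<inter>
      (\<Inter>c. \<Inter>f\<in>bounded_continuous. {\<phi> :: ('s \<Rightarrow> complex) \<Rightarrow> complex. \<phi> (scale_fun c f) = c * \<phi> f}) \<inter>
      {\<phi> :: ('s \<Rightarrow> complex) \<Rightarrow> complex. \<phi> (\<lambda>_. 1) = 1})" (is "closed ?L")
    by (intro closed_Int closed_INT ballI closed_Collect_eq continuous_intros continuous_on_product_coordinates)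
  then have "compact (?L \<inter> PiE UNIV B)" using comp by (rule closed_Int_compact)
  moreover have "means = ?L \<inter> PiE UNIV B"
    by (auto simp: means_def linear_functional_on_def B_def PiE_def Pi_iff split: if_splits)
  ultimately show ?thesis by simp
qed

lemma compact_WAP_means: "compact (WAP_means :: (('s::semitopological_semigroup \<Rightarrow> complex) \<Rightarrow> complex) set)"
proof (rule compact_continuous_image[OF _ compact_means])
  have "continuous_on UNIV (\<lambda>\<phi> :: ('s \<Rightarrow> complex) \<Rightarrow> complex. restrict_WAP \<phi> f)" for f
    by (cases "f \<in> WAP") (auto simp: restrict_WAP_def)
  then have "continuous_on UNIV (restrict_WAP :: (('s \<Rightarrow> complex) \<Rightarrow> complex) \<Rightarrow> _)"
    by (intro continuous_on_coordinatewise_then_product)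
  then show "continuous_on means (restrict_WAP :: (('s \<Rightarrow> complex) \<Rightarrow> complex) \<Rightarrow> _)"
    by (rule continuous_on_subset) simp
qed

abbreviation "TM \<equiv> top_of_set WAP_means"

lemma continuous_map_TM_evaluation: "continuous_map TM euclidean (\<lambda>\<mu>. \<mu> f)"
  by (rule continuous_map_from_subtopology) simp

lemma continuous_map_into_TM:
  assumes "\<And>f. continuous_map T euclidean (\<lambda>z. g z f)" "\<And>z. z \<in> topspace T \<Longrightarrow> g z \<in> WAP_means"
  shows "continuous_map T TM g"
  using assms by (intro continuous_map_into_subtopology) (auto simp: continuous_map_euclidean_coordinatewise)

text \<open>Krein's theorem in disguise: the seminorms are those of uniform convergence on weakly compact sets,
  and still the weak topology on the means is that of pointwise convergence.\<close>

lemma weak_topology_means: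
  "subtopology weakX WAP_means = (TM :: (('s::semitopological_semigroup \<Rightarrow> complex) \<Rightarrow> complex) topology)"
proof -
  have "continuous_map TM weakX (\<lambda>\<mu>. \<mu> :: ('s \<Rightarrow> complex) \<Rightarrow> complex)"
    unfolding dual.continuous_map_into_weak
  proof (intro conjI ballI)
    fix \<phi> :: "(('s \<Rightarrow> complex) \<Rightarrow> complex) \<Rightarrow> complex"
    assume \<phi>: "\<phi> \<in> continuous_dual scale_fun WAP_dual compact_seminorms"
    obtain A C where A: "A \<in> invariant_compact" and C: "0 \<le> C" "\<And>\<mu>. \<mu> \<in> WAP_dual \<Longrightarrow> cmod (\<phi> \<mu>) \<le> C * compact_seminorm A \<mu>"
      by (rule compact_seminorms_dominated[OF \<phi>]) blast
    have lin: "linear_functional_on scale_fun WAP_dual \<phi>" using \<phi> by (simp add: continuous_dual_def)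
    obtain M where M: "\<forall>a\<in>A. sup_norm a \<le> M" and AW: "A \<subseteq> WAP" using A by (auto simp: invariant_compact_def)
    have top: "topspace (subtopology weakC A) = A" using AW WAP_bounded_continuous by auto
    \<comment> \<open>Here \<open>H\<close> is the pairing \<open>\<mu> a\<close>, separately
      continuous on the means times the weakly compact \<open>A\<close>. By linearity and the
      seminorm of \<open>A\<close>, \<open>\<phi>\<close> is dominated by the supremum over
      \<open>A\<close>.\<close>
    have "continuous_map TM euclidean \<phi>"
    proof (rule dominated_functional_continuous[where H = "\<lambda>\<mu> a. \<mu> a" and TA = "subtopology weakC A" and M = M and C = C])
      show "compact_space TM" using compact_WAP_means by (intro compact_space_subtopology) simp
      show "compact_space (subtopology weakC A)" by (rule compact_space_subtopology[OF invariant_compactD(3)[OF A]])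
      show "continuous_map TM euclidean (\<lambda>\<mu>. \<mu> a)" for a by (rule continuous_map_TM_evaluation)
      show "continuous_map (subtopology weakC A) euclidean \<mu>" if "\<mu> \<in> topspace TM" for \<mu> :: "('s \<Rightarrow> complex) \<Rightarrow> complex"
        using that WAP_means_dual by (intro WAP_dual_weakly_continuous[OF _ AW]) auto
      show "cmod (\<mu> a) \<le> M" if "\<mu> \<in> topspace TM" "a \<in> topspace (subtopology weakC A)" for \<mu> a
        using WAP_means_norm[of \<mu> a] that M AW unfolding top by force
    next
      fix N and \<kappa> :: "nat \<Rightarrow> ('s \<Rightarrow> complex) \<Rightarrow> complex" and c :: "nat \<Rightarrow> complex" and e :: real
      assume \<kappa>: "\<And>n. \<kappa> n \<in> topspace TM"
        and le: "\<And>a. a \<in> topspace (subtopology weakC A) \<Longrightarrow> cmod (\<Sum>n<N. c n * \<kappa> n a) \<le> e"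
      have \<kappa>D: "\<kappa> n \<in> WAP_dual" for n using \<kappa>[of n] WAP_means_dual by auto
      have sum: "(\<Sum>n<N. scale_fun (c n) (\<kappa> n)) a = (\<Sum>n<N. c n * \<kappa> n a)" for a
        by (induction N) (auto simp: scale_fun_def)
      have mem: "(\<Sum>n<N. scale_fun (c n) (\<kappa> n)) \<in> WAP_dual"
        by (intro complex_function.subspace_sum subspace_WAP_dual dual.carrier_closed \<kappa>D)
      have "(\<Sum>n<N. c n * \<phi> (\<kappa> n)) = \<phi> (\<Sum>n<N. scale_fun (c n) (\<kappa> n))"
        by (rule dual.linear_functional_on_sum[OF lin \<kappa>D, symmetric])
      also have "cmod \<dots> \<le> C * compact_seminorm A (\<Sum>n<N. scale_fun (c n) (\<kappa> n))" by (rule C(2)[OF mem])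
      also have "\<dots> \<le> C * e"
        by (intro mult_left_mono C compact_seminorm_least[OF A]) (unfold sum, rule le, simp only: top)
      finally show "cmod (\<Sum>n<N. c n * \<phi> (\<kappa> n)) \<le> C * e" .
    qed
    then show "continuous_map TM euclidean (\<lambda>\<mu>. \<phi> \<mu>)" .
  qed (use WAP_means_dual in auto)
  then have "continuous_map TM (subtopology weakX WAP_means) (id :: _ \<Rightarrow> ('s \<Rightarrow> complex) \<Rightarrow> complex)"
    by (auto simp: id_def continuous_map_in_subtopology)
  moreover have "continuous_map (subtopology weakX WAP_means) TM (id :: _ \<Rightarrow> ('s \<Rightarrow> complex) \<Rightarrow> complex)"
  proof -
    have "continuous_map (subtopology weakX WAP_means) euclidean (\<lambda>\<mu>. \<mu> f)" for f :: "'s \<Rightarrow> complex"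
    proof (cases "f \<in> WAP")
      case True
      then obtain A where A: "A \<in> invariant_compact" "f \<in> A" by (rule invariant_compact_exists)
      have "(\<lambda>\<mu>. \<mu> f) \<in> continuous_dual scale_fun WAP_dual compact_seminorms"
      proof (rule dual.continuous_dualI[of _ "compact_seminorm A" 1])
        show "cmod (\<mu> f) \<le> 1 * compact_seminorm A \<mu>" if "\<mu> \<in> WAP_dual" for \<mu>
          using compact_seminorm_upper[OF that A] by simp
      qed (use A in \<open>auto simp: linear_functional_on_def scale_fun_def compact_seminorms_def\<close>)
      then show ?thesis by (intro continuous_map_from_subtopology dual.continuous_map_weak_functional)
    next
      case False
      have "continuous_map (subtopology weakX WAP_means) euclidean (\<lambda>\<mu> :: ('s \<Rightarrow> complex) \<Rightarrow> complex. 0 :: complex)" by simp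
      then show ?thesis
        by (rule continuous_map_eq) (use False in \<open>auto simp: WAP_dual_zero\<close>)
    qed
    then show ?thesis unfolding id_def by (rule continuous_map_into_TM) simp
  qed
  moreover have "topspace (subtopology weakX WAP_means) = topspace (TM :: (('s \<Rightarrow> complex) \<Rightarrow> complex) topology)"
    using WAP_means_dual by auto
  ultimately show ?thesis
    unfolding topology_eq
    using topology_finer_continuous_id[of "subtopology weakX WAP_means" "TM :: (('s \<Rightarrow> complex) \<Rightarrow> complex) topology"]
      topology_finer_continuous_id[of "TM :: (('s \<Rightarrow> complex) \<Rightarrow> complex) topology" "subtopology weakX WAP_means"]
    by metis
qed

section \<open>The action on the means and its fixed point\<close>

definition mean_action :: "'s::semitopological_semigroup \<Rightarrow> (('s \<Rightarrow> complex) \<Rightarrow> complex) \<Rightarrow> ('s \<Rightarrow> complex) \<Rightarrow> complex" where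
  "mean_action s \<mu> = restrict_WAP (\<lambda>f. \<mu> (left_translate s f))"

lemma mean_action_apply: "f \<in> WAP \<Longrightarrow> mean_action s \<mu> f = \<mu> (left_translate s f)"
  by (simp add: mean_action_def restrict_WAP_def)

lemma mean_action_mem:
  assumes "\<mu> \<in> WAP_means"
  shows "mean_action s \<mu> \<in> WAP_means"
proof -
  obtain \<phi> where \<phi>: "\<phi> \<in> means" "\<mu> = restrict_WAP \<phi>" using assms by auto
  define \<psi> where "\<psi> = (\<lambda>f. if f \<in> bounded_continuous then \<phi> (left_translate s f) else 0)"
  have one: "left_translate s (\<lambda>_. 1) = (\<lambda>_. 1)" by (simp add: left_translate_def)
  have "\<psi> \<in> means"
    unfolding means_def
  proof (intro CollectI conjI ballI allI impI)
    show "linear_functional_on scale_fun bounded_continuous \<psi>"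
      using \<phi>(1)
      by (auto simp: means_def linear_functional_on_def \<psi>_def left_translate_linear
          left_translate_bounded_continuous BC.carrier_closed)
    fix f :: "'a \<Rightarrow> complex" assume f: "f \<in> bounded_continuous"
    have "cmod (\<phi> (left_translate s f)) \<le> sup_norm (left_translate s f)"
      using \<phi>(1) left_translate_bounded_continuous[OF f] by (auto simp: means_def)
    then show "cmod (\<psi> f) \<le> sup_norm f" using sup_norm_left_translate[OF f, of s] f by (simp add: \<psi>_def)
  qed (use \<phi>(1) one const_bounded_continuous in \<open>auto simp: \<psi>_def means_def\<close>)
  moreover have "mean_action s \<mu> = restrict_WAP \<psi>"
    by (auto simp: mean_action_def \<phi>(2) \<psi>_def restrict_WAP_def fun_eq_iff left_translate_WAP WAP_bounded_continuous)
  ultimately show ?thesis by blast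
qed

text \<open>The orbit of \<open>f\<close> stays in a weakly compact set, on which the weak topology
  is that of pointwise convergence; pointwise, \<open>f (s * t)\<close> is continuous in
  \<open>s\<close>. Functionals in \<open>WAP_dual\<close> are weakly continuous there.\<close>

lemma continuous_mean_orbit:
  fixes f :: "'s::semitopological_semigroup \<Rightarrow> complex"
  assumes \<mu>: "\<mu> \<in> WAP_dual" and f: "f \<in> WAP"
  shows "continuous_map euclidean euclidean (\<lambda>s. \<mu> (left_translate s f))"
proof -
  obtain A where A: "A \<in> invariant_compact" "f \<in> A" by (rule invariant_compact_exists[OF f])
  have AW: "A \<subseteq> WAP" by (rule invariant_compactD(2)[OF A(1)])
  have "continuous_map euclidean (subtopology weakC A) (\<lambda>s. left_translate s f)"
  proof (rule continuous_map_into_compact)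
    show "compact_space (subtopology weakC A)" by (rule compact_space_subtopology[OF invariant_compactD(3)[OF A(1)]])
    show "Hausdorff_space (euclidean :: ('s \<Rightarrow> complex) topology)"
      by (simp add: Hausdorff_space_product_topology flip: euclidean_product_topology)
    show "continuous_map (subtopology weakC A) (euclidean :: ('s \<Rightarrow> complex) topology) (\<lambda>x. x)"
      unfolding continuous_map_euclidean_coordinatewise
      by (intro allI continuous_map_from_subtopology continuous_map_weakC_evaluation)
    have "continuous_on UNIV (\<lambda>s. f (s * t))" for t
      by (rule continuous_on_compose2[of UNIV f UNIV "\<lambda>s. s * t", OF _ continuous_translations(2)])
         (use WAP_bounded_continuous[OF f] in \<open>auto simp: bounded_continuous_def\<close>)
    then show "continuous_map euclidean (euclidean :: ('s \<Rightarrow> complex) topology) (\<lambda>s. left_translate s f)"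
      unfolding continuous_map_euclidean_coordinatewise by (simp add: left_translate_def)
    show "(\<lambda>s. left_translate s f) ` topspace euclidean \<subseteq> topspace (subtopology weakC A)"
      using invariant_compactD(4)[OF A(1) A(2)] AW WAP_bounded_continuous by auto
  qed
  from continuous_map_compose[OF this WAP_dual_weakly_continuous[OF \<mu> AW]]
  show ?thesis by (simp add: o_def)
qed

lemma dynamical_system_means:
  "dynamical_system (mean_action :: 's::semitopological_semigroup \<Rightarrow> _) TM"
proof unfold_locales
  fix s t :: 's and \<mu> :: "('s \<Rightarrow> complex) \<Rightarrow> complex"
  show "mean_action s (mean_action t \<mu>) = mean_action (s * t) \<mu>"
    by (auto simp: mean_action_def restrict_WAP_def fun_eq_iff left_translate_left_translate left_translate_WAP)
next
  fix \<mu> :: "('s \<Rightarrow> complex) \<Rightarrow> complex" assume "\<mu> \<in> topspace TM"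
  then have \<mu>: "\<mu> \<in> WAP_means" by simp
  have "continuous_map euclidean euclidean (\<lambda>s. mean_action s \<mu> f)" for f
    using continuous_mean_orbit[of \<mu> f] subsetD[OF WAP_means_dual \<mu>]
    by (cases "f \<in> WAP") (auto simp: mean_action_def restrict_WAP_def)
  then show "continuous_map euclidean TM (\<lambda>s. mean_action s \<mu>)"
    by (rule continuous_map_into_TM) (rule mean_action_mem[OF \<mu>])
next
  fix s :: 's
  have "continuous_map TM euclidean (\<lambda>\<mu>. mean_action s \<mu> f)" for f :: "'s \<Rightarrow> complex"
    using continuous_map_TM_evaluation[of "left_translate s f"]
    by (cases "f \<in> WAP") (auto simp: mean_action_def restrict_WAP_def)
  then show "continuous_map TM TM (mean_action s)"
    by (rule continuous_map_into_TM) (intro mean_action_mem, simp)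
qed

text \<open>Fix \<open>f \<in> WAP\<close> in an invariant compact \<open>A\<close>. The functions
  \<open>\<mu>\<close> \<mapsto> \<open>\<mu> a\<close> with \<open>a \<in> A\<close> form a
  compact, hence closed, set \<open>J\<close> under pointwise convergence. It contains what each
  translation does to \<open>f\<close>, so a limit \<open>g\<close> also satisfies
  \<open>g \<mu> f = \<mu> a\<close> for one \<open>a\<close> common to all \<open>\<mu>\<close>,
  and evaluation at \<open>a\<close> is continuous.\<close>

lemma enveloping_means_continuous:
  fixes g :: "(('s::semitopological_semigroup \<Rightarrow> complex) \<Rightarrow> complex) \<Rightarrow> (('s \<Rightarrow> complex) \<Rightarrow> complex)"
  assumes g: "g \<in> enveloping_semigroup mean_action TM"
  shows "continuous_map TM TM g"
proof -
  let ?P = "product_topology (\<lambda>_. TM) WAP_means :: ((('s \<Rightarrow> complex) \<Rightarrow> complex) \<Rightarrow> (('s \<Rightarrow> complex) \<Rightarrow> complex)) topology"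
  let ?R = "range (\<lambda>s. restrict (mean_action s) WAP_means)"
  have gcl: "g \<in> ?P closure_of ?R" using g by (simp add: enveloping_semigroup_def)
  have gP: "g \<in> topspace ?P" by (rule subsetD[OF closure_of_subset_topspace gcl])
  then have gmem: "g \<mu> \<in> WAP_means" if "\<mu> \<in> WAP_means" for \<mu> using that by (auto simp: PiE_iff)
  have "continuous_map TM euclidean (\<lambda>\<mu>. g \<mu> f)" for f
  proof (cases "f \<in> WAP")
    case True
    then obtain A where A: "A \<in> invariant_compact" "f \<in> A" by (rule invariant_compact_exists)
    define J where "J = (\<lambda>a. \<lambda>\<mu>\<in>WAP_means. \<mu> a) ` A"
    have "compactin (product_topology (\<lambda>_. euclidean) WAP_means) J"
    proof -
      have "continuous_map (subtopology weakC A) (product_topology (\<lambda>_. euclidean) WAP_means) (\<lambda>a. \<lambda>\<mu>\<in>WAP_means. \<mu> a :: complex)"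
        unfolding continuous_map_componentwise
        using WAP_dual_weakly_continuous[OF _ invariant_compactD(2)[OF A(1)]] WAP_means_dual by (auto simp: subset_iff)
      moreover have "compactin (subtopology weakC A) A"
        using invariant_compactD(3)[OF A(1)] by (simp add: compactin_subtopology)
      ultimately show ?thesis unfolding J_def by (rule image_compactin[rotated])
    qed
    then have "closedin (product_topology (\<lambda>_. euclidean) WAP_means) J"
      by (rule compactin_imp_closedin[rotated]) (simp add: Hausdorff_space_product_topology)
    moreover have "continuous_map ?P (product_topology (\<lambda>_. euclidean) WAP_means) (\<lambda>h. \<lambda>\<mu>\<in>WAP_means. h \<mu> f)"
      unfolding continuous_map_componentwise
    proof (intro conjI ballI)
      fix \<mu> :: "('s \<Rightarrow> complex) \<Rightarrow> complex" assume \<mu>: "\<mu> \<in> WAP_means"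
      have "continuous_map ?P euclidean (\<lambda>h. h \<mu> f)"
        using continuous_map_compose[OF continuous_map_product_projection[OF \<mu>, of "\<lambda>_. TM"] continuous_map_TM_evaluation[of f]]
        by (simp add: o_def)
      then show "continuous_map ?P euclidean (\<lambda>h. (\<lambda>\<mu>\<in>WAP_means. h \<mu> f) \<mu>)" using \<mu> by simp
    qed auto
    ultimately have "closedin ?P {h \<in> topspace ?P. (\<lambda>\<mu>\<in>WAP_means. h \<mu> f) \<in> J}"
      by (rule closedin_continuous_map_preimage[rotated])
    moreover have "?R \<subseteq> {h \<in> topspace ?P. (\<lambda>\<mu>\<in>WAP_means. h \<mu> f) \<in> J}"
    proof clarify
      fix s
      have "(\<lambda>\<mu>\<in>WAP_means. restrict (mean_action s) WAP_means \<mu> f) = (\<lambda>\<mu>\<in>WAP_means. \<mu> (left_translate s f))"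
        using True by (auto simp: fun_eq_iff restrict_def mean_action_apply)
      then have "(\<lambda>\<mu>\<in>WAP_means. restrict (mean_action s) WAP_means \<mu> f) \<in> J"
        using invariant_compactD(4)[OF A(1) A(2)] by (auto simp: J_def)
      then show "restrict (mean_action s) WAP_means \<in> topspace ?P \<and>
          (\<lambda>\<mu>\<in>WAP_means. restrict (mean_action s) WAP_means \<mu> f) \<in> J"
        using mean_action_mem by (auto simp: PiE_iff)
    qed
    ultimately have "?P closure_of ?R \<subseteq> {h \<in> topspace ?P. (\<lambda>\<mu>\<in>WAP_means. h \<mu> f) \<in> J}"
      by (intro closure_of_minimal)
    then have "(\<lambda>\<mu>\<in>WAP_means. g \<mu> f) \<in> J" using gcl by blast
    then obtain a where a: "(\<lambda>\<mu>\<in>WAP_means. g \<mu> f) = (\<lambda>\<mu>\<in>WAP_means. \<mu> a)" by (auto simp: J_def)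
    have ga: "g \<mu> f = \<mu> a" if "\<mu> \<in> WAP_means" for \<mu> using fun_cong[OF a, of \<mu>] that by simp
    show ?thesis
      by (rule continuous_map_eq[OF continuous_map_TM_evaluation[of a]]) (simp add: ga)
  next
    case False
    have zero: "g \<mu> f = 0" if "\<mu> \<in> WAP_means" for \<mu>
      using WAP_dual_zero[OF subsetD[OF WAP_means_dual gmem[OF that]] False] .
    show ?thesis by (rule continuous_map_eq[of TM euclidean "\<lambda>_. 0"]) (simp_all add: zero)
  qed
  then show ?thesis
    by (rule continuous_map_into_TM) (intro gmem, simp)
qed

lemma convex_WAP_means: "convex_on_scale scale_fun WAP_means"
  unfolding convex_on_scale_def
proof (intro ballI allI impI)
  fix \<mu> \<nu> :: "('a \<Rightarrow> complex) \<Rightarrow> complex" and t :: real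
  assume "\<mu> \<in> WAP_means" "\<nu> \<in> WAP_means" and t: "0 \<le> t \<and> t \<le> 1"
  then obtain \<phi> \<psi> where \<phi>: "\<phi> \<in> means" "\<mu> = restrict_WAP \<phi>" and \<psi>: "\<psi> \<in> means" "\<nu> = restrict_WAP \<psi>" by auto
  define \<theta> where "\<theta> = (\<lambda>f. of_real (1 - t) * \<phi> f + of_real t * \<psi> f)"
  have "\<theta> \<in> means"
    unfolding means_def
  proof (intro CollectI conjI ballI allI impI)
    show "linear_functional_on scale_fun bounded_continuous \<theta>"
      using \<phi>(1) \<psi>(1) by (auto simp: means_def linear_functional_on_def \<theta>_def algebra_simps)
    fix f :: "'a \<Rightarrow> complex" assume f: "f \<in> bounded_continuous"
    have "cmod (\<theta> f) \<le> cmod (of_real (1 - t) * \<phi> f) + cmod (of_real t * \<psi> f)"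
      unfolding \<theta>_def by (rule norm_triangle_ineq)
    also have "\<dots> = (1 - t) * cmod (\<phi> f) + t * cmod (\<psi> f)" using t by (simp only: norm_mult norm_of_real) simp
    also have "\<dots> \<le> (1 - t) * sup_norm f + t * sup_norm f"
      using \<phi>(1) \<psi>(1) f t by (intro add_mono mult_left_mono) (auto simp: means_def)
    finally show "cmod (\<theta> f) \<le> sup_norm f" by (simp add: algebra_simps)
  qed (use \<phi>(1) \<psi>(1) in \<open>auto simp: \<theta>_def means_def\<close>)
  moreover have "scale_fun (of_real (1 - t)) \<mu> + scale_fun (of_real t) \<nu> = restrict_WAP \<theta>"
    by (auto simp: fun_eq_iff scale_fun_def restrict_WAP_def \<theta>_def \<phi>(2) \<psi>(2))
  ultimately show "scale_fun (of_real (1 - t)) \<mu> + scale_fun (of_real t) \<nu> \<in> WAP_means" by blast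
qed

text \<open>Moving the action onto the function replaces \<open>a \<in> A\<close> by a left
  translate, which is again in \<open>A\<close>, so the supremum cannot grow.\<close>

lemma nonexpansive_means: "nonexpansive compact_seminorms mean_action WAP_means"
  unfolding nonexpansive_def
proof (intro ballI allI)
  fix p :: "(('a \<Rightarrow> complex) \<Rightarrow> complex) \<Rightarrow> real" and s and \<mu> \<nu> :: "('a \<Rightarrow> complex) \<Rightarrow> complex"
  assume "p \<in> compact_seminorms" and \<mu>: "\<mu> \<in> WAP_means" and \<nu>: "\<nu> \<in> WAP_means"
  then obtain A where A: "A \<in> invariant_compact" "p = compact_seminorm A" by (auto simp: compact_seminorms_def)
  have D: "\<mu> - \<nu> \<in> WAP_dual" using \<mu> \<nu> WAP_means_dual by (intro dual.carrier_closed) auto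
  show "p (mean_action s \<mu> - mean_action s \<nu>) \<le> p (\<mu> - \<nu>)"
    unfolding A(2)
  proof (rule compact_seminorm_least[OF A(1)])
    fix a assume a: "a \<in> A"
    have "a \<in> WAP" using a invariant_compactD(2)[OF A(1)] by blast
    then have "cmod ((mean_action s \<mu> - mean_action s \<nu>) a) = cmod ((\<mu> - \<nu>) (left_translate s a))"
      by (simp add: mean_action_apply)
    also have "\<dots> \<le> compact_seminorm A (\<mu> - \<nu>)"
      by (rule compact_seminorm_upper[OF D A(1) invariant_compactD(4)[OF A(1) a]])
    finally show "cmod ((mean_action s \<mu> - mean_action s \<nu>) a) \<le> compact_seminorm A (\<mu> - \<nu>)" .
  qed
qed

lemma left_invariant_mean_exists:
  assumes F: "fixed_point_property TYPE('s::semitopological_semigroup) TYPE(complex) TYPE(('s \<Rightarrow> complex) \<Rightarrow> complex)"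
  shows "\<exists>\<mu>. left_invariant_mean (WAP :: ('s \<Rightarrow> complex) set) \<mu>"
proof -
  have "compactin (subtopology weakX WAP_means) (WAP_means :: (('s \<Rightarrow> complex) \<Rightarrow> complex) set)"
    unfolding weak_topology_means using compact_WAP_means by (simp add: compactin_subtopology)
  then have comp: "compactin weakX (WAP_means :: (('s \<Rightarrow> complex) \<Rightarrow> complex) set)"
    by (simp add: compactin_subtopology)
  obtain \<mu> :: "('s \<Rightarrow> complex) \<Rightarrow> complex" where \<mu>: "\<mu> \<in> WAP_means" and fix_\<mu>: "\<And>s. mean_action s \<mu> = \<mu>"
    using F[unfolded fixed_point_property_def, rule_format, OF dual.locally_convex_space_axioms
        WAP_means_nonempty comp convex_WAP_means, unfolded weak_topology_means,
        OF dynamical_system_means nonexpansive_means enveloping_means_continuous] by blast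
  have \<mu>D: "\<mu> \<in> WAP_dual" using \<mu> WAP_means_dual by blast
  have one: "sup_norm (\<lambda>_ :: 's. 1) \<le> 1" by (rule sup_norm_le) simp
  have "left_invariant_mean WAP \<mu>"
    unfolding left_invariant_mean_def
  proof (intro conjI allI ballI)
    obtain C where "0 \<le> C" "\<And>f. f \<in> WAP \<Longrightarrow> cmod (\<mu> f) \<le> C * sup_norm f" by (rule WAP_dual_bounded[OF \<mu>D]) blast
    then show "\<mu> \<in> continuous_dual scale_fun WAP {sup_norm}"
      unfolding bounded_functional_iff[OF WAP.locally_convex_space_axioms] using WAP_dual_linear[OF \<mu>D] by blast
    show "\<mu> (\<lambda>_. 1) = 1" by (rule WAP_means_one[OF \<mu>])
    show "\<mu> (left_translate s f) = \<mu> f" if "f \<in> WAP" for s f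
      using mean_action_apply[OF that, of s \<mu>] fix_\<mu> by simp
    show "functional_norm WAP \<mu> = 1"
    proof (rule antisym)
      show "functional_norm WAP \<mu> \<le> 1"
        unfolding functional_norm_def
        by (rule cSUP_least) (use one const_WAP WAP_means_norm[OF \<mu>] in \<open>auto intro: order_trans\<close>)
      \<comment> \<open>The norm 1 is attained at the constant function 1.\<close>
      have "cmod (\<mu> (\<lambda>_. 1)) \<le> functional_norm WAP \<mu>"
        unfolding functional_norm_def
        by (rule cSUP_upper) (use one const_WAP WAP_means_norm[OF \<mu>] in \<open>auto intro!: bdd_aboveI[of _ 1] intro: order_trans\<close>)
      then show "1 \<le> functional_norm WAP \<mu>" using WAP_means_one[OF \<mu>] by simp
    qed
  qed
  then show ?thesis by blast
qed

text \<open>A mean is recovered from the complex property on the type of functionals; the real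
  property on that type leads there by restriction of scalars, so both equivalences share one
  converse.\<close>

theorem theorem3p6:
  shows
    "((\<exists>\<mu>. left_invariant_mean (WAP :: ('s::semitopological_semigroup \<Rightarrow> complex) set) \<mu>) \<longleftrightarrow>
        fixed_point_property TYPE('s) TYPE(real) TYPE(('s \<Rightarrow> complex) \<Rightarrow> complex))
     \<and> ((\<exists>\<mu>. left_invariant_mean (WAP :: ('s \<Rightarrow> complex) set) \<mu>) \<longleftrightarrow>
        fixed_point_property TYPE('s) TYPE(complex) TYPE(('s \<Rightarrow> complex) \<Rightarrow> complex))
     \<and> ((\<exists>\<mu>. left_invariant_mean (WAP :: ('s \<Rightarrow> complex) set) \<mu>) \<longrightarrow>
        fixed_point_property TYPE('s) TYPE(real) TYPE('x::ab_group_add)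
        \<and> fixed_point_property TYPE('s) TYPE(complex) TYPE('x))"
  by (intro conjI iffI impI;
      ((elim exE, (rule fixed_point_property_real, assumption
          | rule fixed_point_property_complex, rule fixed_point_property_real, assumption))
        | (rule left_invariant_mean_exists, (assumption | rule fixed_point_property_complex, assumption))))

end
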